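(* Let $k_1,k_2,k_3,k_4,k_5>0$ and let $V$ be the strict control Lyapunov function $$V(\Theta)=\tfrac12\left(k_1\rho^2+k_2\delta^2+k_3\tan^2\zeta+k_4e_1^2+k_5e_2^2\right),$$ where $$e_1=\gamma+\arctan(k_2\delta\cos\zeta),\qquad e_2=\theta+\arctan(\eta(\delta,\zeta)),\qquad \eta(\delta,\zeta)=\frac{k_3\sin\zeta+\tan\zeta}{\sqrt{1+k_2^2\delta^2\cos^2\zeta}}.$$ Consider on the domain $\mathcal D$ the control system with state $\Theta=[\rho,\delta,\gamma,\zeta,\theta]^\top$ and inputs $(v,q,r)$, $$\dot\Theta=\bar g_1(\Theta)\frac{v}{\rho}+g_2(\Theta)\,q+\bar g_3(\Theta)\frac{r}{\cos\theta},$$ with $$\bar g_1(\Theta)=\begin{bmatrix}\rho(\sin\theta\sin\zeta-\cos\theta\cos\zeta\cos\gamma)\\ \frac{\cos\theta}{\cos\zeta}\sin\gamma\\ \frac{\cos\theta}{\cos\zeta}\sin\gamma\\ \cos\theta\sin\zeta\cos\gamma+\sin\theta\cos\zeta\\ 0\end{bmatrix},\quad g_2(\Theta)=\begin{bmatrix}0\\0\\0\\0\\1\end{bmatrix},\quad \bar g_3(\Theta)=\begin{bmatrix}0\\0\\-1\\0\\0\end{bmatrix}.$$ For $i\in\{1,2,3\}$ let $w_i>0$ be finite or infinite, let $\mu_i\in\mathcal K_\infty[0,w_i)$ have derivative $\mu_i'\in\mathcal K_\infty[0,w_i)$, and let $\varepsilon_i=\varepsilon_i(\Theta)$ be continuous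 positive scalar-valued functions. Put $\nu_1(\Theta)=L_{\bar g_1}V(\Theta)$, $\nu_2(\Theta)=L_{g_2}V(\Theta)$, $\nu_3(\Theta)=L_{\bar g_3}V(\Theta)$. Then the cost functional $$J=\int_0^\infty\left[l(\Theta)+\mu_1\!\left(\frac{|v|}{\varepsilon_1\rho}\right)+\mu_2\!\left(\frac{|q|}{\varepsilon_2}\right)+\mu_3\!\left(\frac{|r|}{\varepsilon_3|\cos\theta|}\right)\right]dt,$$ where $$l(\Theta)=\ell\mu_1(\varepsilon_1|\nu_1|)+\ell\mu_2(\varepsilon_2|\nu_2|)+\ell\mu_3(\varepsilon_3|\nu_3|),$$ is, for all initial conditions on $\mathcal D$, minimized by the feedback law $$v^*=-\rho\,\varepsilon_1(\mu_1')^{-1}(\varepsilon_1|\nu_1|)\,\mathrm{sgn}(\nu_1),$$ $$q^*=-\varepsilon_2(\mu_2')^{-1}(\varepsilon_2|\nu_2|)\,\mathrm{sgn}(\nu_2),$$ $$r^*=-\cos(\theta)\,\varepsilon_3(\mu_3')^{-1}(\varepsilon_3|\nu_3|)\,\mathrm{sgn}(\nu_3).$$ Additionally, the feedback $$v=-\rho\,\varepsilon_1\frac{\ell\mu_1(\varepsilon_1|\nu_1|)}{\varepsilon_1|\nu_1|}\,\mathrm{sgn}(\nu_1),\qquad q=-\varepsilon_2\frac{\ell\mu_2(\varepsilon_2|\nu_2|)}{\varepsilon_2|\nu_2|}\,\mathrm{sgn}(\nu_2),\qquad r=-\cos(\theta)\,\varepsilon_3\frac{\ell\mu_3(\varepsilon_3|\nu_3|)}{\varepsilon_3|\nu_3|}\,\mathrm{sgn}(\nu_3)$$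 is continuous in $(\nu_1,\nu_2,\nu_3)$ and renders $\Theta=0$ globally asymptotically stable (GAS) on $\mathcal D$.
   Context: Setting. The system is the kinematic model of a 3D nonholonomic vehicle in spherical coordinates: $\rho$ is the distance to the target, $\delta$ the azimuth angle, $\gamma$ the line-of-sight angle about the $z$-axis, $\zeta$ the elevation angle, $\theta$ the pitch angle; the inputs are surge velocity $v$, pitch rate $q$, yaw rate $r$. The yaw rate is always of the form $r=\tilde r\cos\theta$, where $\tilde r$ is the effective input, and $r/\cos\theta$ denotes $\tilde r$ (also where $\cos\theta=0$). Domain and metric. $\mathcal T=\{(\delta,\gamma,\zeta,\theta)\in\mathbb R^4:|\zeta|<\pi/2\}$, $\mathcal D=\{\rho>0\}\times\mathcal T$, $\Sigma=\{\rho\ge0\}\times\mathcal T$, and $$|\Theta|_{\mathcal D}=\rho+|\delta|+|\gamma|+|\tan\zeta|+|\theta|.$$ GAS on $\mathcal D$. For feedback laws $v,q,r$ that are continuous on $\mathcal D$ with respect to its metric, the point $\Theta=0$ is called globally asymptotically stable (GAS) on $\mathcal D$ if there exists a class $\mathcal{KL}$ function $\beta$ such that $|\Theta(t)|_{\mathcal D}\le\beta(|\Theta(t_0)|_{\mathcal D},t-t_0)$ for all $t\ge t_0$ (along closed-loop solutions). Strict CLF. A continuously differentiable function $V$ of $\Theta$ is a (strict) control Lyapunov function for the system if (i) there are class $\mathcal K$ functions $\bar\alpha_1,\bar\alpha_2$ with $\bar\alpha_1(|\Theta|_{\mathcal D})\le V(\Theta)\le\bar\alpha_2(|\Theta|_{\mathcal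 D})$ for all $\Theta\in\Sigma$, and (ii) for all $\Theta\ne0$ in $\Sigma$ there exists $(v/\rho,\,q,\,r/\cos\theta)\in\mathbb R^3$ such that $\dot V(\Theta)<0$. That the $V$ in the claim is a strict CLF for all $k_1,\dots,k_5>0$ is a result of earlier work. Notation. $L_gV(\Theta)=\nabla V(\Theta)\cdot g(\Theta)$ is the Lie derivative. A function is of class $\mathcal K_\infty[0,w)$ ($w>0$ finite or infinite) if it is continuous and strictly increasing on $[0,w)$, vanishes at $0$, and tends to $+\infty$ as its argument tends to $w$. For $\mu\in\mathcal K_\infty[0,w)$ with $\mu'\in\mathcal K_\infty[0,w)$, the Legendre–Fenchel transform is $\ell\mu(s)=\int_0^s(\mu')^{-1}(\tau)\,d\tau$, where $(\mu')^{-1}$ is the inverse function of $\mu'=d\mu/ds$. The expressions $\frac{\ell\mu_i(\varepsilon_i|\nu_i|)}{\varepsilon_i|\nu_i|}\mathrm{sgn}(\nu_i)$ are understood at $\nu_i=0$ by their limiting value $0$.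
   Formalization: The functions ε_i are assumed continuous and positive on Σ (including ρ=0 and Θ=0), not only on D; with positivity on D alone the GAS claim fails, e.g. for ε_i=ρ and μ_i(s)=s²/2. *)

theory Defs
  imports "HOL-Analysis.Analysis"
begin

section \<open>State space and inputs\<close>

text \<open>A state is \<open>(\<rho>, \<delta>, \<gamma>, \<zeta>, \<theta>)\<close>. An input is \<open>(v, q, s)\<close>, where \<open>s\<close> is the effective yaw
  input: the physical yaw rate is \<open>r = s * cos \<theta>\<close>, so \<open>r / cos \<theta>\<close> is \<open>s\<close> also where
  \<open>cos \<theta> = 0\<close>.\<close>

type_synonym state = "real \<times> real \<times> real \<times> real \<times> real"
type_synonym control = "real \<times> real \<times> real"

definition dom_D :: "state set" where
  "dom_D = {(\<rho>, \<delta>, \<gamma>, \<zeta>, \<theta>). 0 < \<rho> \<and> \<bar>\<zeta>\<bar> < pi / 2}"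

definition dom_Sigma :: "state set" where
  "dom_Sigma = {(\<rho>, \<delta>, \<gamma>, \<zeta>, \<theta>). 0 \<le> \<rho> \<and> \<bar>\<zeta>\<bar> < pi / 2}"

definition norm_D :: "state \<Rightarrow> real" where
  "norm_D = (\<lambda>(\<rho>, \<delta>, \<gamma>, \<zeta>, \<theta>). \<rho> + \<bar>\<delta>\<bar> + \<bar>\<gamma>\<bar> + \<bar>tan \<zeta>\<bar> + \<bar>\<theta>\<bar>)"

definition g1_bar :: "state \<Rightarrow> state" where
  "g1_bar = (\<lambda>(\<rho>, \<delta>, \<gamma>, \<zeta>, \<theta>).
     (\<rho> * (sin \<theta> * sin \<zeta> - cos \<theta> * cos \<zeta> * cos \<gamma>),
      cos \<theta> / cos \<zeta> * sin \<gamma>,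
      cos \<theta> / cos \<zeta> * sin \<gamma>,
      cos \<theta> * sin \<zeta> * cos \<gamma> + sin \<theta> * cos \<zeta>,
      0))"

definition g2 :: "state \<Rightarrow> state" where
  "g2 = (\<lambda>_. (0, 0, 0, 0, 1))"

definition g3_bar :: "state \<Rightarrow> state" where
  "g3_bar = (\<lambda>_. (0, 0, -1, 0, 0))"

definition vehicle :: "state \<Rightarrow> control \<Rightarrow> state" where
  "vehicle x = (\<lambda>(v, q, s). (v / fst x) *\<^sub>R g1_bar x + q *\<^sub>R g2 x + s *\<^sub>R g3_bar x)"

section \<open>The control Lyapunov function\<close>

definition e1 :: "(nat \<Rightarrow> real) \<Rightarrow> state \<Rightarrow> real" where
  "e1 k = (\<lambda>(\<rho>, \<delta>, \<gamma>, \<zeta>, \<theta>). \<gamma> + arctan (k 2 * \<delta> * cos \<zeta>))"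

definition eta :: "(nat \<Rightarrow> real) \<Rightarrow> real \<Rightarrow> real \<Rightarrow> real" where
  "eta k \<delta> \<zeta> = (k 3 * sin \<zeta> + tan \<zeta>) / sqrt (1 + (k 2)\<^sup>2 * \<delta>\<^sup>2 * (cos \<zeta>)\<^sup>2)"

definition e2 :: "(nat \<Rightarrow> real) \<Rightarrow> state \<Rightarrow> real" where
  "e2 k = (\<lambda>(\<rho>, \<delta>, \<gamma>, \<zeta>, \<theta>). \<theta> + arctan (eta k \<delta> \<zeta>))"

definition clf :: "(nat \<Rightarrow> real) \<Rightarrow> state \<Rightarrow> real" where
  "clf k = (\<lambda>(\<rho>, \<delta>, \<gamma>, \<zeta>, \<theta>).
     (k 1 * \<rho>\<^sup>2 + k 2 * \<delta>\<^sup>2 + k 3 * (tan \<zeta>)\<^sup>2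
      + k 4 * (e1 k (\<rho>, \<delta>, \<gamma>, \<zeta>, \<theta>))\<^sup>2 + k 5 * (e2 k (\<rho>, \<delta>, \<gamma>, \<zeta>, \<theta>))\<^sup>2) / 2)"

text \<open>The Frechet derivative applied to \<open>g x\<close> is the inner product of the gradient with \<open>g x\<close>.\<close>

definition lie_derivative :: "('a::real_normed_vector \<Rightarrow> 'a) \<Rightarrow> ('a \<Rightarrow> real) \<Rightarrow> 'a \<Rightarrow> real" where
  "lie_derivative g V x = frechet_derivative V (at x) (g x)"

definition nu :: "(nat \<Rightarrow> real) \<Rightarrow> state \<Rightarrow> real \<times> real \<times> real" where
  "nu k x = (lie_derivative g1_bar (clf k) x,
             lie_derivative g2 (clf k) x,
             lie_derivative g3_bar (clf k) x)"

section \<open>Comparison functions and the Legendre--Fenchel transform\<close>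

definition class_K :: "(real \<Rightarrow> real) \<Rightarrow> bool" where
  "class_K a \<longleftrightarrow> continuous_on {0..} a \<and> strict_mono_on {0..} a \<and> a 0 = 0"

definition class_KL :: "(real \<Rightarrow> real \<Rightarrow> real) \<Rightarrow> bool" where
  "class_KL b \<longleftrightarrow>
     continuous_on ({0..} \<times> {0..}) (\<lambda>(r, t). b r t) \<and>
     (\<forall>t\<ge>0. class_K (\<lambda>r. b r t)) \<and>
     (\<forall>r\<ge>0. antimono_on {0..} (b r) \<and> (b r \<longlongrightarrow> 0) at_top)"

text \<open>The interval \<open>[0, w)\<close> for a finite or infinite right end point.\<close>

definition upto_w :: "ereal \<Rightarrow> real set" where
  "upto_w w = {x. 0 \<le> x \<and> ereal x < w}"

text \<open>The filter below is \<open>at_left a\<close> for \<open>w = ereal a\<close> and \<open>at_top\<close> for \<open>w = \<infinity>\<close>.\<close>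

definition class_K_inf :: "ereal \<Rightarrow> (real \<Rightarrow> real) \<Rightarrow> bool" where
  "class_K_inf w f \<longleftrightarrow>
     continuous_on (upto_w w) f \<and> strict_mono_on (upto_w w) f \<and> f 0 = 0 \<and>
     filterlim f at_top (filtercomap ereal (at_left w))"

text \<open>The derivative on \<open>[0, w)\<close>, one-sided at 0, and its inverse function \<open>[0, \<infinity>) \<rightarrow> [0, w)\<close>.\<close>

definition deriv_w :: "ereal \<Rightarrow> (real \<Rightarrow> real) \<Rightarrow> real \<Rightarrow> real" where
  "deriv_w w \<mu> s = vector_derivative \<mu> (at s within upto_w w)"

definition inv_deriv :: "ereal \<Rightarrow> (real \<Rightarrow> real) \<Rightarrow> real \<Rightarrow> real" where
  "inv_deriv w \<mu> = the_inv_into (upto_w w) (deriv_w w \<mu>)"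

definition legendre :: "ereal \<Rightarrow> (real \<Rightarrow> real) \<Rightarrow> real \<Rightarrow> real" where
  "legendre w \<mu> s = integral {0..s} (inv_deriv w \<mu>)"

section \<open>Closed-loop solutions and stability\<close>

definition solution :: "(state \<Rightarrow> control) \<Rightarrow> real set \<Rightarrow> (real \<Rightarrow> state) \<Rightarrow> bool" where
  "solution F I X \<longleftrightarrow>
     (\<forall>t\<in>I. X t \<in> dom_D \<and> (X has_vector_derivative vehicle (X t) (F (X t))) (at t within I))"

text \<open>Solutions of a closed loop with merely continuous right-hand side need not be unique; every
  one of them has to be continuable for all times.\<close>

definition forward_complete :: "(state \<Rightarrow> control) \<Rightarrow> bool" where
  "forward_complete F \<longleftrightarrow>
     (\<forall>t0. \<forall>x\<in>dom_D. \<exists>X. solution F {t0..} X \<and> X t0 = x) \<and>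
     (\<forall>t0 T X. t0 < T \<and> solution F {t0..<T} X \<longrightarrow>
        (\<exists>Y. solution F {t0..} Y \<and> (\<forall>t\<in>{t0..<T}. Y t = X t)))"

text \<open>Since \<open>tan\<close> is a homeomorphism from \<open>(- pi / 2, pi / 2)\<close> onto the reals, continuity on \<open>dom_D\<close>
  with respect to the metric underlying \<open>norm_D\<close> is continuity for the Euclidean topology.\<close>

definition GAS :: "(state \<Rightarrow> control) \<Rightarrow> bool" where
  "GAS F \<longleftrightarrow>
     continuous_on dom_D F \<and> forward_complete F \<and>
     (\<exists>b. class_KL b \<and>
        (\<forall>t0 X. solution F {t0..} X \<longrightarrow>
           (\<forall>t\<ge>t0. norm_D (X t) \<le> b (norm_D (X t0)) (t - t0))))"

section \<open>The optimal control problem\<close>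

text \<open>State trajectories of measurable open-loop inputs, in the Caratheodory sense.\<close>

definition admissible :: "(real \<Rightarrow> state) \<Rightarrow> (real \<Rightarrow> control) \<Rightarrow> bool" where
  "admissible X u \<longleftrightarrow>
     u \<in> borel_measurable (lebesgue_on {0..}) \<and>
     (\<forall>t\<ge>0. X t \<in> dom_D \<and>
        (\<lambda>s. vehicle (X s) (u s)) absolutely_integrable_on {0..t} \<and>
        ((\<lambda>s. vehicle (X s) (u s)) has_integral (X t - X 0)) {0..t})"

definition state_cost ::
  "(nat \<Rightarrow> real) \<Rightarrow> (nat \<Rightarrow> ereal) \<Rightarrow> (nat \<Rightarrow> real \<Rightarrow> real) \<Rightarrow> (nat \<Rightarrow> state \<Rightarrow> real) \<Rightarrow> state \<Rightarrow> real" where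
  "state_cost k w \<mu> \<epsilon> x = (case nu k x of (n1, n2, n3) \<Rightarrow>
     legendre (w 1) (\<mu> 1) (\<epsilon> 1 x * \<bar>n1\<bar>)
     + legendre (w 2) (\<mu> 2) (\<epsilon> 2 x * \<bar>n2\<bar>)
     + legendre (w 3) (\<mu> 3) (\<epsilon> 3 x * \<bar>n3\<bar>))"

text \<open>Inputs outside the domain \<open>[0, w)\<close> of \<open>\<mu>\<close> have infinite cost.\<close>

definition penalty :: "ereal \<Rightarrow> (real \<Rightarrow> real) \<Rightarrow> real \<Rightarrow> ennreal" where
  "penalty w \<mu> s = (if ereal s < w then ennreal (\<mu> s) else \<infinity>)"

text \<open>The third penalty has \<open>\<bar>r\<bar> / (\<epsilon> 3 * \<bar>cos \<theta>\<bar>)\<close>, that is \<open>\<bar>s\<bar> / \<epsilon> 3\<close>, as argument.\<close>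

definition running_cost ::
  "(nat \<Rightarrow> real) \<Rightarrow> (nat \<Rightarrow> ereal) \<Rightarrow> (nat \<Rightarrow> real \<Rightarrow> real) \<Rightarrow> (nat \<Rightarrow> state \<Rightarrow> real)
    \<Rightarrow> state \<Rightarrow> control \<Rightarrow> ennreal" where
  "running_cost k w \<mu> \<epsilon> x = (\<lambda>(v, q, s).
     ennreal (state_cost k w \<mu> \<epsilon> x)
     + penalty (w 1) (\<mu> 1) (\<bar>v\<bar> / (\<epsilon> 1 x * fst x))
     + penalty (w 2) (\<mu> 2) (\<bar>q\<bar> / \<epsilon> 2 x)
     + penalty (w 3) (\<mu> 3) (\<bar>s\<bar> / \<epsilon> 3 x))"

definition cost_J ::
  "(nat \<Rightarrow> real) \<Rightarrow> (nat \<Rightarrow> ereal) \<Rightarrow> (nat \<Rightarrow> real \<Rightarrow> real) \<Rightarrow> (nat \<Rightarrow> state \<Rightarrow> real)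
    \<Rightarrow> (real \<Rightarrow> state) \<Rightarrow> (real \<Rightarrow> control) \<Rightarrow> ennreal" where
  "cost_J k w \<mu> \<epsilon> X u = (\<integral>\<^sup>+t. running_cost k w \<mu> \<epsilon> (X t) (u t) \<partial>lebesgue_on {0..})"

text \<open>From every initial state, each closed-loop solution attains the (finite) minimum of \<open>J\<close> over all
  admissible pairs with the same initial state.\<close>

definition minimized_by ::
  "((real \<Rightarrow> state) \<Rightarrow> (real \<Rightarrow> control) \<Rightarrow> ennreal) \<Rightarrow> (state \<Rightarrow> control) \<Rightarrow> bool" where
  "minimized_by J F \<longleftrightarrow>
     forward_complete F \<and>
     (\<forall>X. solution F {0..} X \<longrightarrow>
        admissible X (\<lambda>t. F (X t)) \<and> J X (\<lambda>t. F (X t)) < \<infinity> \<and>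
        (\<forall>Y u. admissible Y u \<and> Y 0 = X 0 \<longrightarrow> J X (\<lambda>t. F (X t)) \<le> J Y u))"

section \<open>The two feedback laws\<close>

text \<open>Both laws are functions of the state and of the values \<open>(n1, n2, n3)\<close> of the Lie derivatives;
  the third component is \<open>r / cos \<theta>\<close>.\<close>

definition optimal_law ::
  "(nat \<Rightarrow> ereal) \<Rightarrow> (nat \<Rightarrow> real \<Rightarrow> real) \<Rightarrow> (nat \<Rightarrow> state \<Rightarrow> real)
    \<Rightarrow> state \<Rightarrow> real \<times> real \<times> real \<Rightarrow> control" where
  "optimal_law w \<mu> \<epsilon> x = (\<lambda>(n1, n2, n3).
     (- fst x * \<epsilon> 1 x * inv_deriv (w 1) (\<mu> 1) (\<epsilon> 1 x * \<bar>n1\<bar>) * sgn n1,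
      - \<epsilon> 2 x * inv_deriv (w 2) (\<mu> 2) (\<epsilon> 2 x * \<bar>n2\<bar>) * sgn n2,
      - \<epsilon> 3 x * inv_deriv (w 3) (\<mu> 3) (\<epsilon> 3 x * \<bar>n3\<bar>) * sgn n3))"

text \<open>At \<open>n = 0\<close> the quotients take the value 0, since division by 0 gives 0.\<close>

definition stabilizing_law ::
  "(nat \<Rightarrow> ereal) \<Rightarrow> (nat \<Rightarrow> real \<Rightarrow> real) \<Rightarrow> (nat \<Rightarrow> state \<Rightarrow> real)
    \<Rightarrow> state \<Rightarrow> real \<times> real \<times> real \<Rightarrow> control" where
  "stabilizing_law w \<mu> \<epsilon> x = (\<lambda>(n1, n2, n3).
     (- fst x * \<epsilon> 1 x * (legendre (w 1) (\<mu> 1) (\<epsilon> 1 x * \<bar>n1\<bar>) / (\<epsilon> 1 x * \<bar>n1\<bar>)) * sgn n1,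
      - \<epsilon> 2 x * (legendre (w 2) (\<mu> 2) (\<epsilon> 2 x * \<bar>n2\<bar>) / (\<epsilon> 2 x * \<bar>n2\<bar>)) * sgn n2,
      - \<epsilon> 3 x * (legendre (w 3) (\<mu> 3) (\<epsilon> 3 x * \<bar>n3\<bar>) / (\<epsilon> 3 x * \<bar>n3\<bar>)) * sgn n3))"

end

theory Submission
  imports Defs "HOL-Complex_Analysis.Great_Picard"
begin

text \<open>
  The gradient of \<open>V = clf k\<close> pairs with the vehicle field to \<open>u1 * \<nu>1 + u2 * \<nu>2 + u3 * \<nu>3\<close> in the inputs
  \<open>(v / \<rho>, q, r / cos \<theta>)\<close>, so each input acts on \<open>V\<close> through one Lie derivative alone.  Two facts about
  \<open>V\<close> carry everything.  Its Lie derivatives vanish together only at the origin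
  (\<open>nu_eq_zero_imp\<close>): where the errors \<open>e1\<close>, \<open>e2\<close> vanish, \<open>\<nu>1\<close> is a negative multiple of a positive
  definite function of the remaining coordinates.  And \<open>V\<close> is squeezed between multiples of
  \<open>(norm_D x)^2\<close>, whence its sublevel sets in \<open>\<rho> \<ge> 0\<close> are compact (\<open>compact_sublevel\<close>).

  Both feedback laws have the form \<open>u_i = - \<epsilon>_i * f_i (\<epsilon>_i * \<bar>\<nu>_i\<bar>) * sgn \<nu>_i\<close> with \<open>f_i\<close> continuous on
  \<open>[0, \<infinity>)\<close>, zero at 0 and positive elsewhere: \<open>f\<close> is the inverse \<open>\<phi>\<close> of \<open>\<mu>'\<close> for the optimal law and
  \<open>\<ell>\<mu>(s) / s\<close> for the other.  For every such \<open>f\<close> the closed loop satisfies \<open>dV/dt = - W\<close> with \<open>W\<close>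
  continuous and positive definite.  Solutions then stay in a compact sublevel set, and there
  \<open>\<rho>\<close> decays at most exponentially, so \<open>\<rho> = 0\<close> is not reached in finite time.  The field is merely
  continuous: solutions come from Peano's theorem, applied to a bounded extension of the field, and
  the a priori bounds make them global (\<open>integral_curve_global\<close>, \<open>integral_curve_continuation\<close>).  The
  \<open>\<K>\<L>\<close> estimate comes from a scalar bound \<open>W x \<ge> \<alpha> (V x)\<close>
  (\<open>decay_rate_of_positive_definite\<close>) and integration of \<open>dv/dt \<le> - \<alpha> v\<close> by separation of variables
  (\<open>class_KL_of_decay_rate\<close>).

  Optimality rests on Young's inequality \<open>a * b \<le> \<mu> a + \<ell>\<mu> b\<close>, with equality at \<open>a = \<phi> b\<close>.  It makes
  the running cost at least \<open>\<bar>dV/dt\<bar>\<close> along every admissible trajectory, with equality (and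
  \<open>dV/dt \<le> 0\<close>) under the optimal law; so the optimal cost is at most \<open>V (X 0)\<close>.  Conversely, suppose that
  some pair costs \<open>j < V (Y 0)\<close>.  Then \<open>V\<close> changes along \<open>Y\<close> by at most \<open>j\<close>, so \<open>Y\<close> remains for
  all times in the compact set \<open>V (Y 0) - j \<le> V \<le> V (Y 0) + j\<close>, on which the state cost has a
  positive minimum; its integral over \<open>[0, \<infinity>)\<close> is then infinite, a contradiction.  Hence the value
  function is \<open>V\<close>.
\<close>

section \<open>Peano's existence theorem\<close>

definition euler :: "('a::real_vector \<Rightarrow> 'a) \<Rightarrow> real \<Rightarrow> 'a \<Rightarrow> nat \<Rightarrow> 'a" where
  "euler G h x j = ((\<lambda>y. y + h *\<^sub>R G y) ^^ j) x"

text \<open>A step function rather than the usual polygon: it takes only the values of the Euler scheme, so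
  the integral of \<open>G\<close> along it is an exact sum (\<open>euler_path_has_integral\<close>), at the price of continuity,
  which is restored in the limit because the jumps are at most \<open>M * h\<close>.\<close>

definition euler_path :: "('a::real_vector \<Rightarrow> 'a) \<Rightarrow> real \<Rightarrow> 'a \<Rightarrow> real \<Rightarrow> 'a" where
  "euler_path G h x t = euler G h x (nat \<lfloor>t / h\<rfloor>)"

lemma euler_0 [simp]: "euler G h x 0 = x"
  by (simp add: euler_def)

lemma euler_Suc: "euler G h x (Suc j) = euler G h x j + h *\<^sub>R G (euler G h x j)"
  by (simp add: euler_def)

lemma euler_dist:
  fixes G :: "'a::real_normed_vector \<Rightarrow> 'a"
  assumes "\<And>y. norm (G y) \<le> M" "0 \<le> h"
  shows "norm (euler G h x (i + j) - euler G h x i) \<le> M * h * real j"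
proof (induction j)
  case (Suc j)
  have "norm (euler G h x (i + Suc j) - euler G h x i)
      = norm ((euler G h x (i + j) - euler G h x i) + h *\<^sub>R G (euler G h x (i + j)))"
    by (simp add: euler_Suc algebra_simps)
  also have "\<dots> \<le> M * h * real j + h * M"
    using Suc assms by (intro norm_triangle_le add_mono) (auto intro: mult_left_mono)
  finally show ?case by (simp add: algebra_simps)
qed simp

text \<open>An approximate Lipschitz bound; the extra \<open>h\<close> accounts for the jumps of the step function.\<close>

lemma euler_path_dist:
  fixes G :: "'a::real_normed_vector \<Rightarrow> 'a"
  assumes G: "\<And>y. norm (G y) \<le> M" and "0 < h" "0 \<le> s" "s \<le> t"
  shows "norm (euler_path G h x t - euler_path G h x s) \<le> M * (t - s + h)"
proof -
  define i j where "i = nat \<lfloor>s / h\<rfloor>" and "j = nat \<lfloor>t / h\<rfloor>"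
  have M: "0 \<le> M" using G[of x] norm_ge_zero order_trans by blast
  have "\<lfloor>s / h\<rfloor> \<le> \<lfloor>t / h\<rfloor>"
    using assms by (intro floor_mono divide_right_mono) auto
  hence ij: "i \<le> j" unfolding i_def j_def by (rule nat_mono)
  have "real j \<le> t / h" "s / h \<le> real i + 1"
    unfolding i_def j_def using assms by (auto intro: of_nat_floor)
  hence "real j * h \<le> t" "s \<le> (real i + 1) * h"
    using \<open>0 < h\<close> by (simp_all add: pos_le_divide_eq pos_divide_le_eq)
  hence *: "h * real (j - i) \<le> t - s + h"
    using ij by (simp add: algebra_simps)
  have "norm (euler G h x (i + (j - i)) - euler G h x i) \<le> M * h * real (j - i)"
    using euler_dist[OF G] \<open>0 < h\<close> by auto
  also have "\<dots> \<le> M * (t - s + h)"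
    using * M by (simp add: mult.assoc mult_left_mono)
  finally show ?thesis
    using ij by (simp add: euler_path_def i_def j_def)
qed

lemma euler_path_has_integral:
  fixes G :: "'a::euclidean_space \<Rightarrow> 'a"
  assumes "0 < h"
  shows "((\<lambda>s. G (euler_path G h x s)) has_integral (euler G h x j - x)) {0..real j * h}"
proof (induction j)
  case 0
  show ?case
    using has_integral_refl(2)[of "\<lambda>s. G (euler_path G h x s)" 0]
    by (simp only: of_nat_0 mult_zero_left euler_0 diff_self atLeastAtMost_singleton)
next
  case (Suc j)
  let ?y = "euler G h x j"
  have const: "((\<lambda>s. G ?y) has_integral (h *\<^sub>R G ?y)) {real j * h..real (Suc j) * h}"
  proof -
    have "measure lborel {real j * h..real (Suc j) * h} = h"
      using \<open>0 < h\<close> by (simp add: algebra_simps)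
    with has_integral_const_real[of "G ?y" "real j * h" "real (Suc j) * h"] show ?thesis
      by (simp only:)
  qed
  have eq: "G (euler_path G h x s) = G ?y" if "s \<in> {real j * h..real (Suc j) * h} - {real (Suc j) * h}" for s
  proof -
    have "real j \<le> s / h" "s / h < real j + 1"
      using that \<open>0 < h\<close> by (simp_all add: pos_le_divide_eq pos_divide_less_eq add.commute)
    hence "\<lfloor>s / h\<rfloor> = int j" by linarith
    thus ?thesis by (simp add: euler_path_def)
  qed
  have step: "((\<lambda>s. G (euler_path G h x s)) has_integral (h *\<^sub>R G ?y)) {real j * h..real (Suc j) * h}"
    by (rule has_integral_spike_finite[OF finite.insertI[OF finite.emptyI] eq const])
  have "0 \<le> real j * h" "real j * h \<le> real (Suc j) * h"
    using \<open>0 < h\<close> by simp_all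
  hence "((\<lambda>s. G (euler_path G h x s)) has_integral (?y - x) + h *\<^sub>R G ?y) {0..real (Suc j) * h}"
    by (rule has_integral_combine[OF _ _ Suc step])
  moreover have "(?y - x) + h *\<^sub>R G ?y = euler G h x (Suc j) - x"
    by (simp add: euler_Suc)
  ultimately show ?case by (simp only:)
qed

text \<open>The path solves the integral equation up to the last, incomplete step.\<close>

lemma euler_path_integral:
  fixes G :: "'a::euclidean_space \<Rightarrow> 'a"
  assumes G: "\<And>y. norm (G y) \<le> M" and "0 < h" "0 \<le> t"
  shows "(\<lambda>s. G (euler_path G h x s)) integrable_on {0..t}"
    and "norm (euler_path G h x t - x - integral {0..t} (\<lambda>s. G (euler_path G h x s))) \<le> M * h"
proof -
  define j where "j = nat \<lfloor>t / h\<rfloor>"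
  let ?g = "\<lambda>s. G (euler_path G h x s)"
  have M: "0 \<le> M" using G[of x] norm_ge_zero order_trans by blast
  have "real j \<le> t / h" "t / h \<le> real j + 1"
    unfolding j_def using assms by (auto intro: of_nat_floor)
  hence j: "real j * h \<le> t" "t \<le> real (Suc j) * h"
    using \<open>0 < h\<close> by (simp_all add: pos_le_divide_eq pos_divide_le_eq add.commute)
  have "?g integrable_on {0..real (Suc j) * h}"
    using euler_path_has_integral[OF \<open>0 < h\<close>] by blast
  thus int: "?g integrable_on {0..t}"
    by (rule integrable_on_subinterval) (use j in auto)
  have eq: "integral {0..t} ?g = euler G h x j - x + integral {real j * h..t} ?g"
    using Henstock_Kurzweil_Integration.integral_combine[OF _ j(1) int] \<open>0 < h\<close>
      euler_path_has_integral[OF \<open>0 < h\<close>, of G x j] by (simp add: integral_unique)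
  have "norm (integral {real j * h..t} ?g) \<le> integral {real j * h..t} (\<lambda>_. M)"
    by (rule integral_norm_bound_integral)
      (use integrable_on_subinterval[OF int] j \<open>0 < h\<close> G in \<open>auto\<close>)
  also have "\<dots> = M * (t - real j * h)"
    using j by simp
  also have "\<dots> \<le> M * h"
    using j M by (intro mult_left_mono) (auto simp: algebra_simps)
  finally show "norm (euler_path G h x t - x - integral {0..t} ?g) \<le> M * h"
    unfolding eq by (simp add: euler_path_def j_def)
qed

lemma has_vector_derivative_within_atLeast:
  assumes "\<And>b. t < b \<Longrightarrow> (f has_vector_derivative f') (at t within {a..b})" "a \<le> t"
  shows "(f has_vector_derivative f') (at (t::real) within {a..})"
proof -
  have "at t within {a..t+1} = at t within {a..}"
    by (rule at_within_nhd[of _ "{..<t+1}"]) auto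
  thus ?thesis using assms(1)[of "t+1"] by simp
qed

text \<open>The Euler paths with step sizes tending to 0 are uniformly almost Lipschitz.  A diagonal
  subsequence converges at all rational times, hence at all times, and dominated convergence passes
  to the limit in the integral equation.  Because \<open>G\<close> is bounded on the whole space, this works on
  the half-line at once.\<close>

theorem peano_bounded:
  fixes G :: "'a::euclidean_space \<Rightarrow> 'a"
  assumes cont: "continuous_on UNIV G" and G: "\<And>y. norm (G y) \<le> M"
  obtains X where "X 0 = x" "\<And>t. 0 \<le> t \<Longrightarrow> (X has_vector_derivative G (X t)) (at t within {0..})"
proof -
  have M: "0 \<le> M" using G[of x] norm_ge_zero order_trans by blast
  define h where "h n = inverse (real (Suc n))" for n
  have h: "0 < h n" for n by (simp add: h_def)
  define P where "P n = euler_path G (h n) x" for n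
  have P0: "P n 0 = x" for n by (simp add: P_def euler_path_def)
  have Pd: "norm (P n t - P n s) \<le> M * (t - s + h n)" if "0 \<le> s" "s \<le> t" for n s t
    unfolding P_def by (rule euler_path_dist[OF G h that])
  have Pd': "norm (P n t - P n s) \<le> M * \<bar>t - s\<bar> + M * h n" if "0 \<le> s" "0 \<le> t" for n s t
    using Pd[of s t n] Pd[of t s n] that by (cases "s \<le> t") (auto simp: norm_minus_commute algebra_simps)
  \<comment> \<open>The factor makes the paths uniformly bounded on the whole half-line.\<close>
  define Q where "Q n t = (1 / (1 + t)) *\<^sub>R (P n t - x)" for n t
  have "countable (\<rat> \<inter> {0::real..})" by (simp add: countable_rat)
  moreover have "norm (Q n t) \<le> M" if "t \<in> \<rat> \<inter> {0..}" for n t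
  proof -
    have "norm (P n t - x) \<le> M * (t + h n)" using Pd[of 0 t n] that P0 by simp
    also have "\<dots> \<le> M * (t + 1)" using M by (intro mult_left_mono) (auto simp: h_def field_simps)
    finally have "norm (P n t - x) \<le> M * (1 + t)" by (simp add: add.commute)
    thus ?thesis using that by (simp add: Q_def pos_divide_le_eq)
  qed
  ultimately obtain k where k: "strict_mono (k::nat \<Rightarrow> nat)"
    and Q: "\<And>t. t \<in> \<rat> \<inter> {0..} \<Longrightarrow> \<exists>l. (\<lambda>n. Q (k n) t) \<longlonglongrightarrow> l"
    using function_convergent_subsequence[of "\<rat> \<inter> {0::real..}" Q M] by blast
  have hk: "(\<lambda>n. h (k n)) \<longlonglongrightarrow> 0"
    using LIMSEQ_subseq_LIMSEQ[OF LIMSEQ_inverse_real_of_nat k] by (simp add: h_def o_def)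
  have conv_rat: "Cauchy (\<lambda>n. P (k n) t)" if t: "t \<in> \<rat>" "0 \<le> t" for t
  proof -
    obtain l where "(\<lambda>n. Q (k n) t) \<longlonglongrightarrow> l" using Q t by auto
    hence "(\<lambda>n. (1 + t) *\<^sub>R Q (k n) t + x) \<longlonglongrightarrow> (1 + t) *\<^sub>R l + x"
      by (intro tendsto_intros)
    moreover have "(1 + t) *\<^sub>R Q (k n) t + x = P (k n) t" for n
      using t by (simp add: Q_def)
    ultimately show ?thesis by (simp add: LIMSEQ_imp_Cauchy)
  qed
  have conv: "\<exists>l. (\<lambda>n. P (k n) t) \<longlonglongrightarrow> l" if t: "0 \<le> t" for t
  proof -
    have "Cauchy (\<lambda>n. P (k n) t)"
    proof (rule CauchyI)
      fix e :: real assume "0 < e"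
      define d where "d = e / (5 * (M + 1))"
      have d: "0 < d" "M * d < e / 5"
        using \<open>0 < e\<close> M by (auto simp: d_def field_simps)
      obtain r where r: "r \<in> \<rat>" "t < r" "r < t + d"
        using Rats_dense_in_real[of t "t + d"] d by auto
      have Mr: "M * \<bar>t - r\<bar> < e / 5"
        using mult_left_mono[of "\<bar>t - r\<bar>" d M] r d M by auto
      obtain N1 where N1: "\<And>m n. m \<ge> N1 \<Longrightarrow> n \<ge> N1 \<Longrightarrow> norm (P (k m) r - P (k n) r) < e / 5"
        using CauchyD[OF conv_rat[of r], of "e / 5"] r t \<open>0 < e\<close> by auto
      obtain N2 where N2: "\<And>n. n \<ge> N2 \<Longrightarrow> h (k n) < d"
        using order_tendstoD(2)[OF hk d(1)] by (auto simp: eventually_sequentially)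
      have near: "norm (P (k n) t - P (k n) r) < 2 * e / 5" if "n \<ge> N2" for n
      proof -
        have "M * h (k n) \<le> M * d"
          using M N2[OF that] by (intro mult_left_mono) auto
        moreover have "norm (P (k n) t - P (k n) r) \<le> M * \<bar>t - r\<bar> + M * h (k n)"
          using Pd'[of r t "k n"] r t by simp
        ultimately show ?thesis using Mr d(2) by linarith
      qed
      have "norm (P (k m) t - P (k n) t) < e" if "m \<ge> max N1 N2" "n \<ge> max N1 N2" for m n
      proof -
        let ?a = "P (k m) t - P (k m) r" and ?b = "P (k m) r - P (k n) r" and ?c = "P (k n) t - P (k n) r"
        have "P (k m) t - P (k n) t = ?a + ?b - ?c" by simp
        moreover have "norm (?a + ?b - ?c) \<le> norm ?a + norm ?b + norm ?c"
          using norm_triangle_ineq4[of "?a + ?b" ?c] norm_triangle_ineq[of ?a ?b] by linarith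
        moreover have "norm ?a < 2 * e / 5" "norm ?b < e / 5" "norm ?c < 2 * e / 5"
          using near N1 that by simp_all
        ultimately show ?thesis by simp
      qed
      thus "\<exists>N. \<forall>m\<ge>N. \<forall>n\<ge>N. norm (P (k m) t - P (k n) t) < e" by blast
    qed
    thus ?thesis using Cauchy_convergent convergent_def by blast
  qed
  define X where "X t = lim (\<lambda>n. P (k n) t)" for t
  have X: "(\<lambda>n. P (k n) t) \<longlonglongrightarrow> X t" if "0 \<le> t" for t
    using conv[OF that] by (simp add: X_def convergent_LIMSEQ_iff[symmetric] convergent_def)
  have lip: "norm (X t - X s) \<le> M * \<bar>t - s\<bar>" if "0 \<le> s" "0 \<le> t" for s t
  proof -
    have "(\<lambda>n. norm (P (k n) t - P (k n) s)) \<longlonglongrightarrow> norm (X t - X s)"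
      using X that by (intro tendsto_intros) auto
    moreover have "(\<lambda>n. M * \<bar>t - s\<bar> + M * h (k n)) \<longlonglongrightarrow> M * \<bar>t - s\<bar> + M * 0"
      by (intro tendsto_intros hk)
    ultimately show ?thesis
      using LIMSEQ_le[of _ "norm (X t - X s)" _ "M * \<bar>t - s\<bar>"] Pd' that by auto
  qed
  have contX: "continuous_on {0..} X"
  proof (rule lipschitz_on_continuous_on)
    show "M-lipschitz_on {0..} X"
      using lip M by (auto simp: lipschitz_on_def dist_norm)
  qed
  have contGX: "continuous_on {0..} (\<lambda>s. G (X s))"
    by (rule continuous_on_compose2[OF cont contX]) auto
  have int_eq: "X t = x + integral {0..t} (\<lambda>s. G (X s))" if t: "0 \<le> t" for t
  proof -
    have lim: "(\<lambda>n. integral {0..t} (\<lambda>s. G (P (k n) s))) \<longlonglongrightarrow> integral {0..t} (\<lambda>s. G (X s))"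
    proof (rule dominated_convergence(2))
      show "(\<lambda>s. G (P (k n) s)) integrable_on {0..t}" for n
        unfolding P_def using euler_path_integral(1)[OF G h t] .
      show "(\<lambda>n. G (P (k n) s)) \<longlonglongrightarrow> G (X s)" if "s \<in> {0..t}" for s
        using X[of s] that cont
        by (intro isCont_tendsto_compose[of _ G]) (auto simp: continuous_on_eq_continuous_at)
    qed (use G in auto)
    have 1: "(\<lambda>n. P (k n) t - x - integral {0..t} (\<lambda>s. G (P (k n) s))) \<longlonglongrightarrow> 0"
    proof (rule Lim_null_comparison)
      show "(\<lambda>n. M * h (k n)) \<longlonglongrightarrow> 0" using tendsto_mult_right_zero[OF hk] by simp
      show "\<forall>\<^sub>F n in sequentially. norm (P (k n) t - x - integral {0..t} (\<lambda>s. G (P (k n) s))) \<le> M * h (k n)"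
        unfolding P_def by (intro always_eventually allI euler_path_integral(2)[OF G h t])
    qed
    have 2: "(\<lambda>n. P (k n) t - x - integral {0..t} (\<lambda>s. G (P (k n) s)))
        \<longlonglongrightarrow> X t - x - integral {0..t} (\<lambda>s. G (X s))"
      by (intro tendsto_intros lim X t)
    have "X t - x - integral {0..t} (\<lambda>s. G (X s)) = 0"
      by (rule LIMSEQ_unique[OF 2 1])
    thus ?thesis by (simp add: algebra_simps)
  qed
  have "(X has_vector_derivative G (X t)) (at t within {0..})" if t: "0 \<le> t" for t
  proof (rule has_vector_derivative_within_atLeast)
    fix b assume "t < b"
    have "((\<lambda>u. integral {0..u} (\<lambda>s. G (X s))) has_vector_derivative G (X t)) (at t within {0..b})"
      using t \<open>t < b\<close> by (intro integral_has_vector_derivative continuous_on_subset[OF contGX]) auto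
    hence "((\<lambda>u. x + integral {0..u} (\<lambda>s. G (X s))) has_vector_derivative G (X t)) (at t within {0..b})"
      by (auto intro!: derivative_eq_intros)
    thus "(X has_vector_derivative G (X t)) (at t within {0..b})"
      by (rule has_vector_derivative_transform[rotated 2]) (use t \<open>t < b\<close> int_eq in auto)
  qed (use t in auto)
  moreover have "X 0 = x" using int_eq[of 0] by simp
  ultimately show ?thesis using that by blast
qed

section \<open>Confined integral curves\<close>

definition integral_curve :: "('a::real_normed_vector \<Rightarrow> 'a) \<Rightarrow> 'a set \<Rightarrow> real set \<Rightarrow> (real \<Rightarrow> 'a) \<Rightarrow> bool" where
  "integral_curve G S I X \<longleftrightarrow>
     (\<forall>t\<in>I. X t \<in> S \<and> (X has_vector_derivative G (X t)) (at t within I))"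

lemma integral_curve_continuous_on:
  "integral_curve G S I X \<Longrightarrow> continuous_on I X"
  by (auto simp: integral_curve_def continuous_on_eq_continuous_within intro: has_vector_derivative_continuous)

lemma integral_curve_mono: "integral_curve G S I X \<Longrightarrow> S \<subseteq> S' \<Longrightarrow> integral_curve G S' I X"
  unfolding integral_curve_def by blast

text \<open>A continuous curve that satisfies the differential equation except at one time satisfies the
  integral equation, hence the differential equation everywhere.  This is what glues two integral
  curves at their common end point.\<close>

lemma has_vector_derivative_across_point:
  fixes Z :: "real \<Rightarrow> 'a::euclidean_space"
  assumes Z: "continuous_on {a..} Z" and g: "continuous_on {a..} g"
    and deriv: "\<And>t. a < t \<Longrightarrow> t \<noteq> T \<Longrightarrow> (Z has_vector_derivative g t) (at t)"
    and t: "a \<le> t"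
  shows "(Z has_vector_derivative g t) (at t within {a..})"
proof (rule has_vector_derivative_within_atLeast)
  fix b assume "t < b"
  have int_eq: "Z u = Z a + integral {a..u} g" if "a \<le> u" for u
  proof -
    have "(g has_integral (Z u - Z a)) {a..u}"
      using that deriv continuous_on_subset[OF Z]
      by (intro fundamental_theorem_of_calculus_interior_strong[of "{T}"]) simp_all
    thus ?thesis by (simp add: integral_unique)
  qed
  have "((\<lambda>u. integral {a..u} g) has_vector_derivative g t) (at t within {a..b})"
    using t \<open>t < b\<close> by (intro integral_has_vector_derivative continuous_on_subset[OF g]) auto
  hence "((\<lambda>u. Z a + integral {a..u} g) has_vector_derivative g t) (at t within {a..b})"
    using has_vector_derivative_add[OF has_vector_derivative_const[of "Z a"]] by force
  thus "(Z has_vector_derivative g t) (at t within {a..b})"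
    by (rule has_vector_derivative_transform[rotated 2]) (use t \<open>t < b\<close> in \<open>simp_all add: int_eq[symmetric]\<close>)
qed (use t in auto)

lemma has_vector_derivative_at_interior:
  "(f has_vector_derivative d) (at t within A) \<Longrightarrow> t \<in> interior A \<Longrightarrow> (f has_vector_derivative d) (at t)"
  by (metis at_within_interior)

lemma integral_curve_shift:
  assumes "integral_curve G S {0..} Y"
  shows "integral_curve G S {T..} (\<lambda>t. Y (t - T))"
  unfolding integral_curve_def
proof (intro ballI conjI)
  fix t assume t: "t \<in> {T..}"
  show "Y (t - T) \<in> S" using assms t by (auto simp: integral_curve_def)
  have "(Y has_vector_derivative G (Y (t - T))) (at (t - T) within (\<lambda>t. t - T) ` {T..})"
  proof -
    have "(\<lambda>t. t - T) ` {T..} = {0..}"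
    proof (intro equalityI subsetI)
      fix u :: real assume "u \<in> {0..}"
      thus "u \<in> (\<lambda>t. t - T) ` {T..}" by (intro image_eqI[of _ _ "u + T"]) auto
    qed auto
    thus ?thesis using assms t by (auto simp: integral_curve_def)
  qed
  moreover have "((\<lambda>t. t - T) has_vector_derivative 1) (at t within {T..})"
    by (auto intro!: derivative_eq_intros)
  ultimately show "((\<lambda>t. Y (t - T)) has_vector_derivative G (Y (t - T))) (at t within {T..})"
    using vector_diff_chain_within[of "\<lambda>t. t - T" 1 t "{T..}" Y] by (simp add: o_def)
qed

text \<open>Inside a compact set the velocity is bounded, so the curve is Lipschitz and extends
  continuously to the right end point.\<close>

lemma integral_curve_limit:
  fixes G :: "'a::euclidean_space \<Rightarrow> 'a"
  assumes X: "integral_curve G S {a..<T} X" and "a < T"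
    and K: "compact K" "X ` {a..<T} \<subseteq> K" and G: "continuous_on K G"
  obtains g where "continuous_on {a..T} g" "\<And>t. t \<in> {a..<T} \<Longrightarrow> g t = X t" "g T \<in> K"
proof -
  obtain M where M: "\<And>x. x \<in> K \<Longrightarrow> norm (G x) \<le> M"
    using compact_imp_bounded[OF compact_continuous_image[OF G K(1)]] by (auto simp: bounded_iff)
  have "X a \<in> K" using K \<open>a < T\<close> by auto
  hence M0: "0 \<le> M" using M norm_ge_zero order_trans by blast
  have "norm (X s - X t) \<le> M * norm (s - t)" if "s \<in> {a..<T}" "t \<in> {a..<T}" for s t
  proof (rule differentiable_bound[OF _ _ _ that])
    fix u assume u: "u \<in> {a..<T}"
    show "(X has_derivative (\<lambda>h. h *\<^sub>R G (X u))) (at u within {a..<T})"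
      using X u by (auto simp: integral_curve_def has_vector_derivative_def)
    have "norm (G (X u)) \<le> M" using M K(2) u by blast
    thus "onorm (\<lambda>h. h *\<^sub>R G (X u)) \<le> M"
      by (intro onorm_le) (simp add: mult.commute[of M] mult_left_mono)
  qed simp
  hence "M-lipschitz_on {a..<T} X"
    using M0 by (auto simp: lipschitz_on_def dist_norm)
  hence uc: "uniformly_continuous_on {a..<T} X"
    by (rule lipschitz_on_uniformly_continuous)
  obtain g where g: "uniformly_continuous_on (closure {a..<T}) g" "\<And>t. t \<in> {a..<T} \<Longrightarrow> X t = g t"
    by (rule uniformly_continuous_on_extension_on_closure[OF uc]) (use that in blast)
  have cont: "continuous_on {a..T} g"
    using uniformly_continuous_imp_continuous[OF g(1)] \<open>a < T\<close> by simp
  have "g ` closure {a..<T} \<subseteq> K"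
    using cont \<open>a < T\<close> K g(2)
    by (intro image_closure_subset compact_imp_closed) (auto simp: image_subset_iff)
  hence "g T \<in> K" using \<open>a < T\<close> by auto
  with cont g(2) show ?thesis by (intro that[of g]) auto
qed

text \<open>The curve is extended to its limit at time \<open>T\<close> and followed by a global curve from there.\<close>

theorem integral_curve_continuation:
  fixes G :: "'a::euclidean_space \<Rightarrow> 'a"
  assumes X: "integral_curve G S {a..<T} X" and "a < T"
    and K: "compact K" "K \<subseteq> S" "X ` {a..<T} \<subseteq> K" and G: "continuous_on S G"
    and global: "\<And>x. x \<in> K \<Longrightarrow> \<exists>Y. Y 0 = x \<and> integral_curve G S {0..} Y"
  shows "\<exists>Z. integral_curve G S {a..} Z \<and> (\<forall>t\<in>{a..<T}. Z t = X t)"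
proof -
  obtain g where g: "continuous_on {a..T} g" "\<And>t. t \<in> {a..<T} \<Longrightarrow> g t = X t" "g T \<in> K"
    using integral_curve_limit[OF X \<open>a < T\<close> K(1,3) continuous_on_subset[OF G K(2)]] by blast
  obtain Y where Y: "Y 0 = g T" "integral_curve G S {0..} Y" using global g(3) by blast
  define Z where "Z t = (if t \<le> T then g t else Y (t - T))" for t
  note Y' = integral_curve_shift[OF Y(2), of T]
  have "continuous_on ({a..T} \<union> {T..}) Z"
    unfolding Z_def
  proof (rule continuous_on_cases)
    show "continuous_on {T..} (\<lambda>t. Y (t - T))" by (rule integral_curve_continuous_on[OF Y'])
  qed (use g(1) Y(1) in auto)
  moreover have "{a..T} \<union> {T..} = {a..}" using \<open>a < T\<close> by auto
  ultimately have contZ: "continuous_on {a..} Z" by simp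
  have ZS: "Z t \<in> S" if "a \<le> t" for t
  proof -
    consider "t < T" | "t = T" | "t > T" by linarith
    thus ?thesis
    proof cases
      case 1
      thus ?thesis using that X g(2)[of t] by (auto simp: Z_def integral_curve_def)
    next
      case 2
      thus ?thesis using g(3) K by (auto simp: Z_def)
    next
      case 3
      thus ?thesis using Y' by (auto simp: Z_def integral_curve_def)
    qed
  qed
  have "continuous_on {a..} (\<lambda>t. G (Z t))"
    by (rule continuous_on_compose2[OF G contZ]) (use ZS in auto)
  moreover have "(Z has_vector_derivative G (Z t)) (at t)" if "a < t" "t \<noteq> T" for t
  proof (cases "t < T")
    case True
    have "(X has_vector_derivative G (X t)) (at t)"
      using X True \<open>a < t\<close>
      by (intro has_vector_derivative_at_interior[of _ _ _ "{a..<T}"]) (auto simp: integral_curve_def)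
    hence "(Z has_vector_derivative G (X t)) (at t)"
      by (rule has_vector_derivative_transform_within_open[of _ _ _ "{a<..<T}"])
        (use True \<open>a < t\<close> g(2) in \<open>auto simp: Z_def\<close>)
    thus ?thesis using True \<open>a < t\<close> g(2)[of t] by (simp add: Z_def)
  next
    case False
    hence "((\<lambda>t. Y (t - T)) has_vector_derivative G (Y (t - T))) (at t)"
      using Y' \<open>t \<noteq> T\<close>
      by (intro has_vector_derivative_at_interior[of _ _ _ "{T..}"]) (auto simp: integral_curve_def)
    hence "(Z has_vector_derivative G (Y (t - T))) (at t)"
      by (rule has_vector_derivative_transform_within_open[of _ _ _ "{T<..}"])
        (use False \<open>t \<noteq> T\<close> in \<open>auto simp: Z_def\<close>)
    thus ?thesis using False \<open>t \<noteq> T\<close> by (simp add: Z_def)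
  qed
  ultimately have "(Z has_vector_derivative G (Z t)) (at t within {a..})" if "a \<le> t" for t
    by (rule has_vector_derivative_across_point[OF contZ _ _ that])
  hence "integral_curve G S {a..} Z" using ZS by (auto simp: integral_curve_def)
  moreover have "\<forall>t\<in>{a..<T}. Z t = X t" using g(2) by (auto simp: Z_def)
  ultimately show ?thesis by blast
qed

text \<open>The field need only be known on \<open>C\<close>: extended to a bounded field on the whole space, it has a
  global integral curve by \<open>peano_bounded\<close>.  If this curve left \<open>S\<close>, then up to the first exit time it
  would be a curve of the original field, hence confined to a compact subset \<open>K\<close> of \<open>S\<close>; by continuity its
  position at the exit time would still lie in \<open>K\<close>.\<close>

theorem integral_curve_global:
  fixes G :: "'a::euclidean_space \<Rightarrow> 'a"
  assumes "open S" "compact C" "S \<subseteq> C" and G: "continuous_on C G" and x: "x \<in> S"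
    and confined: "\<And>X T. 0 < T \<Longrightarrow> X 0 = x \<Longrightarrow> integral_curve G S {0..<T} X \<Longrightarrow>
      \<exists>K. compact K \<and> K \<subseteq> S \<and> X ` {0..<T} \<subseteq> K"
  shows "\<exists>X. X 0 = x \<and> integral_curve G S {0..} X"
proof -
  obtain M where M: "\<And>y. y \<in> C \<Longrightarrow> norm (G y) \<le> M"
    using compact_imp_bounded[OF compact_continuous_image[OF G \<open>compact C\<close>]] by (auto simp: bounded_iff)
  hence "0 \<le> M" using x \<open>S \<subseteq> C\<close> norm_ge_zero order_trans by blast
  then obtain F where F: "continuous_on UNIV F" "\<And>y. y \<in> C \<Longrightarrow> F y = G y" "\<And>y. norm (F y) \<le> M"
    using Tietze[OF G, of UNIV M] M \<open>compact C\<close> by (auto dest: compact_imp_closed)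
  obtain X where X: "X 0 = x" "\<And>t. 0 \<le> t \<Longrightarrow> (X has_vector_derivative F (X t)) (at t within {0..})"
    using peano_bounded[OF F(1,3)] by blast
  have contX: "continuous_on {0..} X"
    using X(2) by (auto simp: continuous_on_eq_continuous_within intro: has_vector_derivative_continuous)
  have inS: "X t \<in> S" if "0 \<le> t" for t
  proof (rule ccontr)
    assume "X t \<notin> S"
    define B where "B = {0..t} \<inter> X -` (- S)"
    have "closed B"
      unfolding B_def using \<open>open S\<close>
      by (intro continuous_closed_preimage continuous_on_subset[OF contX]) auto
    moreover have "t \<in> B" using that \<open>X t \<notin> S\<close> by (auto simp: B_def)
    moreover have bdd: "bdd_below B" by (auto simp: B_def)
    ultimately have TB: "Inf B \<in> B" using closed_contains_Inf by blast
    define T where "T = Inf B"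
    have T: "0 \<le> T" "X T \<notin> S" using TB by (auto simp: T_def B_def)
    hence "0 < T" using X(1) x by (cases "T = 0") auto
    have before: "X s \<in> S" if "s \<in> {0..<T}" for s
    proof (rule ccontr)
      assume "X s \<notin> S"
      hence "s \<in> B" using that TB by (auto simp: B_def T_def)
      hence "T \<le> s" unfolding T_def using bdd by (rule cInf_lower)
      thus False using that by simp
    qed
    have "integral_curve G S {0..<T} X"
      unfolding integral_curve_def
    proof (intro ballI conjI before)
      fix s assume s: "s \<in> {0..<T}"
      have "(X has_vector_derivative F (X s)) (at s within {0..<T})"
        using s by (intro has_vector_derivative_within_subset[OF X(2)]) auto
      thus "(X has_vector_derivative G (X s)) (at s within {0..<T})"
        using F(2) before[OF s] \<open>S \<subseteq> C\<close> by auto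
    qed
    then obtain K where K: "compact K" "K \<subseteq> S" "X ` {0..<T} \<subseteq> K"
      using confined[of T X] \<open>0 < T\<close> X(1) by blast
    have "X ` closure {0..<T} \<subseteq> K"
      using \<open>0 < T\<close> K by (intro image_closure_subset continuous_on_subset[OF contX] compact_imp_closed) auto
    hence "X T \<in> K" using \<open>0 < T\<close> by auto
    thus False using K T by auto
  qed
  have "integral_curve G S {0..} X"
    unfolding integral_curve_def
  proof (intro ballI conjI inS)
    fix t :: real assume t: "t \<in> {0..}"
    hence "F (X t) = G (X t)" using F(2) inS \<open>S \<subseteq> C\<close> by auto
    thus "(X has_vector_derivative G (X t)) (at t within {0..})" using X(2)[of t] t by simp
  qed simp
  thus ?thesis using X(1) by blast
qed

section \<open>Decay rates and comparison functions\<close>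

lemma antimono_of_nonpos_derivative:
  fixes f :: "real \<Rightarrow> real"
  assumes "a \<le> b" "\<And>x. x \<in> {a..b} \<Longrightarrow> (f has_real_derivative f' x) (at x within {a..b})"
    "\<And>x. x \<in> {a..b} \<Longrightarrow> f' x \<le> 0"
  shows "f b \<le> f a"
proof -
  have "\<exists>x\<in>{a..b}. f b - f a = f' x * (b - a)"
    using assms by (intro mvt_very_simple) (auto simp: has_field_derivative_def)
  then obtain x where "x \<in> {a..b}" "f b - f a = f' x * (b - a)" by blast
  thus ?thesis using assms(1,3) mult_nonpos_nonneg[of "f' x" "b - a"] by auto
qed

text \<open>Separation of variables.  With \<open>H\<close> an antiderivative of \<open>1 / \<alpha>\<close>, the inequality
  \<open>v' \<le> - \<alpha> v\<close> says that \<open>H (v t) + t\<close> decreases, so \<open>b r t = H\<inverse> (H r - t)\<close> is a bound.  The hypothesis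
  \<open>\<alpha> s \<le> s\<close> makes \<open>H\<close> grow at least as fast as \<open>ln\<close>, hence map \<open>(0, \<infinity>)\<close> onto the reals; so \<open>H\<inverse>\<close> is
  defined everywhere and tends to 0 at \<open>-\<infinity>\<close>.\<close>

lemma class_KL_of_decay_rate:
  fixes \<alpha> :: "real \<Rightarrow> real"
  assumes cont: "continuous_on {0<..} \<alpha>"
    and pos: "\<And>s. 0 < s \<Longrightarrow> 0 < \<alpha> s" and le: "\<And>s. 0 < s \<Longrightarrow> \<alpha> s \<le> s"
  obtains b where "class_KL b"
    "\<And>v d t0 t. t0 \<le> t \<Longrightarrow>
       (\<And>s. s \<in> {t0..t} \<Longrightarrow> 0 < v s) \<Longrightarrow>
       (\<And>s. s \<in> {t0..t} \<Longrightarrow> (v has_real_derivative d s) (at s within {t0..t})) \<Longrightarrow>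
       (\<And>s. s \<in> {t0..t} \<Longrightarrow> d s \<le> - \<alpha> (v s)) \<Longrightarrow>
       v t \<le> b (v t0) (t - t0)"
proof -
  define H where "H v = (LBINT y=ereal 1..ereal v. 1 / \<alpha> y)" for v
  have cont': "continuous_on {a..b} (\<lambda>y. 1 / \<alpha> y)" if "0 < a" for a b :: real
  proof -
    have "\<alpha> y \<noteq> 0" if "y \<in> {a..b}" for y
      using pos[of y] that \<open>0 < a\<close> by auto
    thus ?thesis
      using that by (intro continuous_intros continuous_on_subset[OF cont]) auto
  qed
  have H: "(H has_real_derivative 1 / \<alpha> v) (at v)" if "0 < v" for v :: real
  proof -
    define a b where "a = min (v / 2) 1" and "b = v + 1"
    have ab: "0 < a" "a \<le> 1" "1 \<le> b" "a < v" "v < b" using that by (auto simp: a_def b_def min_def)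
    have "(H has_vector_derivative 1 / \<alpha> v) (at v within {a..b})"
      unfolding H_def using ab by (intro interval_integral_FTC2 cont') auto
    moreover have "at v within {a..b} = at v"
      using ab by (intro at_within_interior) auto
    ultimately show ?thesis
      by (simp only: has_real_derivative_iff_has_vector_derivative)
  qed
  have H_mono: "H x < H y" if "0 < x" "x < y" for x y
  proof (rule DERIV_pos_imp_increasing[OF that(2)])
    fix u assume "x \<le> u" "u \<le> y"
    thus "\<exists>z. (H has_real_derivative z) (at u) \<and> 0 < z"
      using H[of u] pos[of u] that(1) by (intro exI[of _ "1 / \<alpha> u"]) auto
  qed
  have H1: "H 1 = 0" by (simp add: H_def)
  have H_ln: "H x - ln x \<le> H y - ln y" if "0 < x" "x \<le> y" for x y
  proof (rule DERIV_nonneg_imp_nondecreasing[OF that(2)])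
    fix u assume "x \<le> u" "u \<le> y"
    hence u: "0 < u" using that by simp
    have "1 / u \<le> 1 / \<alpha> u" using pos[OF u] le[OF u] by (intro divide_left_mono) auto
    moreover have "((\<lambda>u. H u - ln u) has_real_derivative 1 / \<alpha> u - 1 / u) (at u)"
      using H[OF u] u by (auto intro!: derivative_eq_intros)
    ultimately show "\<exists>z. ((\<lambda>u. H u - ln u) has_real_derivative z) (at u) \<and> 0 \<le> z"
      by (intro exI[of _ "1 / \<alpha> u - 1 / u"]) auto
  qed
  have contH: "continuous_on {0<..} H"
    by (rule DERIV_continuous_on[of _ _ "\<lambda>v. 1 / \<alpha> v"])
      (use H has_field_derivative_at_within in force)
  have H_surj: "\<exists>x>0. H x = y" for y
  proof (cases "0 \<le> y")
    case True
    have "\<exists>x\<ge>1. x \<le> exp y \<and> H x = y"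
    proof (rule IVT')
      show "y \<le> H (exp y)" using H_ln[of 1 "exp y"] True H1 by simp
      show "continuous_on {1..exp y} H" by (rule continuous_on_subset[OF contH]) auto
    qed (use True H1 in auto)
    then obtain x where "1 \<le> x" "H x = y" by blast
    thus ?thesis by (intro exI[of _ x]) auto
  next
    case False
    have "\<exists>x\<ge>exp y. x \<le> 1 \<and> H x = y"
    proof (rule IVT')
      show "H (exp y) \<le> y" using H_ln[of "exp y" 1] False H1 by simp
      show "continuous_on {exp y..1} H"
        by (rule continuous_on_subset[OF contH]) (auto intro: less_le_trans[OF exp_gt_zero])
    qed (use False H1 in auto)
    then obtain x where "exp y \<le> x" "H x = y" by blast
    thus ?thesis by (intro exI[of _ x]) (auto intro: less_le_trans[OF exp_gt_zero])
  qed
  define K where "K y = (SOME x. 0 < x \<and> H x = y)" for y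
  have K: "0 < K y" "H (K y) = y" for y
    using someI_ex[of "\<lambda>x. 0 < x \<and> H x = y"] H_surj[of y] by (auto simp: K_def)
  have K_le: "K x \<le> K y" if "x \<le> y" for x y
    using H_mono[of "K y" "K x"] K[of x] K[of y] that by force
  have K_less: "K x < K y" if "x < y" for x y
    using K_le[of x y] K(2)[of x] K(2)[of y] that by (cases "K x = K y") auto
  have KH: "K (H x) = x" if "0 < x" for x
    using H_mono[of x "K (H x)"] H_mono[of "K (H x)" x] K[of "H x"] that
    by (cases x "K (H x)" rule: linorder_cases) auto
  have "K ` UNIV = {0<..}"
    using K(1) KH by (metis (no_types, opaque_lifting) UNIV_I equalityI greaterThan_iff image_eqI image_subsetI subsetI)
  hence contK: "continuous_on UNIV K"
    by (intro continuous_onI_mono) (auto intro: K_le)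
  define b where "b r t = (if r \<le> 0 then 0 else K (H r - t))" for r t
  have b_nonneg: "0 \<le> b r t" for r t
    using K(1) by (auto simp: b_def intro: less_imp_le)
  have b_le: "b r t \<le> r" if "0 \<le> r" "0 \<le> t" for r t
    using K_le[of "H r - t" "H r"] KH[of r] that by (auto simp: b_def)
  have joint: "continuous_on ({0..} \<times> {0..}) (\<lambda>(r, t). b r t)"
    unfolding continuous_on_eq_continuous_within
  proof
    fix z :: "real \<times> real" assume z: "z \<in> {0..} \<times> {0..}"
    show "continuous (at z within {0..} \<times> {0..}) (\<lambda>(r, t). b r t)"
    proof (cases "fst z = 0")
      case True
      have "((\<lambda>(r, t). b r t) \<longlongrightarrow> 0) (at z within {0..} \<times> {0..})"
      proof (rule Lim_null_comparison)
        show "\<forall>\<^sub>F x in at z within {0..} \<times> {0..}. norm (case x of (r, t) \<Rightarrow> b r t) \<le> fst x"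
          unfolding eventually_at_filter using b_le b_nonneg by (intro always_eventually) auto
        show "(fst \<longlongrightarrow> 0) (at z within {0..} \<times> {0..})"
          using tendsto_fst[OF tendsto_ident_at, of z] True by simp
      qed
      moreover have "(case z of (r, t) \<Rightarrow> b r t) = 0" using True by (auto simp: b_def split: prod.split)
      ultimately show ?thesis by (simp add: continuous_within)
    next
      case False
      \<comment> \<open>Away from \<open>r = 0\<close> the bound is a composition of continuous functions, for all real \<open>t\<close>.\<close>
      have op: "open ({0<..} \<times> UNIV :: (real \<times> real) set)" by (intro open_Times) auto
      have "continuous_on ({0<..} \<times> UNIV) (\<lambda>z. K (H (fst z) - snd z))"
        by (intro continuous_on_compose2[OF contK] continuous_intros continuous_on_compose2[OF contH]) auto
      moreover have "(\<lambda>z. K (H (fst z) - snd z)) z = (\<lambda>(r, t). b r t) z" if "z \<in> {0<..} \<times> UNIV" for z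
        using that by (auto simp: b_def)
      ultimately have "continuous_on ({0<..} \<times> UNIV) (\<lambda>(r, t). b r t)"
        by (simp cong: continuous_on_cong)
      hence "continuous (at z) (\<lambda>(r, t). b r t)"
        by (rule continuous_on_interior) (use op z False in \<open>auto simp: interior_open mem_Times_iff\<close>)
      thus ?thesis by (rule continuous_at_imp_continuous_at_within)
    qed
  qed
  have "class_KL b"
    unfolding class_KL_def class_K_def
  proof (intro conjI allI impI joint)
    fix t :: real assume t: "0 \<le> t"
    have "continuous_on {0..} (\<lambda>r. case (r, t) of (r, t) \<Rightarrow> b r t)"
      by (rule continuous_on_compose2[OF joint]) (use t in \<open>auto intro!: continuous_intros\<close>)
    thus "continuous_on {0..} (\<lambda>r. b r t)" by simp
    show "strict_mono_on {0..} (\<lambda>r. b r t)"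
    proof (rule strict_mono_onI)
      fix r s :: real assume "r \<in> {0..}" "s \<in> {0..}" "r < s"
      thus "b r t < b s t" using K(1) H_mono[of r s] K_less[of "H r - t" "H s - t"] by (auto simp: b_def)
    qed
    show "b 0 t = 0" by (simp add: b_def)
  next
    fix r :: real assume r: "0 \<le> r"
    show "antimono_on {0..} (b r)"
      by (rule monotone_onI) (auto simp: b_def intro: K_le)
    show "(b r \<longlongrightarrow> 0) at_top"
    proof (rule order_tendstoI)
      fix a :: real assume "a < 0"
      thus "\<forall>\<^sub>F t in at_top. a < b r t" using b_nonneg by (auto intro: always_eventually less_le_trans)
    next
      fix a :: real assume a: "0 < a"
      have "\<forall>\<^sub>F t in at_top. H r - H a < t" by (rule eventually_gt_at_top)
      thus "\<forall>\<^sub>F t in at_top. b r t < a"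
      proof eventually_elim
        case (elim t)
        thus ?case using a KH[OF a] K_less[of "H r - t" "H a"] by (auto simp: b_def)
      qed
    qed
  qed
  moreover have "v t \<le> b (v t0) (t - t0)"
    if "t0 \<le> t" and v: "\<And>s. s \<in> {t0..t} \<Longrightarrow> 0 < v s"
      "\<And>s. s \<in> {t0..t} \<Longrightarrow> (v has_real_derivative d s) (at s within {t0..t})"
      "\<And>s. s \<in> {t0..t} \<Longrightarrow> d s \<le> - \<alpha> (v s)" for v d t0 t
  proof -
    have "H (v t) + t \<le> H (v t0) + t0"
    proof (rule antimono_of_nonpos_derivative[OF \<open>t0 \<le> t\<close>])
      fix s assume s: "s \<in> {t0..t}"
      have "((\<lambda>s. H (v s)) has_real_derivative 1 / \<alpha> (v s) * d s) (at s within {t0..t})"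
        by (rule DERIV_chain2[OF H v(2)]) (use s v in auto)
      thus "((\<lambda>s. H (v s) + s) has_real_derivative 1 / \<alpha> (v s) * d s + 1) (at s within {t0..t})"
        by (intro DERIV_add DERIV_ident)
      show "1 / \<alpha> (v s) * d s + 1 \<le> 0"
        using v(3)[OF s] pos[OF v(1)[OF s]] by (simp add: field_simps)
    qed
    hence "K (H (v t)) \<le> K (H (v t0) - (t - t0))" by (intro K_le) simp
    thus ?thesis using KH v(1)[of t] v(1)[of t0] \<open>t0 \<le> t\<close> by (auto simp: b_def)
  qed
  ultimately show ?thesis using that by blast
qed

lemma class_K_nonneg: "class_K a \<Longrightarrow> 0 \<le> x \<Longrightarrow> 0 \<le> a x"
  unfolding class_K_def by (metis atLeast_iff order.refl strict_mono_on_leD)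

lemma class_KL_nonneg: "class_KL b \<Longrightarrow> 0 \<le> r \<Longrightarrow> 0 \<le> t \<Longrightarrow> 0 \<le> b r t"
  unfolding class_KL_def using class_K_nonneg by blast

lemma class_K_compose:
  assumes "class_K a" "class_K c"
  shows "class_K (\<lambda>r. a (c r))"
proof -
  have "continuous_on {0..} a" "continuous_on {0..} c" using assms by (simp_all add: class_K_def)
  hence "continuous_on {0..} (\<lambda>r. a (c r))"
    by (rule continuous_on_compose2) (use class_K_nonneg[OF assms(2)] in auto)
  moreover have "strict_mono_on {0..} (\<lambda>r. a (c r))"
  proof (rule strict_mono_onI)
    fix r s :: real assume rs: "r \<in> {0..}" "s \<in> {0..}" "r < s"
    hence "c r < c s" using assms(2) by (auto simp: class_K_def strict_mono_on_def)
    thus "a (c r) < a (c s)"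
      using assms rs class_K_nonneg[OF assms(2)] by (auto simp: class_K_def strict_mono_on_def)
  qed
  ultimately show ?thesis using assms by (simp add: class_K_def)
qed

lemma class_KL_compose:
  assumes b: "class_KL b" and a: "class_K a" and c: "class_K c"
  shows "class_KL (\<lambda>r t. a (b (c r) t))"
  unfolding class_KL_def
proof (intro conjI allI impI)
  have conta: "continuous_on {0..} a" and contc: "continuous_on {0..} c"
    using a c by (simp_all add: class_K_def)
  have contb: "continuous_on ({0..} \<times> {0..}) (\<lambda>(r, t). b r t)"
    using b unfolding class_KL_def by blast
  have "continuous_on ({0..} \<times> {0..}) (\<lambda>z. c (fst z))"
    by (rule continuous_on_compose2[OF contc]) (auto intro!: continuous_intros)
  hence "continuous_on ({0..} \<times> {0..}) (\<lambda>z. (c (fst z), snd z))"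
    by (auto intro!: continuous_intros)
  moreover have "(\<lambda>z. (c (fst z), snd z)) ` ({0..} \<times> {0..}) \<subseteq> {0..} \<times> {0..}"
    by (simp add: image_subset_iff mem_Times_iff class_K_nonneg[OF c])
  ultimately have "continuous_on ({0..} \<times> {0..}) ((\<lambda>(r, t). b r t) \<circ> (\<lambda>z. (c (fst z), snd z)))"
    by (rule continuous_on_compose[OF _ continuous_on_subset[OF contb]])
  moreover have "((\<lambda>(r, t). b r t) \<circ> (\<lambda>z. (c (fst z), snd z))) ` ({0..} \<times> {0..}) \<subseteq> {0..}"
    by (simp add: image_subset_iff class_KL_nonneg[OF b] class_K_nonneg[OF c])
  ultimately have "continuous_on ({0..} \<times> {0..}) (a \<circ> ((\<lambda>(r, t). b r t) \<circ> (\<lambda>z. (c (fst z), snd z))))"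
    by (rule continuous_on_compose[OF _ continuous_on_subset[OF conta]])
  thus "continuous_on ({0..} \<times> {0..}) (\<lambda>(r, t). a (b (c r) t))"
    by (simp add: case_prod_unfold o_def)
next
  fix t :: real assume "0 \<le> t"
  thus "class_K (\<lambda>r. a (b (c r) t))"
    using b by (intro class_K_compose[OF a] class_K_compose[of "\<lambda>r. b r t" c] c) (auto simp: class_KL_def)
next
  fix r :: real assume r: "0 \<le> r"
  have anti: "antimono_on {0..} (b (c r))" and lim: "(b (c r) \<longlongrightarrow> 0) at_top"
    using b class_K_nonneg[OF c r] unfolding class_KL_def by simp_all
  show "antimono_on {0..} (\<lambda>t. a (b (c r) t))"
  proof (rule monotone_onI)
    fix s t :: real assume st: "s \<in> {0..}" "t \<in> {0..}" "s \<le> t"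
    hence "b (c r) t \<le> b (c r) s" using monotone_onD[OF anti] by simp
    thus "a (b (c r) t) \<le> a (b (c r) s)"
      using a class_KL_nonneg[OF b class_K_nonneg[OF c r]] st
      by (intro strict_mono_on_leD[of "{0..}" a]) (auto simp: class_K_def)
  qed
  have conta: "continuous_on {0..} a" using a by (simp add: class_K_def)
  have "\<forall>\<^sub>F t in at_top. b (c r) t \<in> {0..}"
    using eventually_ge_at_top[of 0]
    by eventually_elim (simp add: class_KL_nonneg[OF b class_K_nonneg[OF c r]])
  hence "((\<lambda>t. a (b (c r) t)) \<longlongrightarrow> a 0) at_top"
    by (intro continuous_on_tendsto_compose[OF conta lim]) simp_all
  thus "((\<lambda>t. a (b (c r) t)) \<longlongrightarrow> 0) at_top" using a by (simp add: class_K_def)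
qed

text \<open>The rate \<open>\<alpha> s = inf (W x + \<bar>V x - s\<bar>)\<close> is 1-Lipschitz in \<open>s\<close>; the point \<open>x\<close> itself shows
  \<open>\<alpha> (V x) \<le> W x\<close> and the zero \<open>z\<close> shows \<open>\<alpha> s \<le> s\<close>.  It is positive for \<open>s > 0\<close> because the infimum over the
  compact sublevel set \<open>V \<le> s + 1\<close> is attained and the terms outside that set are at least 1.\<close>

lemma decay_rate_of_positive_definite:
  fixes V W :: "'a::topological_space \<Rightarrow> real"
  assumes contV: "continuous_on S V" and contW: "continuous_on S W"
    and sublevel: "\<And>c. compact {x \<in> S. V x \<le> c}"
    and W0: "\<And>x. x \<in> S \<Longrightarrow> 0 \<le> W x"
    and zero: "z \<in> S" "V z = 0" "W z = 0"
    and pd: "\<And>x. x \<in> S \<Longrightarrow> W x = 0 \<Longrightarrow> V x = 0"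
  obtains \<alpha> :: "real \<Rightarrow> real" where "continuous_on {0<..} \<alpha>"
    "\<And>s. 0 < s \<Longrightarrow> 0 < \<alpha> s" "\<And>s. 0 < s \<Longrightarrow> \<alpha> s \<le> s" "\<And>x. x \<in> S \<Longrightarrow> \<alpha> (V x) \<le> W x"
proof -
  define \<alpha> where "\<alpha> s = (INF x\<in>S. W x + \<bar>V x - s\<bar>)" for s
  have bdd: "bdd_below ((\<lambda>x. W x + \<bar>V x - s\<bar>) ` S)" for s
    using W0 by (intro bdd_belowI2[of _ 0]) (simp add: add_nonneg_nonneg)
  have below: "\<alpha> s \<le> W x + \<bar>V x - s\<bar>" if "x \<in> S" for x s
    unfolding \<alpha>_def by (rule cINF_lower[OF bdd that])
  have above: "c \<le> \<alpha> s" if "\<And>x. x \<in> S \<Longrightarrow> c \<le> W x + \<bar>V x - s\<bar>" for c s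
    unfolding \<alpha>_def by (rule cINF_greatest) (use zero that in auto)
  have lip: "\<alpha> s - \<bar>s - t\<bar> \<le> \<alpha> t" for s t
  proof (rule above)
    fix x assume "x \<in> S"
    from below[OF this, of s] show "\<alpha> s - \<bar>s - t\<bar> \<le> W x + \<bar>V x - t\<bar>" by linarith
  qed
  have "1-lipschitz_on {0<..} \<alpha>"
  proof (rule lipschitz_onI)
    fix s t :: real
    show "dist (\<alpha> s) (\<alpha> t) \<le> 1 * dist s t"
      using lip[of s t] lip[of t s] by (auto simp: dist_real_def abs_if split: if_splits)
  qed simp
  moreover have "0 < \<alpha> s" if s: "0 < s" for s
  proof -
    let ?C = "{x \<in> S. V x \<le> s + 1}"
    have "\<exists>x\<in>?C. \<forall>y\<in>?C. W x + \<bar>V x - s\<bar> \<le> W y + \<bar>V y - s\<bar>"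
    proof (rule continuous_attains_inf[OF sublevel])
      show "?C \<noteq> {}" using zero s by force
      show "continuous_on ?C (\<lambda>x. W x + \<bar>V x - s\<bar>)"
        by (intro continuous_intros continuous_on_subset[OF contW] continuous_on_subset[OF contV]) auto
    qed
    then obtain x where x: "x \<in> ?C" "\<And>y. y \<in> ?C \<Longrightarrow> W x + \<bar>V x - s\<bar> \<le> W y + \<bar>V y - s\<bar>" by blast
    define m where "m = min 1 (W x + \<bar>V x - s\<bar>)"
    have "0 < W x + \<bar>V x - s\<bar>"
    proof (cases "W x = 0")
      case True
      thus ?thesis using pd[of x] x s by auto
    next
      case False
      thus ?thesis using W0[of x] x by auto
    qed
    hence "0 < m" by (simp add: m_def)
    also have "m \<le> \<alpha> s"
    proof (rule above)
      fix y assume y: "y \<in> S"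
      show "m \<le> W y + \<bar>V y - s\<bar>"
        using x(2)[of y] y W0[OF y] by (cases "V y \<le> s + 1") (auto simp: m_def)
    qed
    finally show ?thesis .
  qed
  moreover have "\<alpha> s \<le> s" if "0 < s" for s using below[OF zero(1), of s] zero that by simp
  moreover have "\<alpha> (V x) \<le> W x" if "x \<in> S" for x using below[OF that, of "V x"] by simp
  ultimately show ?thesis using that lipschitz_on_continuous_on by blast
qed

section \<open>Legendre--Fenchel duality\<close>

text \<open>In this locale \<open>D\<close> is \<open>[0, w)\<close>, \<open>\<phi> = (\<mu>')\<inverse>\<close> and \<open>L\<close> is the transform \<open>\<ell>\<mu>\<close>.\<close>

locale young_pair =
  fixes w :: ereal and \<mu> :: "real \<Rightarrow> real"
  assumes w: "0 < w" and \<mu>: "class_K_inf w \<mu>" and diff: "\<mu> differentiable_on upto_w w"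
    and slope: "class_K_inf w (deriv_w w \<mu>)"
begin

abbreviation "D \<equiv> upto_w w"
abbreviation "\<mu>' \<equiv> deriv_w w \<mu>"
abbreviation "\<phi> \<equiv> inv_deriv w \<mu>"
abbreviation "L \<equiv> legendre w \<mu>"

lemma D_nonneg: "x \<in> D \<Longrightarrow> 0 \<le> x"
  by (simp add: upto_w_def)

lemma zero_in_D: "0 \<in> D"
  using w by (simp add: upto_w_def zero_ereal_def[symmetric])

lemma D_interval: "x \<in> D \<Longrightarrow> 0 \<le> y \<Longrightarrow> y \<le> x \<Longrightarrow> y \<in> D"
  by (auto simp: upto_w_def intro: le_less_trans[of "ereal y" "ereal x"])

text \<open>The filter of the class \<open>\<K>\<^sub>\<infinity>[0, w)\<close> condition is nontrivial and concentrated on \<open>D\<close>.\<close>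

lemma D_eventually:
  assumes "\<forall>\<^sub>F x in filtercomap ereal (at_left w). P x"
  obtains x where "x \<in> D" "P x"
proof -
  obtain Q where Q: "eventually Q (at_left w)" "\<And>x. Q (ereal x) \<Longrightarrow> P x"
    using assms by (auto simp: eventually_filtercomap)
  obtain b where b: "b < w" "\<And>y. b < y \<Longrightarrow> y < w \<Longrightarrow> Q y"
    using Q(1) w by (subst (asm) eventually_at_left[of 0]) auto
  obtain x where x: "max b 0 < ereal x" "ereal x < w"
    using ereal_dense2[of "max b 0" w] b(1) w by auto
  hence "Q (ereal x)" using b(2)[of "ereal x"] by auto
  hence "P x" by (rule Q(2))
  moreover have "x \<in> D" using x by (auto simp: upto_w_def)
  ultimately show ?thesis by (rule that[rotated])
qed

lemma slope_zero: "\<mu>' 0 = 0" and slope_cont: "continuous_on D \<mu>'" and slope_mono: "strict_mono_on D \<mu>'"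
  using slope by (auto simp: class_K_inf_def)

lemma slope_nonneg: "x \<in> D \<Longrightarrow> 0 \<le> \<mu>' x"
  using strict_mono_on_leD[OF slope_mono zero_in_D] slope_zero D_nonneg by force

lemma slope_surj:
  assumes "0 \<le> y" shows "\<exists>x\<in>D. \<mu>' x = y"
proof -
  have "\<forall>\<^sub>F x in filtercomap ereal (at_left w). y \<le> \<mu>' x"
    using slope by (auto simp: class_K_inf_def filterlim_at_top)
  then obtain a where a: "a \<in> D" "y \<le> \<mu>' a" by (rule D_eventually)
  have "\<exists>x\<ge>0. x \<le> a \<and> \<mu>' x = y"
  proof (rule IVT')
    show "continuous_on {0..a} \<mu>'"
      using a D_interval by (intro continuous_on_subset[OF slope_cont]) auto
  qed (use a assms slope_zero D_nonneg in auto)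
  thus ?thesis using D_interval a(1) by blast
qed

lemma slope_inj: "inj_on \<mu>' D"
  using slope_mono strict_mono_on_imp_inj_on by blast

lemma slope_image: "\<mu>' ` D = {0..}"
  using slope_surj slope_nonneg by (auto simp: image_iff)

lemma \<phi>_in_D: "0 \<le> y \<Longrightarrow> \<phi> y \<in> D" and slope_\<phi>: "0 \<le> y \<Longrightarrow> \<mu>' (\<phi> y) = y"
  using the_inv_into_into[OF slope_inj, of y D] f_the_inv_into_f[OF slope_inj, of y] slope_image
  by (auto simp: inv_deriv_def)

lemma \<phi>_slope: "x \<in> D \<Longrightarrow> \<phi> (\<mu>' x) = x"
  by (simp add: inv_deriv_def the_inv_into_f_f[OF slope_inj])

lemma \<phi>_zero: "\<phi> 0 = 0"
  using \<phi>_slope[OF zero_in_D] slope_zero by simp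

lemma \<phi>_nonneg: "0 \<le> y \<Longrightarrow> 0 \<le> \<phi> y"
  using \<phi>_in_D D_nonneg by blast

lemma \<phi>_pos: "0 < y \<Longrightarrow> 0 < \<phi> y"
  using \<phi>_nonneg[of y] slope_\<phi>[of y] slope_zero by (cases "\<phi> y = 0") auto

lemma \<phi>_less: "0 \<le> x \<Longrightarrow> x < y \<Longrightarrow> \<phi> x < \<phi> y"
  using strict_mono_on_leD[OF slope_mono, of "\<phi> y" "\<phi> x"] \<phi>_in_D[of x] \<phi>_in_D[of y] slope_\<phi>[of x] slope_\<phi>[of y]
  by (cases "\<phi> x < \<phi> y") auto

text \<open>The inverse of a continuous injection of a compact interval is continuous; every point of
  \<open>[0, \<infinity>)\<close> has a relative neighbourhood \<open>[0, y + 1]\<close> that is the image of such an interval.\<close>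

lemma \<phi>_cont: "continuous_on {0..} \<phi>"
proof (rule continuous_on_eq_continuous_within[THEN iffD2, rule_format])
  fix y :: real assume y: "y \<in> {0..}"
  define a where "a = \<phi> (y + 1)"
  have a: "a \<in> D" "\<mu>' a = y + 1" using y \<phi>_in_D slope_\<phi> by (auto simp: a_def)
  have sub: "{0..a} \<subseteq> D" using D_interval[OF a(1)] by auto
  have img: "\<mu>' ` {0..a} = {0..y + 1}"
  proof (intro equalityI subsetI)
    fix z assume "z \<in> \<mu>' ` {0..a}"
    then obtain x where x: "x \<in> {0..a}" "z = \<mu>' x" by blast
    hence "\<mu>' x \<le> \<mu>' a" using sub a by (intro strict_mono_on_leD[OF slope_mono]) auto
    thus "z \<in> {0..y+1}" using x sub slope_nonneg a by auto
  next
    fix z assume z: "z \<in> {0..y+1}"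
    have "\<phi> z \<le> a"
      using z \<phi>_less[of z "y+1"] by (cases "z = y + 1") (auto simp: a_def)
    thus "z \<in> \<mu>' ` {0..a}"
      using z slope_\<phi>[of z] \<phi>_nonneg[of z] by (intro image_eqI[of _ _ "\<phi> z"]) auto
  qed
  have "continuous_on (\<mu>' ` {0..a}) \<phi>"
    using sub by (intro continuous_on_inv continuous_on_subset[OF slope_cont]) (auto simp: \<phi>_slope)
  hence "continuous (at y within {0..y+1}) \<phi>"
    using y img by (auto simp: continuous_on_eq_continuous_within)
  moreover have "at y within {0..y+1} = at y within {0..}"
    by (rule at_within_nhd[of _ "{..<y+1}"]) auto
  ultimately show "continuous (at y within {0..}) \<phi>" by simp
qed

lemma \<mu>_zero: "\<mu> 0 = 0" and \<mu>_nonneg: "x \<in> D \<Longrightarrow> 0 \<le> \<mu> x"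
proof -
  show "\<mu> 0 = 0" using \<mu> by (simp add: class_K_inf_def)
  thus "x \<in> D \<Longrightarrow> 0 \<le> \<mu> x"
    using strict_mono_on_leD[of D \<mu> 0 x] \<mu> zero_in_D D_nonneg by (auto simp: class_K_inf_def)
qed

lemma \<mu>_deriv:
  assumes "{a..b} \<subseteq> D" "x \<in> {a..b}"
  shows "(\<mu> has_real_derivative \<mu>' x) (at x within {a..b})"
proof -
  have "(\<mu> has_vector_derivative \<mu>' x) (at x within D)"
    using diff assms unfolding deriv_w_def differentiable_on_def
    by (subst vector_derivative_works[symmetric]) auto
  hence "(\<mu> has_vector_derivative \<mu>' x) (at x within {a..b})"
    using assms(1) by (rule has_vector_derivative_within_subset)
  thus ?thesis by (simp add: has_real_derivative_iff_has_vector_derivative)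
qed

text \<open>Convexity of \<open>\<mu>\<close>, from the mean value theorem and the monotonicity of \<open>\<mu>'\<close>.\<close>

lemma \<mu>_above_tangent:
  assumes a: "a \<in> D" and c: "c \<in> D"
  shows "\<mu> c + \<mu>' c * (a - c) \<le> \<mu> a"
proof (cases a c rule: linorder_cases)
  case less
  have sub: "{a..c} \<subseteq> D" using D_interval[OF c] D_nonneg[OF a] by auto
  have "\<exists>x\<in>{a..c}. \<mu> c - \<mu> a = \<mu>' x * (c - a)"
    using less \<mu>_deriv[OF sub] by (intro mvt_very_simple) (auto simp: has_field_derivative_def)
  then obtain x where x: "x \<in> {a..c}" "\<mu> c - \<mu> a = \<mu>' x * (c - a)" by blast
  have "\<mu>' x \<le> \<mu>' c" using x sub c by (intro strict_mono_on_leD[OF slope_mono]) auto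
  hence "\<mu>' x * (c - a) \<le> \<mu>' c * (c - a)" using less by (intro mult_right_mono) auto
  thus ?thesis using x(2) by (simp add: algebra_simps)
next
  case greater
  have sub: "{c..a} \<subseteq> D" using D_interval[OF a] D_nonneg[OF c] by auto
  have "\<exists>x\<in>{c..a}. \<mu> a - \<mu> c = \<mu>' x * (a - c)"
    using greater \<mu>_deriv[OF sub] by (intro mvt_very_simple) (auto simp: has_field_derivative_def)
  then obtain x where x: "x \<in> {c..a}" "\<mu> a - \<mu> c = \<mu>' x * (a - c)" by blast
  have "\<mu>' c \<le> \<mu>' x" using x sub c by (intro strict_mono_on_leD[OF slope_mono]) auto
  hence "\<mu>' c * (a - c) \<le> \<mu>' x * (a - c)" using greater by (intro mult_right_mono) auto
  thus ?thesis using x(2) by (simp add: algebra_simps)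
qed simp

text \<open>The convex conjugate \<open>sup {a * b - \<mu> a | a}\<close>, written at its maximiser \<open>a = \<phi> b\<close>.\<close>

definition conjugate :: "real \<Rightarrow> real" where
  "conjugate b = b * \<phi> b - \<mu> (\<phi> b)"

lemma young_conjugate:
  assumes "a \<in> D" "0 \<le> b" shows "a * b \<le> \<mu> a + conjugate b"
  using \<mu>_above_tangent[OF assms(1) \<phi>_in_D[OF assms(2)]] slope_\<phi>[OF assms(2)]
  by (simp add: conjugate_def algebra_simps)

lemma conjugate_subgradient:
  assumes "0 \<le> b" "0 \<le> c" shows "\<phi> b * (c - b) \<le> conjugate c - conjugate b"
  using young_conjugate[OF \<phi>_in_D[OF assms(1)] assms(2)] by (simp add: conjugate_def algebra_simps)

text \<open>The subgradient inequality at \<open>b\<close> and at \<open>c\<close> traps the difference quotient between \<open>\<phi> b\<close> and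
  \<open>\<phi> c\<close>.  Hence \<open>\<phi>\<close>, which need not be differentiable, is the derivative of the conjugate, and the
  conjugate is the integral that defines the Legendre--Fenchel transform.\<close>

lemma conjugate_deriv:
  assumes "0 \<le> b" shows "(conjugate has_real_derivative \<phi> b) (at b within {0..})"
proof -
  have lim: "(\<phi> \<longlongrightarrow> \<phi> b) (at b within {0..})" using \<phi>_cont assms by (auto simp: continuous_on_def)
  have "((\<lambda>c. (conjugate c - conjugate b) / (c - b) - \<phi> b) \<longlongrightarrow> 0) (at b within {0..})"
  proof (rule Lim_null_comparison)
    have "\<bar>(conjugate c - conjugate b) / (c - b) - \<phi> b\<bar> \<le> \<bar>\<phi> c - \<phi> b\<bar>" if "0 \<le> c" "c \<noteq> b" for c
    proof -
      have 1: "\<phi> b * (c - b) \<le> conjugate c - conjugate b" and 2: "conjugate c - conjugate b \<le> \<phi> c * (c - b)"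
        using conjugate_subgradient[of b c] conjugate_subgradient[of c b] assms that by (auto simp: algebra_simps)
      show ?thesis
      proof (cases "b < c")
        case True
        hence "\<phi> b \<le> (conjugate c - conjugate b) / (c - b)" "(conjugate c - conjugate b) / (c - b) \<le> \<phi> c"
          using 1 2 by (auto simp: pos_le_divide_eq pos_divide_le_eq)
        thus ?thesis by auto
      next
        case False
        hence "c < b" using that by simp
        hence "\<phi> c \<le> (conjugate c - conjugate b) / (c - b)" "(conjugate c - conjugate b) / (c - b) \<le> \<phi> b"
          using 1 2 by (auto simp: neg_le_divide_eq neg_divide_le_eq)
        thus ?thesis by auto
      qed
    qed
    thus "\<forall>\<^sub>F c in at b within {0..}. norm ((conjugate c - conjugate b) / (c - b) - \<phi> b) \<le> \<bar>\<phi> c - \<phi> b\<bar>"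
      unfolding eventually_at_filter by (intro always_eventually) auto
    show "((\<lambda>c. \<bar>\<phi> c - \<phi> b\<bar>) \<longlongrightarrow> 0) (at b within {0..})"
      using tendsto_rabs[OF tendsto_diff[OF lim tendsto_const[of "\<phi> b"]]] by simp
  qed
  thus ?thesis
    by (simp add: has_field_derivative_iff LIM_zero_iff)
qed

lemma legendre_eq_conjugate:
  assumes "0 \<le> b" shows "L b = conjugate b"
proof -
  have "(\<phi> has_integral (conjugate b - conjugate 0)) {0..b}"
  proof (rule fundamental_theorem_of_calculus[OF assms])
    fix x assume "x \<in> {0..b}"
    thus "(conjugate has_vector_derivative \<phi> x) (at x within {0..b})"
      using has_vector_derivative_within_subset[of conjugate "\<phi> x" x "{0..}" "{0..b}"] conjugate_deriv[of x]
      by (simp add: has_real_derivative_iff_has_vector_derivative)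
  qed
  moreover have "conjugate 0 = 0" by (simp add: conjugate_def \<phi>_zero \<mu>_zero)
  ultimately show ?thesis by (simp add: legendre_def integral_unique)
qed

lemma young: "a \<in> D \<Longrightarrow> 0 \<le> b \<Longrightarrow> a * b \<le> \<mu> a + L b"
  using young_conjugate by (simp add: legendre_eq_conjugate)

lemma young_eq: "0 \<le> b \<Longrightarrow> \<mu> (\<phi> b) + L b = b * \<phi> b"
  by (simp add: legendre_eq_conjugate conjugate_def)

lemma legendre_zero: "L 0 = 0"
  by (simp add: legendre_def)

lemma legendre_le: "0 \<le> b \<Longrightarrow> L b \<le> b * \<phi> b"
  using young_eq[of b] \<mu>_nonneg[OF \<phi>_in_D, of b] by simp

lemma legendre_pos:
  assumes "0 < b" shows "0 < L b"
proof -
  have "0 < \<phi> (b / 2) * (b / 2)" using assms \<phi>_pos[of "b/2"] by simp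
  also have "\<dots> \<le> L b - L (b / 2)"
    using conjugate_subgradient[of "b/2" b] assms by (simp add: legendre_eq_conjugate)
  also have "0 \<le> L (b / 2)"
    using conjugate_subgradient[of 0 "b/2"] assms legendre_zero by (simp add: legendre_eq_conjugate \<phi>_zero)
  hence "L b - L (b / 2) \<le> L b" by simp
  finally show ?thesis .
qed

lemma legendre_nonneg: "0 \<le> b \<Longrightarrow> 0 \<le> L b"
  using legendre_pos[of b] legendre_zero by (cases "b = 0") auto

lemma legendre_cont: "continuous_on {0..} L"
proof -
  have "continuous_on {0..} conjugate"
    using conjugate_deriv by (intro DERIV_continuous_on) auto
  thus ?thesis by (rule continuous_on_eq) (simp add: legendre_eq_conjugate)
qed

text \<open>At 0 the quotient tends to its default value 0 because \<open>0 \<le> L b / b \<le> \<phi> b\<close>.\<close>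

lemma legendre_quotient_cont: "continuous_on {0..} (\<lambda>b. L b / b)"
proof (rule continuous_on_eq_continuous_within[THEN iffD2, rule_format])
  fix b :: real assume b: "b \<in> {0..}"
  show "continuous (at b within {0..}) (\<lambda>b. L b / b)"
  proof (cases "b = 0")
    case True
    have "((\<lambda>b. L b / b) \<longlongrightarrow> 0) (at 0 within {0..})"
    proof (rule Lim_null_comparison)
      have "norm (L c / c) \<le> \<phi> c" if "0 \<le> c" for c
        using legendre_le[OF that] legendre_nonneg[OF that] \<phi>_nonneg[OF that] that
        by (cases "c = 0") (auto simp: pos_divide_le_eq mult.commute)
      thus "\<forall>\<^sub>F c in at 0 within {0..}. norm (L c / c) \<le> \<phi> c"
        unfolding eventually_at_filter by (intro always_eventually) auto
      have "(\<phi> \<longlongrightarrow> \<phi> 0) (at 0 within {0..})" using \<phi>_cont by (auto simp: continuous_on_def)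
      thus "(\<phi> \<longlongrightarrow> 0) (at 0 within {0..})" by (simp add: \<phi>_zero)
    qed
    thus ?thesis using True by (simp add: continuous_within)
  next
    case False
    have "(L \<longlongrightarrow> L b) (at b within {0..})" using legendre_cont b by (auto simp: continuous_on_def)
    thus ?thesis
      unfolding continuous_within using tendsto_divide[OF _ tendsto_ident_at False] by blast
  qed
qed

lemma mem_D_iff: "0 \<le> a \<Longrightarrow> a \<in> D \<longleftrightarrow> ereal a < w"
  by (simp add: upto_w_def)

text \<open>Outside \<open>D\<close> the penalty is infinite, so the inequality holds for all inputs.\<close>

lemma young_penalty:
  assumes "0 \<le> a" "0 \<le> b"
  shows "ennreal (a * b) \<le> penalty w \<mu> a + ennreal (L b)"
proof (cases "ereal a < w")
  case True
  hence a: "a \<in> D" using assms by (simp add: mem_D_iff)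
  have "ennreal (a * b) \<le> ennreal (\<mu> a + L b)" using young[OF a assms(2)] by (rule ennreal_leI)
  thus ?thesis using True \<mu>_nonneg[OF a] legendre_nonneg[OF assms(2)] by (simp add: penalty_def ennreal_plus)
qed (simp add: penalty_def)

lemma young_penalty_eq:
  assumes "0 \<le> b"
  shows "penalty w \<mu> (\<phi> b) + ennreal (L b) = ennreal (b * \<phi> b)"
proof -
  have "ereal (\<phi> b) < w" using \<phi>_in_D[OF assms] by (simp add: upto_w_def)
  thus ?thesis
    using young_eq[OF assms] \<mu>_nonneg[OF \<phi>_in_D[OF assms]] legendre_nonneg[OF assms]
    by (simp add: penalty_def ennreal_plus[symmetric] del: ennreal_plus)
qed

end

section \<open>Chain rule along Caratheodory trajectories\<close>

text \<open>A bound on short increments is additive over a sufficiently fine equidistant partition.\<close>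

lemma abs_increment_le_of_local:
  fixes F A :: "real \<Rightarrow> real"
  assumes "0 < d" "a \<le> b"
    and loc: "\<And>s t. a \<le> s \<Longrightarrow> s \<le> t \<Longrightarrow> t \<le> b \<Longrightarrow> t - s < d \<Longrightarrow> \<bar>F t - F s\<bar> \<le> A t - A s"
  shows "\<bar>F b - F a\<bar> \<le> A b - A a"
proof -
  obtain n :: nat where n: "(b - a) / d < real n" using reals_Archimedean2 by blast
  hence n0: "0 < real n" using assms by (smt (verit) divide_nonneg_pos)
  define h where "h = (b - a) / real n"
  have h: "0 \<le> h" "h < d"
    using n n0 assms by (auto simp: h_def field_simps)
  have nh: "real n * h = b - a" using n0 by (simp add: h_def)
  have "\<bar>F (a + real i * h) - F a\<bar> \<le> A (a + real i * h) - A a" if "i \<le> n" for i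
    using that
  proof (induction i)
    case (Suc i)
    have "real (Suc i) * h \<le> real n * h" using Suc.prems h by (intro mult_right_mono) auto
    hence le: "a + real (Suc i) * h \<le> b" using nh by simp
    have step: "a + real (Suc i) * h - (a + real i * h) = h" by (simp add: algebra_simps)
    have "\<bar>F (a + real (Suc i) * h) - F (a + real i * h)\<bar> \<le> A (a + real (Suc i) * h) - A (a + real i * h)"
    proof (rule loc)
      show "a \<le> a + real i * h" using h by simp
    qed (use step h le in linarith)+
    thus ?case using Suc by linarith
  qed simp
  from this[of n] show ?thesis using nh by simp
qed

text \<open>An absolutely continuous curve \<open>Y\<close> given as an indefinite integral of \<open>y\<close> obeys the chain rule
  in integrated form.  On a short interval \<open>[s, t]\<close> both \<open>V (Y t) - V (Y s)\<close> and the integral of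
  \<open>g (Y r) \<bullet> y r\<close> differ from \<open>g (Y s) \<bullet> (Y t - Y s)\<close> by at most \<open>e / 2\<close> times the integral of \<open>norm (y r)\<close>, by
  uniform continuity of \<open>g\<close> on the convex hull of the curve.  Summing over a partition bounds the
  total discrepancy by \<open>e\<close> times a constant, for every \<open>e > 0\<close>.\<close>

theorem chain_rule_indefinite_integral:
  fixes V :: "'a::euclidean_space \<Rightarrow> real" and g :: "'a \<Rightarrow> 'a" and Y y :: "real \<Rightarrow> 'a" and T :: real
  assumes "convex S" and V: "\<And>x. x \<in> S \<Longrightarrow> (V has_derivative (\<lambda>h. g x \<bullet> h)) (at x)"
    and g: "continuous_on S g"
    and "0 \<le> T" and YS: "\<And>t. t \<in> {0..T} \<Longrightarrow> Y t \<in> S"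
    and y: "y absolutely_integrable_on {0..T}"
    and Y: "\<And>t. t \<in> {0..T} \<Longrightarrow> (y has_integral (Y t - Y 0)) {0..t}"
  shows "(\<lambda>s. g (Y s) \<bullet> y s) absolutely_integrable_on {0..T}"
    and "integral {0..T} (\<lambda>s. g (Y s) \<bullet> y s) = V (Y T) - V (Y 0)"
proof -
  let ?G = "\<lambda>s. g (Y s) \<bullet> y s"
  have yi: "y integrable_on {0..T}" and ni: "(\<lambda>s. norm (y s)) integrable_on {0..T}"
    using y by (simp_all add: absolutely_integrable_on_def)
  have "continuous_on {0..T} (\<lambda>t. Y 0 + integral {0..t} y)"
    by (rule continuous_on_add[OF continuous_on_const indefinite_integral_continuous_1[OF yi]])
  hence contY: "continuous_on {0..T} Y"
    by (rule continuous_on_eq) (use integral_unique[OF Y] in simp)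
  have contgY: "continuous_on {0..T} (\<lambda>s. g (Y s))"
    by (rule continuous_on_compose2[OF g contY]) (use YS in auto)
  show G: "?G absolutely_integrable_on {0..T}"
  proof (rule absolutely_integrable_bounded_measurable_product[of inner])
    show "bilinear (inner :: 'a \<Rightarrow> _)"
      using bilinear_conv_bounded_bilinear bounded_bilinear_inner by blast
    show "(\<lambda>s. g (Y s)) \<in> borel_measurable (lebesgue_on {0..T})"
      by (rule continuous_imp_measurable_on_sets_lebesgue[OF contgY]) simp
    show "bounded ((\<lambda>s. g (Y s)) ` {0..T})"
      by (intro compact_imp_bounded compact_continuous_image contgY compact_Icc)
  qed (use y in simp_all)
  hence Gi: "?G integrable_on {0..T}" by (simp add: absolutely_integrable_on_def)
  define K where "K = convex hull (Y ` {0..T})"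
  have K: "compact K"
    unfolding K_def by (intro compact_convex_hull compact_continuous_image contY compact_Icc)
  have KS: "K \<subseteq> S" unfolding K_def using YS \<open>convex S\<close> by (intro hull_minimal) auto
  have YK: "Y t \<in> K" if "t \<in> {0..T}" for t unfolding K_def using that by (intro hull_inc) auto
  have unifg: "uniformly_continuous_on K g"
    by (rule compact_uniformly_continuous[OF continuous_on_subset[OF g KS] K])
  have unifY: "uniformly_continuous_on {0..T} Y"
    by (rule compact_uniformly_continuous[OF contY compact_Icc])
  \<comment> \<open>The discrepancy, to be shown constant.\<close>
  define F where "F t = V (Y t) - integral {0..t} ?G" for t
  define N where "N t = integral {0..t} (\<lambda>s. norm (y s))" for t
  have bound: "\<bar>F T - F 0\<bar> \<le> e * N T" if "0 < e" for e
  proof -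
    obtain d where d: "0 < d" "\<And>x z. x \<in> K \<Longrightarrow> z \<in> K \<Longrightarrow> dist z x < d \<Longrightarrow> dist (g z) (g x) < e / 2"
      using unifg \<open>0 < e\<close> unfolding uniformly_continuous_on_def by (metis half_gt_zero)
    obtain \<delta> where \<delta>: "0 < \<delta>" "\<And>s t. s \<in> {0..T} \<Longrightarrow> t \<in> {0..T} \<Longrightarrow> dist t s < \<delta> \<Longrightarrow> dist (Y t) (Y s) < d"
      using unifY d(1) unfolding uniformly_continuous_on_def by metis
    have "\<bar>F T - F 0\<bar> \<le> e * N T - e * N 0"
    proof (rule abs_increment_le_of_local[OF \<delta>(1) \<open>0 \<le> T\<close>])
      fix s t assume st: "0 \<le> s" "s \<le> t" "t \<le> T" "t - s < \<delta>"
      have sT: "s \<in> {0..T}" "t \<in> {0..T}" using st by auto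
      have sub: "f integrable_on {s..t}" "integral {0..t} f - integral {0..s} f = integral {s..t} f"
        if "f integrable_on {0..T}" for f :: "real \<Rightarrow> 'b::euclidean_space"
      proof -
        have f: "f integrable_on {0..t}" by (rule integrable_on_subinterval[OF that]) (use st in auto)
        thus "integral {0..t} f - integral {0..s} f = integral {s..t} f"
          using Henstock_Kurzweil_Integration.integral_combine[OF st(1,2) f] by (simp add: algebra_simps)
        show "f integrable_on {s..t}" by (rule integrable_on_subinterval[OF that]) (use st in auto)
      qed
      have Yst: "Y t - Y s = integral {s..t} y"
        using sub(2)[OF yi] integral_unique[OF Y[OF sT(1)]] integral_unique[OF Y[OF sT(2)]] by simp
      have gd: "norm (g (Y r) - g (Y s)) \<le> e / 2" if "r \<in> {s..t}" for r
        using d(2)[of "Y s" "Y r"] \<delta>(2)[of s r] that st YK by (auto simp: dist_norm less_imp_le)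
      have int_norm: "norm (Y t - Y s) \<le> integral {s..t} (\<lambda>r. norm (y r))"
        unfolding Yst by (rule Henstock_Kurzweil_Integration.integral_norm_bound_integral) (auto intro: sub(1) yi ni)
      \<comment> \<open>Both quantities are compared with the linearisation of \<open>V\<close> at \<open>Y s\<close>; the segment stays in the convex hull.\<close>
      have "norm (V (Y t) - V (Y s) - g (Y s) \<bullet> (Y t - Y s)) \<le> norm (Y t - Y s) * (e / 2)"
      proof (rule differentiable_bound_linearization[where S = "closed_segment (Y s) (Y t)" and f' = "\<lambda>x h. g x \<bullet> h"])
        have seg: "closed_segment (Y s) (Y t) \<subseteq> K"
          using YK sT by (intro closed_segment_subset) (auto simp: K_def)
        show "Y s + r *\<^sub>R (Y t - Y s) \<in> closed_segment (Y s) (Y t)" if "r \<in> {0..1}" for r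
          using that by (auto simp: in_segment algebra_simps intro!: exI[of _ r])
        show "(V has_derivative (\<lambda>h. g x \<bullet> h)) (at x within closed_segment (Y s) (Y t))"
          if "x \<in> closed_segment (Y s) (Y t)" for x
          using has_derivative_at_withinI[OF V] that seg KS by blast
        show "Y s \<in> closed_segment (Y s) (Y t)" by simp
        show "onorm ((\<lambda>h. g x \<bullet> h) - (\<lambda>h. g (Y s) \<bullet> h)) \<le> e / 2"
          if x: "x \<in> closed_segment (Y s) (Y t)" for x
        proof (rule onorm_le)
          fix h :: 'a
          have "dist x (Y s) \<le> dist (Y t) (Y s)"
            using dist_in_closed_segment[OF x] by (simp add: dist_commute)
          also have "\<dots> < d" using \<delta>(2)[OF sT] st by (simp add: dist_real_def)
          finally have "norm (g x - g (Y s)) \<le> e / 2"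
            using d(2)[of "Y s" x] x seg YK sT by (auto simp: dist_norm less_imp_le)
          hence "norm (g x - g (Y s)) * norm h \<le> e / 2 * norm h" by (rule mult_right_mono) simp
          thus "norm (((\<lambda>h. g x \<bullet> h) - (\<lambda>h. g (Y s) \<bullet> h)) h) \<le> e / 2 * norm h"
            using Cauchy_Schwarz_ineq2[of "g x - g (Y s)" h] by (simp add: inner_diff_left)
        qed
      qed
      also have "\<dots> \<le> integral {s..t} (\<lambda>r. norm (y r)) * (e / 2)"
        using int_norm \<open>0 < e\<close> by (intro mult_right_mono) auto
      finally have 1: "\<bar>V (Y t) - V (Y s) - g (Y s) \<bullet> (Y t - Y s)\<bar> \<le> e / 2 * integral {s..t} (\<lambda>r. norm (y r))"
        by (simp add: mult.commute)
      have gy: "((\<lambda>r. g (Y s) \<bullet> y r) has_integral g (Y s) \<bullet> (Y t - Y s)) {s..t}"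
        unfolding Yst
        using has_integral_linear[OF integrable_integral[OF sub(1)[OF yi]] bounded_linear_inner_right[of "g (Y s)"]]
        by (simp only: o_def)
      have Gst: "(?G has_integral integral {s..t} ?G) {s..t}" by (rule integrable_integral[OF sub(1)[OF Gi]])
      have h1: "((\<lambda>r. ?G r - g (Y s) \<bullet> y r) has_integral integral {s..t} ?G - g (Y s) \<bullet> (Y t - Y s)) {s..t}"
        by (rule has_integral_diff[OF Gst gy])
      have h2: "((\<lambda>r. e / 2 * norm (y r)) has_integral e / 2 * integral {s..t} (\<lambda>r. norm (y r))) {s..t}"
        by (rule has_integral_mult_right[OF integrable_integral[OF sub(1)[OF ni]]])
      have h3: "norm (?G r - g (Y s) \<bullet> y r) \<le> e / 2 * norm (y r)" if "r \<in> {s..t}" for r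
      proof -
        have "norm (?G r - g (Y s) \<bullet> y r) \<le> norm (g (Y r) - g (Y s)) * norm (y r)"
          using Cauchy_Schwarz_ineq2[of "g (Y r) - g (Y s)" "y r"] by (simp add: inner_diff_left)
        also have "\<dots> \<le> e / 2 * norm (y r)" using gd[OF that] by (rule mult_right_mono) simp
        finally show ?thesis .
      qed
      have 2: "\<bar>integral {s..t} ?G - g (Y s) \<bullet> (Y t - Y s)\<bar> \<le> e / 2 * integral {s..t} (\<lambda>r. norm (y r))"
        using Henstock_Kurzweil_Integration.integral_norm_bound_integral[OF
            has_integral_integrable[OF h1] has_integral_integrable[OF h2] h3]
        unfolding integral_unique[OF h1] integral_unique[OF h2] real_norm_def .
      have FN: "F t - F s = V (Y t) - V (Y s) - integral {s..t} ?G" "N t - N s = integral {s..t} (\<lambda>r. norm (y r))"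
        using sub(2)[OF Gi] sub(2)[OF ni] by (simp_all add: F_def N_def)
      have "\<bar>F t - F s\<bar> \<le> e * (N t - N s)" 
      proof -
        define I where "I = integral {s..t} (\<lambda>r. norm (y r))"
        show ?thesis using 1 2 unfolding FN I_def[symmetric] by linarith
      qed
      thus "\<bar>F t - F s\<bar> \<le> e * N t - e * N s" by (simp add: algebra_simps)
    qed
    thus ?thesis by (simp add: N_def)
  qed
  have N0: "0 \<le> N T" unfolding N_def by (rule integral_nonneg[OF ni]) simp
  have "\<bar>F T - F 0\<bar> \<le> 0"
  proof (rule field_le_epsilon)
    fix e :: real assume "0 < e"
    have "e / (N T + 1) * N T \<le> e" using N0 \<open>0 < e\<close> by (simp add: field_simps)
    moreover have "\<bar>F T - F 0\<bar> \<le> e / (N T + 1) * N T" using N0 \<open>0 < e\<close> by (intro bound) simp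
    ultimately show "\<bar>F T - F 0\<bar> \<le> 0 + e" by linarith
  qed
  thus "integral {0..T} ?G = V (Y T) - V (Y 0)" by (simp add: F_def)
qed

section \<open>Coordinates and gradient of the Lyapunov function\<close>

definition dist_of :: "state \<Rightarrow> real" where "dist_of x = fst x"
definition azimuth :: "state \<Rightarrow> real" where "azimuth x = fst (snd x)"
definition los_angle :: "state \<Rightarrow> real" where "los_angle x = fst (snd (snd x))"
definition elevation :: "state \<Rightarrow> real" where "elevation x = fst (snd (snd (snd x)))"
definition pitch :: "state \<Rightarrow> real" where "pitch x = snd (snd (snd (snd x)))"

lemmas coordinate_defs = dist_of_def azimuth_def los_angle_def elevation_def pitch_def

lemma state_eq_iff:
  "x = y \<longleftrightarrow> dist_of x = dist_of y \<and> azimuth x = azimuth y \<and> los_angle x = los_angle y \<and>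
     elevation x = elevation y \<and> pitch x = pitch y"
  by (auto simp: coordinate_defs prod_eq_iff)

lemma coordinate_derivs [derivative_intros]:
  "(dist_of has_derivative dist_of) F" "(azimuth has_derivative azimuth) F"
  "(los_angle has_derivative los_angle) F" "(elevation has_derivative elevation) F"
  "(pitch has_derivative pitch) F"
  unfolding coordinate_defs[abs_def] by (auto intro!: derivative_eq_intros)

lemma coordinate_continuous [continuous_intros]:
  "continuous_on A dist_of" "continuous_on A azimuth" "continuous_on A los_angle"
  "continuous_on A elevation" "continuous_on A pitch"
  unfolding coordinate_defs[abs_def] by (auto intro!: continuous_intros)

lemma coordinates_zero [simp]:
  "dist_of 0 = 0" "azimuth 0 = 0" "los_angle 0 = 0" "elevation 0 = 0" "pitch 0 = 0"
  by (simp_all add: coordinate_defs)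

text \<open>No restriction on \<open>\<rho>\<close>: \<open>V\<close> is smooth on this open set, which contains the boundary points
  \<open>\<rho> = 0\<close> of \<open>dom_Sigma\<close>, so its derivative at those points is two-sided as well.\<close>

definition strip :: "state set" where "strip = {x. \<bar>elevation x\<bar> < pi / 2}"

lemma open_strip: "open strip"
  unfolding strip_def elevation_def by (intro open_Collect_less continuous_intros)

lemma cos_elevation_pos: "x \<in> strip \<Longrightarrow> 0 < cos (elevation x)"
  by (intro cos_gt_zero_pi) (auto simp: strip_def)

lemma continuous_on_tan_elevation: "continuous_on strip (\<lambda>x. tan (elevation x))"
proof -
  have "\<forall>x\<in>strip. cos (elevation x) \<noteq> 0" using cos_elevation_pos by force
  thus ?thesis unfolding tan_def by (intro continuous_intros)
qed

lemma mem_dom_D: "x \<in> dom_D \<longleftrightarrow> 0 < dist_of x \<and> x \<in> strip"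
  by (cases x) (auto simp: dom_D_def strip_def coordinate_defs)

lemma mem_dom_Sigma: "x \<in> dom_Sigma \<longleftrightarrow> 0 \<le> dist_of x \<and> x \<in> strip"
  by (cases x) (auto simp: dom_Sigma_def strip_def coordinate_defs)

lemma dom_D_subset_Sigma: "dom_D \<subseteq> dom_Sigma" and dom_Sigma_subset_strip: "dom_Sigma \<subseteq> strip"
  by (auto simp: mem_dom_D mem_dom_Sigma)

lemma open_dom_D: "open dom_D"
proof -
  have "dom_D = {x. 0 < dist_of x} \<inter> strip" by (auto simp: mem_dom_D)
  moreover have "open {x. 0 < dist_of x}" by (intro open_Collect_less continuous_intros)
  ultimately show ?thesis using open_strip by (metis open_Int)
qed

lemma convex_dom_D: "convex dom_D"
proof (rule convexI)
  fix x y :: state and u v :: real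
  assume x: "x \<in> dom_D" and y: "y \<in> dom_D" and uv: "0 \<le> u" "0 \<le> v" "u + v = 1"
  have 1: "dist_of (u *\<^sub>R x + v *\<^sub>R y) = u * dist_of x + v * dist_of y"
    "elevation (u *\<^sub>R x + v *\<^sub>R y) = u * elevation x + v * elevation y"
    by (simp_all add: coordinate_defs)
  have "u * (- dist_of x) + v * (- dist_of y) < 0"
    using x y uv by (intro convex_bound_lt) (auto simp: mem_dom_D)
  moreover have "u * elevation x + v * elevation y < pi / 2"
    using x y uv by (intro convex_bound_lt) (auto simp: mem_dom_D strip_def)
  moreover have "u * (- elevation x) + v * (- elevation y) < pi / 2"
    using x y uv by (intro convex_bound_lt) (auto simp: mem_dom_D strip_def)
  ultimately have "0 < u * dist_of x + v * dist_of y" "\<bar>u * elevation x + v * elevation y\<bar> < pi / 2"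
    by linarith+
  thus "u *\<^sub>R x + v *\<^sub>R y \<in> dom_D"
    by (simp add: mem_dom_D strip_def 1)
qed

locale clf_gains =
  fixes k :: "nat \<Rightarrow> real"
  assumes k_pos: "\<And>i. i \<in> {1..5} \<Longrightarrow> 0 < k i"
begin

lemma k_pos' [simp]: "0 < k (Suc 0)" "0 < k 1" "0 < k 2" "0 < k 3" "0 < k 4" "0 < k 5"
  using k_pos[of 1] k_pos[of 2] k_pos[of 3] k_pos[of 4] k_pos[of 5] by simp_all

lemma k_nonneg' [simp]: "0 \<le> k (Suc 0)" "0 \<le> k 1" "0 \<le> k 2" "0 \<le> k 3" "0 \<le> k 4" "0 \<le> k 5"
  using k_pos' by (simp_all only: less_imp_le)

abbreviation "V \<equiv> clf k"
abbreviation "E1 \<equiv> e1 k"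
abbreviation "E2 \<equiv> e2 k"
abbreviation "Eta x \<equiv> eta k (azimuth x) (elevation x)"

text \<open>The reference values that \<open>e1\<close> and \<open>e2\<close> compare with are \<open>- arctan (tan_los x)\<close> for the
  line-of-sight angle and \<open>- arctan (Eta x)\<close>, where \<open>Eta x = eta_num x / sec_los x\<close>, for the pitch.  The
  suffixes \<open>_az\<close> and \<open>_el\<close> mark partial derivatives in azimuth and elevation.\<close>

definition tan_los :: "state \<Rightarrow> real" where "tan_los x = k 2 * azimuth x * cos (elevation x)"
definition tan_los_az :: "state \<Rightarrow> real" where "tan_los_az x = k 2 * cos (elevation x)"
definition tan_los_el :: "state \<Rightarrow> real" where "tan_los_el x = - (k 2 * azimuth x * sin (elevation x))"
definition sec_los :: "state \<Rightarrow> real" where "sec_los x = sqrt (1 + (tan_los x)\<^sup>2)"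
definition eta_num :: "state \<Rightarrow> real" where "eta_num x = k 3 * sin (elevation x) + tan (elevation x)"
definition eta_az :: "state \<Rightarrow> real" where "eta_az x = - (eta_num x * tan_los x * tan_los_az x / sec_los x ^ 3)"
definition eta_el :: "state \<Rightarrow> real" where "eta_el x = (k 3 * cos (elevation x) + inverse ((cos (elevation x))\<^sup>2)) / sec_los x
    - eta_num x * tan_los x * tan_los_el x / sec_los x ^ 3"

definition grad :: "state \<Rightarrow> state" where
  "grad x =
    (k 1 * dist_of x,
     k 2 * azimuth x + k 4 * E1 x * (inverse (1 + (tan_los x)\<^sup>2) * tan_los_az x)
       + k 5 * E2 x * (inverse (1 + (Eta x)\<^sup>2) * eta_az x),
     k 4 * E1 x,
     k 3 * tan (elevation x) * inverse ((cos (elevation x))\<^sup>2)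
       + k 4 * E1 x * (inverse (1 + (tan_los x)\<^sup>2) * tan_los_el x)
       + k 5 * E2 x * (inverse (1 + (Eta x)\<^sup>2) * eta_el x),
     k 5 * E2 x)"

lemma E1_eq: "E1 x = los_angle x + arctan (tan_los x)"
  by (cases x) (simp add: e1_def tan_los_def coordinate_defs)

lemma Eta_eq: "Eta x = eta_num x / sec_los x"
  by (simp add: eta_def eta_num_def sec_los_def tan_los_def power_mult_distrib)

lemma E2_eq: "E2 x = pitch x + arctan (Eta x)"
  by (cases x) (simp add: e2_def coordinate_defs)

lemma V_eq: "V x = (k 1 * (dist_of x)\<^sup>2 + k 2 * (azimuth x)\<^sup>2 + k 3 * (tan (elevation x))\<^sup>2
    + k 4 * (E1 x)\<^sup>2 + k 5 * (E2 x)\<^sup>2) / 2"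
  by (cases x) (simp add: clf_def coordinate_defs)

lemma sec_los_pos: "0 < sec_los x"
  by (simp add: sec_los_def add_pos_nonneg)

lemma tan_los_deriv: "(tan_los has_derivative (\<lambda>h. tan_los_az x * azimuth h + tan_los_el x * elevation h)) (at x)"
  unfolding tan_los_def[abs_def] tan_los_az_def tan_los_el_def
  by (auto intro!: derivative_eq_intros simp: algebra_simps)

lemma eta_num_deriv:
  "x \<in> strip \<Longrightarrow> (eta_num has_derivative
     (\<lambda>h. (k 3 * cos (elevation x) + inverse ((cos (elevation x))\<^sup>2)) * elevation h)) (at x)"
  unfolding eta_num_def[abs_def]
  by (auto intro!: derivative_eq_intros simp: algebra_simps dest: cos_elevation_pos)

lemma sec_los_deriv:
  "(sec_los has_derivative (\<lambda>h. tan_los x * (tan_los_az x * azimuth h + tan_los_el x * elevation h) / sec_los x)) (at x)"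
proof -
  let ?p' = "\<lambda>h. tan_los_az x * azimuth h + tan_los_el x * elevation h"
  have S: "((\<lambda>x. 1 + (tan_los x)\<^sup>2) has_derivative (\<lambda>h. 2 * (tan_los x * ?p' h))) (at x)"
    by (rule has_derivative_eq_rhs[OF has_derivative_add[OF has_derivative_const has_derivative_power[OF tan_los_deriv[of x]]]])
      (simp add: fun_eq_iff algebra_simps)
  have pos: "0 < 1 + (tan_los x)\<^sup>2" by (simp add: add_pos_nonneg)
  have D: "(sec_los has_derivative (\<lambda>h. 2 * (tan_los x * ?p' h) * (inverse (sqrt (1 + (tan_los x)\<^sup>2)) / 2))) (at x)"
    unfolding sec_los_def[abs_def] by (rule has_derivative_real_sqrt[OF pos S])
  show ?thesis
    by (rule has_derivative_eq_rhs[OF D]) (rule ext, simp add: sec_los_def inverse_eq_divide)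
qed

lemma Eta_deriv:
  assumes "x \<in> strip"
  shows "((\<lambda>x. Eta x) has_derivative (\<lambda>h. eta_az x * azimuth h + eta_el x * elevation h)) (at x)"
proof -
  have r: "sec_los x \<noteq> 0" using sec_los_pos[of x] by simp
  define n' where "n' = k 3 * cos (elevation x) + inverse ((cos (elevation x))\<^sup>2)"
  show ?thesis
    unfolding Eta_eq
  proof (rule has_derivative_eq_rhs[OF has_derivative_divide'[OF eta_num_deriv[OF assms] sec_los_deriv r]], rule ext)
    fix h
    show "((k 3 * cos (elevation x) + inverse ((cos (elevation x))\<^sup>2)) * elevation h * sec_los x -
          eta_num x * (tan_los x * (tan_los_az x * azimuth h + tan_los_el x * elevation h) / sec_los x)) / (sec_los x * sec_los x)
        = eta_az x * azimuth h + eta_el x * elevation h"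
      unfolding eta_az_def eta_el_def n'_def[symmetric]
      using r by (simp add: field_simps power3_eq_cube)
  qed
qed

lemma E1_deriv:
  "(E1 has_derivative (\<lambda>h. los_angle h + inverse (1 + (tan_los x)\<^sup>2) * (tan_los_az x * azimuth h + tan_los_el x * elevation h))) (at x)"
  unfolding E1_eq[abs_def]
  by (rule derivative_eq_intros tan_los_deriv refl)+ (simp add: mult.commute)

lemma E2_deriv:
  assumes "x \<in> strip"
  shows "(E2 has_derivative (\<lambda>h. pitch h + inverse (1 + (Eta x)\<^sup>2) * (eta_az x * azimuth h + eta_el x * elevation h))) (at x)"
  unfolding E2_eq[abs_def]
  by (rule derivative_eq_intros Eta_deriv[OF assms] refl)+ (simp add: mult.commute)

lemma V_deriv:
  assumes "x \<in> strip"
  shows "(V has_derivative (\<lambda>h. grad x \<bullet> h)) (at x)"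
proof -
  have c: "cos (elevation x) \<noteq> 0" using cos_elevation_pos[OF assms] by simp
  have tan: "((\<lambda>x. tan (elevation x)) has_derivative (\<lambda>h. elevation h * inverse ((cos (elevation x))\<^sup>2))) (at x)"
    by (rule has_derivative_tan[OF c coordinate_derivs(4)])
  have sq: "((\<lambda>x. c * (f x)\<^sup>2) has_derivative (\<lambda>h. 2 * c * (f x * f' h))) (at x)"
    if "(f has_derivative f') (at x)" for f f' :: "state \<Rightarrow> real" and c
    by (rule has_derivative_eq_rhs[OF has_derivative_mult_right[OF has_derivative_power[OF that]]])
      (simp add: fun_eq_iff)
  note sum = has_derivative_add[OF has_derivative_add[OF has_derivative_add[OF has_derivative_add[OF
    sq[OF coordinate_derivs(1), of "k 1"] sq[OF coordinate_derivs(2), of "k 2"]]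
    sq[OF tan, of "k 3"]] sq[OF E1_deriv, of "k 4"]] sq[OF E2_deriv[OF assms], of "k 5"]]
  show ?thesis
    unfolding V_eq[abs_def]
    by (rule has_derivative_eq_rhs[OF bounded_linear.has_derivative[OF bounded_linear_divide sum]])
      (simp add: fun_eq_iff grad_def inner_prod_def coordinate_defs algebra_simps)
qed

lemma continuous_parts [continuous_intros]:
  "continuous_on strip tan_los" "continuous_on strip tan_los_az" "continuous_on strip tan_los_el"
  "continuous_on strip sec_los" "continuous_on strip eta_num" "continuous_on strip eta_az" "continuous_on strip eta_el"
  "continuous_on strip E1" "continuous_on strip (\<lambda>x. Eta x)" "continuous_on strip E2"
proof -
  have c: "\<forall>x\<in>strip. cos (elevation x) \<noteq> 0" using cos_elevation_pos by force
  have r: "\<forall>x\<in>strip. sec_los x \<noteq> 0" using sec_los_pos by (metis less_irrefl)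
  note tan = continuous_on_tan_elevation
  show 1: "continuous_on strip tan_los" "continuous_on strip tan_los_az" "continuous_on strip tan_los_el"
    unfolding tan_los_def[abs_def] tan_los_az_def[abs_def] tan_los_el_def[abs_def] by (intro continuous_intros)+
  show 2: "continuous_on strip sec_los" "continuous_on strip eta_num"
    unfolding sec_los_def[abs_def] eta_num_def[abs_def] by (intro continuous_intros 1 tan)+
  show 3: "continuous_on strip eta_az" "continuous_on strip eta_el"
    unfolding eta_az_def[abs_def] eta_el_def[abs_def] by (intro continuous_intros 1 2; use c r in simp)+
  show 4: "continuous_on strip E1" "continuous_on strip (\<lambda>x. Eta x)"
    unfolding E1_eq[abs_def] Eta_eq by (intro continuous_intros 1 2; use r in simp)+
  show "continuous_on strip E2"
    unfolding E2_eq[abs_def] by (intro continuous_intros 4)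
qed

lemma grad_cont: "continuous_on strip grad"
proof -
  have c: "\<forall>x\<in>strip. cos (elevation x) \<noteq> 0" using cos_elevation_pos by force
  note tan = continuous_on_tan_elevation
  have s: "1 + y\<^sup>2 \<noteq> 0" for y :: real by (metis add_pos_nonneg less_irrefl zero_le_power2 zero_less_one)
  show ?thesis
    unfolding grad_def[abs_def] by (intro continuous_intros tan; use c s in simp)
qed

lemma V_cont: "continuous_on strip V"
  unfolding V_eq[abs_def] by (intro continuous_intros continuous_on_tan_elevation) auto

end

section \<open>Lie derivatives and properness of the Lyapunov function\<close>

lemma norm_state_le:
  "norm (x :: state) \<le> \<bar>dist_of x\<bar> + \<bar>azimuth x\<bar> + \<bar>los_angle x\<bar> + \<bar>elevation x\<bar> + \<bar>pitch x\<bar>"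
proof -
  have "norm x \<le> norm (fst x) + norm (snd x)" for x :: "'a::real_normed_vector \<times> 'b::real_normed_vector"
    using norm_Pair_le[of "fst x" "snd x"] by simp
  from this[of x] this[of "snd x"] this[of "snd (snd x)"] this[of "snd (snd (snd x))"]
  show ?thesis by (simp add: coordinate_defs)
qed

lemma norm_D_eq: "norm_D x = dist_of x + \<bar>azimuth x\<bar> + \<bar>los_angle x\<bar> + \<bar>tan (elevation x)\<bar> + \<bar>pitch x\<bar>"
  by (cases x) (simp add: norm_D_def coordinate_defs)

lemma lie_derivative_eq_inner:
  "(V has_derivative (\<lambda>h. g \<bullet> h)) (at x) \<Longrightarrow> lie_derivative f V x = g \<bullet> f x"
  by (simp add: lie_derivative_def frechet_derivative_at[symmetric])

lemma g1_bar_eq: "g1_bar x =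
   (dist_of x * (sin (pitch x) * sin (elevation x) - cos (pitch x) * cos (elevation x) * cos (los_angle x)),
    cos (pitch x) / cos (elevation x) * sin (los_angle x),
    cos (pitch x) / cos (elevation x) * sin (los_angle x),
    cos (pitch x) * sin (elevation x) * cos (los_angle x) + sin (pitch x) * cos (elevation x),
    0)"
  by (cases x) (simp add: g1_bar_def coordinate_defs)

lemma g1_bar_cont: "continuous_on strip g1_bar"
proof -
  have "\<forall>x\<in>strip. cos (elevation x) \<noteq> 0" using cos_elevation_pos by force
  thus ?thesis unfolding g1_bar_eq[abs_def] by (intro continuous_intros)
qed

context clf_gains
begin

definition nu1 :: "state \<Rightarrow> real" where "nu1 x = grad x \<bullet> g1_bar x"
definition nu2 :: "state \<Rightarrow> real" where "nu2 x = k 5 * E2 x"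
definition nu3 :: "state \<Rightarrow> real" where "nu3 x = - (k 4 * E1 x)"

lemma grad_inner_g2: "grad x \<bullet> g2 x = nu2 x" and grad_inner_g3: "grad x \<bullet> g3_bar x = nu3 x"
  by (simp_all add: nu2_def nu3_def g2_def g3_bar_def grad_def inner_prod_def)

lemma nu_eq: "x \<in> strip \<Longrightarrow> nu k x = (nu1 x, nu2 x, nu3 x)"
  by (simp only: nu_def lie_derivative_eq_inner[OF V_deriv] grad_inner_g2 grad_inner_g3 nu1_def)

lemma grad_inner_inputs:
  "grad x \<bullet> (u1 *\<^sub>R g1_bar x + u2 *\<^sub>R g2 x + u3 *\<^sub>R g3_bar x) = u1 * nu1 x + u2 * nu2 x + u3 * nu3 x"
  by (simp only: inner_add_right inner_scaleR_right grad_inner_g2 grad_inner_g3 nu1_def)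

lemma nu_cont: "continuous_on strip nu1" "continuous_on strip nu2" "continuous_on strip nu3"
  unfolding nu1_def[abs_def] nu2_def[abs_def] nu3_def[abs_def]
  by (intro continuous_intros grad_cont g1_bar_cont)+

text \<open>On \<open>e1 = e2 = 0\<close> the sines and cosines of both angles are algebraic in the tangents \<open>tan_los\<close> and
  \<open>Eta\<close>.  The definition of \<open>eta\<close> is made so that \<open>s - eta_num x * c = - k 3 * s * c\<close>, which turns the
  elevation term into a negative square.\<close>

lemma nu1_on_zero_errors:
  assumes x: "x \<in> strip" and "E1 x = 0" "E2 x = 0"
  defines "c \<equiv> cos (elevation x)" and "s \<equiv> sin (elevation x)"
  shows "nu1 x * (sqrt (1 + (Eta x)\<^sup>2) * sec_los x)
    = - (k 1 * (dist_of x)\<^sup>2 * (k 3 * s\<^sup>2 + s\<^sup>2 / c + c) + (k 2 * azimuth x)\<^sup>2 + (k 3 * s / c)\<^sup>2)"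
proof -
  define q where "q = sqrt (1 + (Eta x)\<^sup>2)"
  define r where "r = sec_los x"
  have c: "c > 0" and r: "r > 0" and q: "q > 0"
    using cos_elevation_pos[OF x] sec_los_pos by (auto simp: c_def r_def q_def add_pos_nonneg)
  have los: "los_angle x = arctan (- tan_los x)" and pitch: "pitch x = arctan (- Eta x)"
    using assms(2,3) by (auto simp: E1_eq E2_eq arctan_minus)
  have "sqrt (1 + (tan_los x)\<^sup>2) = r" by (simp add: r_def sec_los_def)
  hence g: "cos (los_angle x) = 1 / r" "sin (los_angle x) = - tan_los x / r"
    unfolding los cos_arctan sin_arctan by simp_all
  have "Eta x = eta_num x / r" by (simp add: Eta_eq r_def)
  hence t: "cos (pitch x) = 1 / q" "sin (pitch x) = - eta_num x / (r * q)"
    unfolding pitch cos_arctan sin_arctan by (simp_all add: q_def)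
  have n: "eta_num x = k 3 * s + s / c" by (simp add: eta_num_def tan_def c_def s_def)
  have pp: "tan_los x = k 2 * azimuth x * c" by (simp add: tan_los_def c_def)
  have "nu1 x = k 1 * dist_of x * (dist_of x * (sin (pitch x) * s - cos (pitch x) * c * cos (los_angle x)))
     + k 2 * azimuth x * (cos (pitch x) / c * sin (los_angle x))
     + k 3 * (s / c) * inverse (c\<^sup>2) * (cos (pitch x) * s * cos (los_angle x) + sin (pitch x) * c)"
    unfolding nu1_def grad_def g1_bar_eq
    using assms(2,3) by (simp add: tan_def c_def s_def)
  also have "\<dots> * (q * r) = - (k 1 * (dist_of x)\<^sup>2 * (k 3 * s\<^sup>2 + s\<^sup>2 / c + c) + (k 2 * azimuth x)\<^sup>2 + (k 3 * s / c)\<^sup>2)"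
    unfolding g t n pp using c r q by (simp add: field_simps power2_eq_square)
  finally show ?thesis by (simp add: q_def r_def)
qed

text \<open>The control Lyapunov property: \<open>V\<close> can be decreased at every point of \<open>dom_Sigma\<close> but the
  origin, boundary \<open>\<rho> = 0\<close> included.\<close>

lemma nu_eq_zero_imp:
  assumes x: "x \<in> dom_Sigma" and "nu1 x = 0" "nu2 x = 0" "nu3 x = 0"
  shows "x = 0"
proof -
  have xs: "x \<in> strip" using x dom_Sigma_subset_strip by blast
  have E: "E1 x = 0" "E2 x = 0"
    using assms k_pos' by (auto simp: nu2_def nu3_def)
  define c where "c = cos (elevation x)"
  define s where "s = sin (elevation x)"
  have c: "0 < c" using cos_elevation_pos[OF xs] by (simp add: c_def)
  define A where "A = k 1 * (dist_of x)\<^sup>2 * (k 3 * s\<^sup>2 + s\<^sup>2 / c + c)"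
  have w: "0 < k 3 * s\<^sup>2 + s\<^sup>2 / c + c"
    using c by (intro add_nonneg_pos add_nonneg_nonneg) auto
  have A0: "0 \<le> A" unfolding A_def using w by (intro mult_nonneg_nonneg) auto
  have "A + (k 2 * azimuth x)\<^sup>2 + (k 3 * s / c)\<^sup>2 = 0"
    using nu1_on_zero_errors[OF xs E] assms(2) by (simp add: A_def c_def s_def)
  hence z: "A = 0" "(k 2 * azimuth x)\<^sup>2 = 0" "(k 3 * s / c)\<^sup>2 = 0"
    using A0 zero_le_power2[of "k 2 * azimuth x"] zero_le_power2[of "k 3 * s / c"] by linarith+
  have kn: "k 1 \<noteq> 0" "k 2 \<noteq> 0" "k 3 \<noteq> 0" using k_pos' less_irrefl by metis+
  have "dist_of x = 0" using z(1) w kn(1) unfolding A_def by auto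
  moreover have az: "azimuth x = 0" using z(2) kn(2) by simp
  moreover have s0: "sin (elevation x) = 0" using z(3) c kn(3) unfolding s_def by simp
  have el: "elevation x = 0"
  proof (rule sin_eq_0_pi[OF _ _ s0])
    have "\<bar>elevation x\<bar> < pi / 2" using xs by (simp add: strip_def)
    thus "- pi < elevation x" "elevation x < pi" using pi_gt_zero by linarith+
  qed
  moreover have "los_angle x = 0" using E(1) az by (simp add: E1_eq tan_los_def)
  moreover have "pitch x = 0" using E(2) el by (simp add: E2_eq eta_def)
  ultimately show ?thesis by (simp add: state_eq_iff)
qed

lemma V_nonneg: "0 \<le> V x"
  unfolding V_eq using k_pos' by (intro divide_nonneg_pos add_nonneg_nonneg mult_nonneg_nonneg) auto

lemma V_zero: "V 0 = 0"
  by (simp add: V_eq E1_eq E2_eq tan_los_def eta_def)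

lemma V_pos: "x \<in> dom_D \<Longrightarrow> 0 < V x"
  unfolding V_eq using k_pos'
  by (intro divide_pos_pos add_pos_nonneg mult_pos_pos mult_nonneg_nonneg) (auto simp: mem_dom_D intro: less_imp_le)

lemma abs_tan_los_le: "\<bar>tan_los x\<bar> \<le> k 2 * \<bar>azimuth x\<bar>"
proof -
  have "\<bar>tan_los x\<bar> = k 2 * \<bar>azimuth x\<bar> * \<bar>cos (elevation x)\<bar>"
    using k_pos' by (simp add: tan_los_def abs_mult)
  also have "\<dots> \<le> k 2 * \<bar>azimuth x\<bar> * 1"
    using k_pos' by (intro mult_left_mono) (auto intro: less_imp_le mult_nonneg_nonneg)
  finally show ?thesis by simp
qed

lemma abs_Eta_le:
  assumes "x \<in> strip" shows "\<bar>Eta x\<bar> \<le> (k 3 + 1) * \<bar>tan (elevation x)\<bar>"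
proof -
  have c: "0 < cos (elevation x)" "cos (elevation x) \<le> 1" using cos_elevation_pos[OF assms] by auto
  have "\<bar>sin (elevation x)\<bar> = \<bar>tan (elevation x)\<bar> * cos (elevation x)"
    using c by (simp add: tan_def)
  also have "\<dots> \<le> \<bar>tan (elevation x)\<bar> * 1" using c by (intro mult_left_mono) auto
  finally have s: "\<bar>sin (elevation x)\<bar> \<le> \<bar>tan (elevation x)\<bar>" by simp
  have "1 \<le> sec_los x" by (simp add: sec_los_def)
  hence "\<bar>Eta x\<bar> \<le> \<bar>eta_num x\<bar>"
    by (simp add: Eta_eq divide_le_eq mult_left_le mult_le_cancel_left1)
  also have "\<bar>eta_num x\<bar> \<le> k 3 * \<bar>sin (elevation x)\<bar> + \<bar>tan (elevation x)\<bar>"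
    unfolding eta_num_def using k_pos' by (simp add: abs_mult abs_triangle_ineq order_trans[OF abs_triangle_ineq])
  also have "\<dots> \<le> k 3 * \<bar>tan (elevation x)\<bar> + \<bar>tan (elevation x)\<bar>"
    using s k_pos' by (intro add_right_mono mult_left_mono) auto
  finally show ?thesis by (simp add: algebra_simps)
qed

lemma abs_angle_bounds:
  assumes "x \<in> strip"
  shows "\<bar>E1 x - los_angle x\<bar> \<le> k 2 * \<bar>azimuth x\<bar>" "\<bar>E2 x - pitch x\<bar> \<le> (k 3 + 1) * \<bar>tan (elevation x)\<bar>"
  using abs_arctan_le[of "tan_los x"] abs_tan_los_le[of x] abs_arctan_le[of "Eta x"] abs_Eta_le[OF assms]
  by (simp_all add: E1_eq E2_eq)

lemma V_le_norm_D: "\<exists>C>0. \<forall>x\<in>dom_Sigma. V x \<le> C * (norm_D x)\<^sup>2"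
proof (intro exI conjI ballI)
  let ?C = "(k 1 + k 2 + k 3 + k 4 * (1 + k 2)\<^sup>2 + k 5 * (2 + k 3)\<^sup>2) / 2"
  show "0 < ?C" using k_pos' by (intro divide_pos_pos add_pos_nonneg mult_nonneg_nonneg) auto
  fix x assume x: "x \<in> dom_Sigma"
  hence xs: "x \<in> strip" and d: "0 \<le> dist_of x" by (auto simp: mem_dom_Sigma)
  let ?N = "norm_D x"
  have N: "\<bar>dist_of x\<bar> \<le> ?N" "\<bar>azimuth x\<bar> \<le> ?N" "\<bar>los_angle x\<bar> \<le> ?N" "\<bar>tan (elevation x)\<bar> \<le> ?N" "\<bar>pitch x\<bar> \<le> ?N"
    using d by (simp_all add: norm_D_eq)
  have m: "k 2 * \<bar>azimuth x\<bar> \<le> k 2 * ?N" "(k 3 + 1) * \<bar>tan (elevation x)\<bar> \<le> (k 3 + 1) * ?N"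
    by (intro mult_left_mono N; simp)+
  have "\<bar>E1 x\<bar> \<le> ?N + k 2 * ?N" "\<bar>E2 x\<bar> \<le> ?N + (k 3 + 1) * ?N"
    using abs_angle_bounds[OF xs] N m by linarith+
  hence E1: "\<bar>E1 x\<bar> \<le> (1 + k 2) * ?N" and E2: "\<bar>E2 x\<bar> \<le> (2 + k 3) * ?N"
    by (simp_all add: algebra_simps)
  have sq: "y\<^sup>2 \<le> b\<^sup>2" if "\<bar>y\<bar> \<le> b" for y b :: real
    using power_mono[OF that, of 2] by simp
  have "V x \<le> (k 1 * ?N\<^sup>2 + k 2 * ?N\<^sup>2 + k 3 * ?N\<^sup>2 + k 4 * ((1 + k 2) * ?N)\<^sup>2 + k 5 * ((2 + k 3) * ?N)\<^sup>2) / 2"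
    unfolding V_eq by (intro divide_right_mono add_mono mult_left_mono sq N E1 E2) simp_all
  also have "\<dots> = ?C * ?N\<^sup>2" by (simp add: power2_eq_square algebra_simps add_divide_distrib)
  finally show "V x \<le> ?C * ?N\<^sup>2" .
qed

text \<open>Each summand of \<open>2 * V\<close> bounds one coordinate or one error by a multiple of \<open>sqrt (V x)\<close>; the
  two angles are recovered from the errors by \<open>abs_angle_bounds\<close>.\<close>

lemma norm_D_le_V: "\<exists>C>0. \<forall>x\<in>dom_Sigma. norm_D x \<le> C * sqrt (V x)"
proof (intro exI conjI ballI)
  define a where "a i = sqrt (2 / k i)" for i
  let ?C = "a 1 + a 2 + (a 4 + k 2 * a 2) + a 3 + (a 5 + (k 3 + 1) * a 3)"
  have a: "0 < a i" if "i \<in> {1..5}" for i using k_pos[OF that] by (simp add: a_def)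
  have a': "0 < a 1" "0 < a 2" "0 < a 3" "0 < a 4" "0 < a 5" by (auto intro: a)
  show "0 < ?C" using a' k_pos' by (intro add_pos_pos mult_pos_pos) auto
  fix x assume x: "x \<in> dom_Sigma"
  hence xs: "x \<in> strip" by (auto simp: mem_dom_Sigma)
  have le: "\<bar>y\<bar> \<le> a i * sqrt (V x)" if "k i * y\<^sup>2 \<le> 2 * V x" "i \<in> {1..5}" for i y
  proof -
    have "y\<^sup>2 \<le> 2 / k i * V x" using that k_pos[OF that(2)] by (simp add: field_simps)
    hence "sqrt (y\<^sup>2) \<le> sqrt (2 / k i * V x)" by (rule real_sqrt_le_mono)
    thus ?thesis by (simp only: a_def real_sqrt_mult real_sqrt_abs)
  qed
  have V2: "2 * V x = k 1 * (dist_of x)\<^sup>2 + k 2 * (azimuth x)\<^sup>2 + k 3 * (tan (elevation x))\<^sup>2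
    + k 4 * (E1 x)\<^sup>2 + k 5 * (E2 x)\<^sup>2"
    by (simp add: V_eq)
  have nn: "0 \<le> k 1 * (dist_of x)\<^sup>2" "0 \<le> k 2 * (azimuth x)\<^sup>2" "0 \<le> k 3 * (tan (elevation x))\<^sup>2"
    "0 \<le> k 4 * (E1 x)\<^sup>2" "0 \<le> k 5 * (E2 x)\<^sup>2"
    by (intro mult_nonneg_nonneg; simp)+
  have le': "k 1 * (dist_of x)\<^sup>2 \<le> 2 * V x" "k 2 * (azimuth x)\<^sup>2 \<le> 2 * V x"
    "k 3 * (tan (elevation x))\<^sup>2 \<le> 2 * V x" "k 4 * (E1 x)\<^sup>2 \<le> 2 * V x" "k 5 * (E2 x)\<^sup>2 \<le> 2 * V x"
    unfolding V2 using nn by linarith+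
  have b: "\<bar>dist_of x\<bar> \<le> a 1 * sqrt (V x)" "\<bar>azimuth x\<bar> \<le> a 2 * sqrt (V x)" "\<bar>tan (elevation x)\<bar> \<le> a 3 * sqrt (V x)"
    "\<bar>E1 x\<bar> \<le> a 4 * sqrt (V x)" "\<bar>E2 x\<bar> \<le> a 5 * sqrt (V x)"
    by (rule le[OF le'(1)] le[OF le'(2)] le[OF le'(3)] le[OF le'(4)] le[OF le'(5)]; simp)+
  have m: "k 2 * \<bar>azimuth x\<bar> \<le> k 2 * (a 2 * sqrt (V x))"
    "(k 3 + 1) * \<bar>tan (elevation x)\<bar> \<le> (k 3 + 1) * (a 3 * sqrt (V x))"
    by (intro mult_left_mono b; simp)+
  have "\<bar>los_angle x\<bar> \<le> \<bar>E1 x\<bar> + \<bar>E1 x - los_angle x\<bar>" by linarith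
  also have "\<dots> \<le> a 4 * sqrt (V x) + k 2 * (a 2 * sqrt (V x))"
    by (intro add_mono b order_trans[OF abs_angle_bounds(1)[OF xs] m(1)])
  finally have los: "\<bar>los_angle x\<bar> \<le> a 4 * sqrt (V x) + k 2 * (a 2 * sqrt (V x))" .
  have "\<bar>pitch x\<bar> \<le> \<bar>E2 x\<bar> + \<bar>E2 x - pitch x\<bar>" by linarith
  also have "\<dots> \<le> a 5 * sqrt (V x) + (k 3 + 1) * (a 3 * sqrt (V x))"
    by (intro add_mono b order_trans[OF abs_angle_bounds(2)[OF xs] m(2)])
  finally have pitch: "\<bar>pitch x\<bar> \<le> a 5 * sqrt (V x) + (k 3 + 1) * (a 3 * sqrt (V x))" .
  have "norm_D x \<le> a 1 * sqrt (V x) + a 2 * sqrt (V x) + (a 4 * sqrt (V x) + k 2 * (a 2 * sqrt (V x)))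
      + a 3 * sqrt (V x) + (a 5 * sqrt (V x) + (k 3 + 1) * (a 3 * sqrt (V x)))"
    unfolding norm_D_eq by (intro add_mono b los pitch order_trans[OF abs_ge_self])
  thus "norm_D x \<le> ?C * sqrt (V x)" by (simp add: algebra_simps)
qed

text \<open>A bound on \<open>V\<close> bounds \<open>tan \<zeta>\<close>, so it keeps the elevation away from \<open>\<plusminus>pi / 2\<close>; this gives
  closedness in the whole space.\<close>

lemma compact_sublevel: "compact {x \<in> dom_Sigma. V x \<le> c}"
proof -
  obtain C where C: "0 < C" "\<And>x. x \<in> dom_Sigma \<Longrightarrow> norm_D x \<le> C * sqrt (V x)"
    using norm_D_le_V by blast
  \<comment> \<open>On the sublevel set \<open>norm_D\<close>, and with it \<open>\<bar>tan \<zeta>\<bar>\<close>, is at most \<open>B\<close>.\<close>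
  define B where "B = C * sqrt c"
  have N: "norm_D x \<le> B" if "x \<in> dom_Sigma" "V x \<le> c" for x
  proof -
    have "C * sqrt (V x) \<le> C * sqrt c" using C(1) that by (intro mult_left_mono) auto
    thus ?thesis using C(2)[OF that(1)] by (simp add: B_def)
  qed
  define Z where "Z = {x. 0 \<le> dist_of x} \<inter> {x. \<bar>elevation x\<bar> \<le> arctan B}"
  have "closed Z"
    unfolding Z_def by (intro closed_Int closed_Collect_le continuous_intros)
  have Zs: "Z \<subseteq> strip" using arctan_ubound[of B] by (auto simp: Z_def strip_def)
  have eq: "{x \<in> dom_Sigma. V x \<le> c} = Z \<inter> V -` {..c}"
  proof (intro equalityI subsetI)
    fix x assume x: "x \<in> {x \<in> dom_Sigma. V x \<le> c}"
    hence t: "\<bar>tan (elevation x)\<bar> \<le> B" using N[of x] by (auto simp: norm_D_eq mem_dom_Sigma)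
    have "\<bar>elevation x\<bar> < pi / 2" using x by (auto simp: mem_dom_Sigma strip_def)
    hence "elevation x = arctan (tan (elevation x))" by (intro arctan_tan[symmetric]) auto
    also have "\<bar>\<dots>\<bar> \<le> arctan B"
      using t arctan_le_iff[of "tan (elevation x)" B] arctan_le_iff[of "- tan (elevation x)" B]
      by (auto simp: arctan_minus abs_le_iff simp del: arctan_le_iff)
    finally show "x \<in> Z \<inter> V -` {..c}" using x by (auto simp: Z_def mem_dom_Sigma)
  qed (use Zs in \<open>auto simp: Z_def mem_dom_Sigma\<close>)
  have "closed (Z \<inter> V -` {..c})"
    by (intro continuous_closed_preimage continuous_on_subset[OF V_cont Zs] \<open>closed Z\<close> closed_atMost)
  moreover have "bounded {x \<in> dom_Sigma. V x \<le> c}"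
  proof (rule boundedI)
    fix x assume x: "x \<in> {x \<in> dom_Sigma. V x \<le> c}"
    hence "\<bar>elevation x\<bar> < pi / 2" "0 \<le> dist_of x" by (auto simp: mem_dom_Sigma strip_def)
    thus "norm x \<le> B + pi / 2" using N[of x] x norm_state_le[of x] by (auto simp: norm_D_eq)
  qed
  ultimately show ?thesis by (simp add: compact_eq_bounded_closed eq)
qed

end

section \<open>Closed loops with damping gains\<close>

text \<open>This is why \<open>f 0 = 0\<close> is required of a gain: the factor \<open>sgn\<close> jumps at 0.\<close>

lemma continuous_odd_extension:
  fixes f :: "real \<Rightarrow> real"
  assumes f: "continuous_on {0..} f" and "f 0 = 0"
  shows "continuous_on UNIV (\<lambda>s. f \<bar>s\<bar> * sgn s)"
proof -
  have "continuous_on ({0..} \<union> {..0}) (\<lambda>s. f \<bar>s\<bar> * sgn s)"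
  proof (rule continuous_on_closed_Un)
    have "continuous_on {0..} (\<lambda>s. f s)" by (rule f)
    thus "continuous_on {0..} (\<lambda>s. f \<bar>s\<bar> * sgn s)"
      by (rule continuous_on_eq) (use \<open>f 0 = 0\<close> in \<open>auto simp: sgn_if\<close>)
    have "continuous_on {..0} (\<lambda>s. - f (- s))"
      by (intro continuous_on_minus continuous_on_compose2[OF f] continuous_on_id) auto
    thus "continuous_on {..0} (\<lambda>s. f \<bar>s\<bar> * sgn s)"
      by (rule continuous_on_eq) (use \<open>f 0 = 0\<close> in \<open>auto simp: sgn_if\<close>)
  qed auto
  moreover have "{0..} \<union> {..0} = (UNIV :: real set)" by auto
  ultimately show ?thesis by simp
qed

text \<open>The common form of the two feedback laws, with the scalar gain functions \<open>f i\<close> as parameters.\<close>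

definition gain_law ::
  "(nat \<Rightarrow> real \<Rightarrow> real) \<Rightarrow> (nat \<Rightarrow> state \<Rightarrow> real) \<Rightarrow> state \<Rightarrow> real \<times> real \<times> real \<Rightarrow> control" where
  "gain_law f \<epsilon> x = (\<lambda>(n1, n2, n3).
     (- fst x * \<epsilon> 1 x * f 1 (\<epsilon> 1 x * \<bar>n1\<bar>) * sgn n1,
      - \<epsilon> 2 x * f 2 (\<epsilon> 2 x * \<bar>n2\<bar>) * sgn n2,
      - \<epsilon> 3 x * f 3 (\<epsilon> 3 x * \<bar>n3\<bar>) * sgn n3))"

locale gain_feedback = clf_gains +
  fixes f :: "nat \<Rightarrow> real \<Rightarrow> real" and \<epsilon> :: "nat \<Rightarrow> state \<Rightarrow> real"
  assumes f_cont: "\<And>i. i \<in> {1..3} \<Longrightarrow> continuous_on {0..} (f i)"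
    and f_zero: "\<And>i. i \<in> {1..3} \<Longrightarrow> f i 0 = 0"
    and f_pos: "\<And>i s. i \<in> {1..3} \<Longrightarrow> 0 < s \<Longrightarrow> 0 < f i s"
    and \<epsilon>_cont: "\<And>i. i \<in> {1..3} \<Longrightarrow> continuous_on dom_Sigma (\<epsilon> i)"
    and \<epsilon>_pos: "\<And>i x. i \<in> {1..3} \<Longrightarrow> x \<in> dom_Sigma \<Longrightarrow> 0 < \<epsilon> i x"
begin

text \<open>The inputs are normalised as coefficients of the fields \<open>g1_bar\<close>, \<open>g2\<close>, \<open>g3_bar\<close>; so the first is
  \<open>v / \<rho>\<close>, and the closed loop extends continuously to \<open>\<rho> = 0\<close>.\<close>

definition u :: "nat \<Rightarrow> real \<Rightarrow> state \<Rightarrow> real" where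
  "u i n x = - (\<epsilon> i x * f i (\<epsilon> i x * \<bar>n\<bar>) * sgn n)"

definition closed_loop :: "state \<Rightarrow> state" where
  "closed_loop x = u 1 (nu1 x) x *\<^sub>R g1_bar x + u 2 (nu2 x) x *\<^sub>R g2 x + u 3 (nu3 x) x *\<^sub>R g3_bar x"

definition W :: "state \<Rightarrow> real" where
  "W x = \<epsilon> 1 x * \<bar>nu1 x\<bar> * f 1 (\<epsilon> 1 x * \<bar>nu1 x\<bar>)
       + \<epsilon> 2 x * \<bar>nu2 x\<bar> * f 2 (\<epsilon> 2 x * \<bar>nu2 x\<bar>)
       + \<epsilon> 3 x * \<bar>nu3 x\<bar> * f 3 (\<epsilon> 3 x * \<bar>nu3 x\<bar>)"

abbreviation "law x \<equiv> gain_law f \<epsilon> x (nu k x)"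

lemma law_eq:
  assumes "x \<in> strip"
  shows "law x = (dist_of x * u 1 (nu1 x) x, u 2 (nu2 x) x, u 3 (nu3 x) x)"
  using assms by (simp add: gain_law_def nu_eq u_def dist_of_def)

lemma vehicle_law:
  assumes "x \<in> dom_D" shows "vehicle x (law x) = closed_loop x"
  using assms by (simp add: law_eq mem_dom_D vehicle_def closed_loop_def dist_of_def)

lemma u_odd: "i \<in> {1..3} \<Longrightarrow> x \<in> dom_Sigma \<Longrightarrow> u i n x = - (\<epsilon> i x * (f i \<bar>\<epsilon> i x * n\<bar> * sgn (\<epsilon> i x * n)))"
  using \<epsilon>_pos[of i x] by (simp add: u_def abs_mult sgn_mult)

lemma odd_f_cont: "i \<in> {1..3} \<Longrightarrow> continuous_on UNIV (\<lambda>s. f i \<bar>s\<bar> * sgn s)"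
  using f_cont f_zero by (rule continuous_odd_extension)

lemma u_cont:
  assumes i: "i \<in> {1..3}" and n: "continuous_on dom_Sigma n"
  shows "continuous_on dom_Sigma (\<lambda>x. u i (n x) x)"
proof -
  have h: "continuous_on dom_Sigma (\<lambda>x. f i \<bar>\<epsilon> i x * n x\<bar> * sgn (\<epsilon> i x * n x))"
    by (rule continuous_on_compose2[OF odd_f_cont[OF i], of dom_Sigma "\<lambda>x. \<epsilon> i x * n x"])
      (intro continuous_on_mult \<epsilon>_cont i n subset_UNIV)+
  have "continuous_on dom_Sigma (\<lambda>x. - (\<epsilon> i x * (f i \<bar>\<epsilon> i x * n x\<bar> * sgn (\<epsilon> i x * n x))))"
    by (rule continuous_on_minus[OF continuous_on_mult[OF \<epsilon>_cont[OF i] h]])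
  thus ?thesis by (rule continuous_on_eq) (simp add: u_odd[OF i])
qed

lemma u_cont_arg:
  assumes i: "i \<in> {1..3}" and x: "x \<in> dom_Sigma"
  shows "continuous_on UNIV (\<lambda>n. u i n x)"
proof -
  have h: "continuous_on UNIV (\<lambda>n. f i \<bar>\<epsilon> i x * n\<bar> * sgn (\<epsilon> i x * n))"
    by (rule continuous_on_compose2[OF odd_f_cont[OF i], of UNIV "\<lambda>n. \<epsilon> i x * n"])
      (intro continuous_on_mult continuous_on_const continuous_on_id subset_UNIV)+
  have "continuous_on UNIV (\<lambda>n. - (\<epsilon> i x * (f i \<bar>\<epsilon> i x * n\<bar> * sgn (\<epsilon> i x * n))))"
    by (rule continuous_on_minus[OF continuous_on_mult[OF continuous_on_const h]])
  thus ?thesis by (simp add: u_odd[OF i x])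
qed

lemma gain_law_cont:
  assumes x: "x \<in> dom_D" shows "continuous_on UNIV (gain_law f \<epsilon> x)"
proof -
  have x': "x \<in> dom_Sigma" using x dom_D_subset_Sigma by blast
  have u: "continuous_on UNIV (\<lambda>n :: real \<times> real \<times> real. u i (g n) x)"
    if "i \<in> {1..3}" "continuous_on UNIV g" for i g
    using continuous_on_compose2[OF u_cont_arg[OF that(1) x'] that(2)] by simp
  have "gain_law f \<epsilon> x = (\<lambda>n. (dist_of x * u 1 (fst n) x, u 2 (fst (snd n)) x, u 3 (snd (snd n)) x))"
    by (auto simp: gain_law_def u_def dist_of_def)
  moreover have "continuous_on UNIV \<dots>"
    by (intro continuous_on_Pair continuous_on_mult continuous_on_const u
        continuous_on_fst continuous_on_snd continuous_on_id) auto
  ultimately show ?thesis by simp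
qed

lemma nu_cont_Sigma: "continuous_on dom_Sigma nu1" "continuous_on dom_Sigma nu2" "continuous_on dom_Sigma nu3"
  using nu_cont dom_Sigma_subset_strip by (blast intro: continuous_on_subset)+

lemma inputs_cont:
  "continuous_on dom_Sigma (\<lambda>x. u 1 (nu1 x) x)" "continuous_on dom_Sigma (\<lambda>x. u 2 (nu2 x) x)"
  "continuous_on dom_Sigma (\<lambda>x. u 3 (nu3 x) x)"
  by (intro u_cont nu_cont_Sigma; simp)+

lemma closed_loop_cont: "continuous_on dom_Sigma closed_loop"
  unfolding closed_loop_def[abs_def] g2_def g3_bar_def
  by (intro continuous_on_add continuous_on_scaleR inputs_cont continuous_on_const
      continuous_on_subset[OF g1_bar_cont dom_Sigma_subset_strip])

lemma law_cont: "continuous_on dom_D law"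
proof -
  have "continuous_on dom_D (\<lambda>x. (dist_of x * u 1 (nu1 x) x, u 2 (nu2 x) x, u 3 (nu3 x) x))"
    by (intro continuous_on_Pair continuous_on_mult coordinate_continuous
        continuous_on_subset[OF inputs_cont(1) dom_D_subset_Sigma]
        continuous_on_subset[OF inputs_cont(2) dom_D_subset_Sigma]
        continuous_on_subset[OF inputs_cont(3) dom_D_subset_Sigma])
  thus ?thesis by (rule continuous_on_eq) (simp add: law_eq mem_dom_D)
qed

lemma u_mult: "u i n x * n = - (\<epsilon> i x * \<bar>n\<bar> * f i (\<epsilon> i x * \<bar>n\<bar>))"
  by (simp add: u_def sgn_if abs_if)

lemma W_eq: "W x = - (u 1 (nu1 x) x * nu1 x + u 2 (nu2 x) x * nu2 x + u 3 (nu3 x) x * nu3 x)"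
  by (simp add: W_def u_mult)

lemma W_cont: "continuous_on dom_Sigma W"
  unfolding W_eq[abs_def]
  by (intro continuous_on_minus continuous_on_add continuous_on_mult inputs_cont nu_cont_Sigma)

lemma grad_closed_loop: "grad x \<bullet> closed_loop x = - W x"
  by (simp add: closed_loop_def grad_inner_inputs W_eq)

lemma gain_product_nonneg:
  assumes i: "i \<in> {1..3}" and x: "x \<in> dom_Sigma"
  shows "0 \<le> \<epsilon> i x * \<bar>n\<bar> * f i (\<epsilon> i x * \<bar>n\<bar>)"
    and "\<epsilon> i x * \<bar>n\<bar> * f i (\<epsilon> i x * \<bar>n\<bar>) = 0 \<Longrightarrow> n = 0"
proof -
  have p: "0 < \<epsilon> i x * \<bar>n\<bar> * f i (\<epsilon> i x * \<bar>n\<bar>)" if "n \<noteq> 0"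
    using that \<epsilon>_pos[OF i x] by (intro mult_pos_pos f_pos[OF i]) auto
  show "0 \<le> \<epsilon> i x * \<bar>n\<bar> * f i (\<epsilon> i x * \<bar>n\<bar>)"
    using p by (cases "n = 0") (simp_all add: order.strict_implies_order)
  show "\<epsilon> i x * \<bar>n\<bar> * f i (\<epsilon> i x * \<bar>n\<bar>) = 0 \<Longrightarrow> n = 0"
    using p by (metis less_irrefl)
qed

lemma W_nonneg: "x \<in> dom_Sigma \<Longrightarrow> 0 \<le> W x"
  unfolding W_def by (intro add_nonneg_nonneg gain_product_nonneg) auto

lemma W_zero_imp:
  assumes "x \<in> dom_Sigma" "W x = 0" shows "x = 0"
proof -
  note n = gain_product_nonneg(1)[OF _ assms(1)]
  have z: "\<epsilon> 1 x * \<bar>nu1 x\<bar> * f 1 (\<epsilon> 1 x * \<bar>nu1 x\<bar>) = 0"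
    "\<epsilon> 2 x * \<bar>nu2 x\<bar> * f 2 (\<epsilon> 2 x * \<bar>nu2 x\<bar>) = 0"
    "\<epsilon> 3 x * \<bar>nu3 x\<bar> * f 3 (\<epsilon> 3 x * \<bar>nu3 x\<bar>) = 0"
    using assms(2) n[of 1 "nu1 x"] n[of 2 "nu2 x"] n[of 3 "nu3 x"] by (simp_all add: W_def add_nonneg_eq_0_iff)
  show ?thesis
    by (rule nu_eq_zero_imp[OF assms(1)])
      (rule gain_product_nonneg(2)[OF _ assms(1) z(1)] gain_product_nonneg(2)[OF _ assms(1) z(2)]
        gain_product_nonneg(2)[OF _ assms(1) z(3)], simp)+
qed

lemma zero_in_Sigma: "0 \<in> dom_Sigma"
  by (simp add: mem_dom_Sigma strip_def)

lemma W_zero: "W 0 = 0"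
proof -
  have "nu2 0 = 0" "nu3 0 = 0" by (simp_all add: nu2_def nu3_def E1_eq E2_eq tan_los_def eta_def)
  moreover have "nu1 0 = 0"
    by (simp add: nu1_def g1_bar_eq grad_def)
  ultimately show ?thesis by (simp add: W_def)
qed

lemma integral_curve_iff: "solution law I X \<longleftrightarrow> integral_curve closed_loop dom_D I X"
  by (auto simp: solution_def integral_curve_def vehicle_law)

lemma V_along:
  assumes "integral_curve closed_loop dom_D I X" "t \<in> I"
  shows "((\<lambda>t. V (X t)) has_real_derivative - W (X t)) (at t within I)"
proof -
  have "X t \<in> strip" using assms by (auto simp: integral_curve_def mem_dom_D)
  moreover have "(X has_derivative (\<lambda>h. h *\<^sub>R closed_loop (X t))) (at t within I)"
    using assms by (auto simp: integral_curve_def has_vector_derivative_def)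
  ultimately have "((\<lambda>t. V (X t)) has_derivative (\<lambda>h. grad (X t) \<bullet> (h *\<^sub>R closed_loop (X t)))) (at t within I)"
    by (rule has_derivative_compose[rotated, OF V_deriv])
  thus ?thesis
    unfolding has_field_derivative_def
    by (rule has_derivative_eq_rhs) (simp add: fun_eq_iff grad_closed_loop)
qed

lemma V_decreases:
  assumes X: "integral_curve closed_loop dom_D I X" and "{a..b} \<subseteq> I" "a \<le> b"
  shows "V (X b) \<le> V (X a)"
proof (rule antimono_of_nonpos_derivative[OF \<open>a \<le> b\<close>])
  fix t assume t: "t \<in> {a..b}"
  show "((\<lambda>t. V (X t)) has_real_derivative - W (X t)) (at t within {a..b})"
    by (rule has_field_derivative_subset[OF V_along[OF X]]) (use assms t in auto)
  have "t \<in> I" using assms t by auto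
  hence "X t \<in> dom_Sigma" using X dom_D_subset_Sigma by (auto simp: integral_curve_def)
  thus "- W (X t) \<le> 0" using W_nonneg by simp
qed

text \<open>The factor \<open>\<rho>\<close> in the first component of \<open>g1_bar\<close> makes \<open>\<rho>\<close> satisfy a linear equation with
  bounded coefficient on sublevel sets.\<close>

lemma distance_rate:
  obtains \<kappa> where "continuous_on dom_Sigma \<kappa>" "\<And>x. dist_of (closed_loop x) = dist_of x * \<kappa> x"
proof
  let ?\<kappa> = "\<lambda>x. u 1 (nu1 x) x * (sin (pitch x) * sin (elevation x) - cos (pitch x) * cos (elevation x) * cos (los_angle x))"
  show "continuous_on dom_Sigma ?\<kappa>"
    by (intro continuous_intros inputs_cont)
  show "dist_of (closed_loop x) = dist_of x * ?\<kappa> x" for x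
    by (simp add: closed_loop_def dist_of_def g1_bar_eq g2_def g3_bar_def)
qed

lemma dist_of_along:
  assumes "integral_curve closed_loop dom_D I X" "t \<in> I"
  shows "((\<lambda>t. dist_of (X t)) has_real_derivative dist_of (closed_loop (X t))) (at t within I)"
proof -
  have "(X has_derivative (\<lambda>h. h *\<^sub>R closed_loop (X t))) (at t within I)"
    using assms by (auto simp: integral_curve_def has_vector_derivative_def)
  hence "((\<lambda>t. dist_of (X t)) has_derivative (\<lambda>h. dist_of (h *\<^sub>R closed_loop (X t)))) (at t within I)"
    by (rule has_derivative_compose) (rule coordinate_derivs)
  thus ?thesis
    unfolding has_field_derivative_def
    by (rule has_derivative_eq_rhs) (simp add: fun_eq_iff dist_of_def)
qed

text \<open>Along a solution \<open>V\<close> decreases, and \<open>\<rho> * exp (M * t)\<close> does not decrease if \<open>M\<close> bounds the relative rate of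
  \<open>\<rho>\<close> on the sublevel set.  So on a bounded time interval \<open>\<rho>\<close> stays above a positive constant.\<close>

lemma confined:
  assumes X: "integral_curve closed_loop dom_D {a..<T} X" and "a < T"
  shows "\<exists>K. compact K \<and> K \<subseteq> {x \<in> dom_D. V x \<le> V (X a)} \<and> X ` {a..<T} \<subseteq> K"
proof -
  let ?C = "{x \<in> dom_Sigma. V x \<le> V (X a)}"
  have inD: "X t \<in> dom_D" if "t \<in> {a..<T}" for t using X that by (auto simp: integral_curve_def)
  have Va: "V (X t) \<le> V (X a)" if "t \<in> {a..<T}" for t
    using that by (intro V_decreases[OF X]) auto
  have inC: "X t \<in> ?C" if "t \<in> {a..<T}" for t
    using inD[OF that] Va[OF that] dom_D_subset_Sigma by auto
  obtain \<kappa> where \<kappa>: "continuous_on dom_Sigma \<kappa>" "\<And>x. dist_of (closed_loop x) = dist_of x * \<kappa> x"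
    by (rule distance_rate) blast
  have "compact (\<kappa> ` ?C)"
    by (intro compact_continuous_image compact_sublevel continuous_on_subset[OF \<kappa>(1)]) auto
  hence "bounded (\<kappa> ` ?C)" by (rule compact_imp_bounded)
  then obtain M where bound: "\<forall>y\<in>\<kappa> ` ?C. norm y \<le> M" unfolding bounded_iff by blast
  have M: "\<bar>\<kappa> x\<bar> \<le> M" if "x \<in> ?C" for x
    using bspec[OF bound imageI[OF that, of \<kappa>]] by simp
  have "\<bar>\<kappa> (X a)\<bar> \<le> M" using \<open>a < T\<close> by (intro M inC) simp
  hence M0: "0 \<le> M" by linarith
  \<comment> \<open>The value at time \<open>T\<close> of the solution of \<open>r' = - M * r\<close> that starts at \<open>dist_of (X a)\<close>.\<close>
  define r where "r = dist_of (X a) * exp (- (M * (T - a)))"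
  have r: "0 < r" using inD[of a] \<open>a < T\<close> by (simp add: r_def mem_dom_D)
  have below: "r \<le> dist_of (X t)" if t: "t \<in> {a..<T}" for t
  proof -
    have pos: "0 < dist_of (X s)" if "s \<in> {a..t}" for s using inD[of s] that t by (simp add: mem_dom_D)
    \<comment> \<open>The growth factor compensates the fastest possible decay of the distance.\<close>
    have "- (dist_of (X t) * exp (M * (t - a))) \<le> - (dist_of (X a) * exp (M * (a - a)))"
    proof (rule antimono_of_nonpos_derivative[where f = "\<lambda>s. - (dist_of (X s) * exp (M * (s - a)))"])
      show "a \<le> t" using t by simp
      fix s assume s: "s \<in> {a..t}"
      hence s': "s \<in> {a..<T}" using t by simp
      have d: "((\<lambda>s. dist_of (X s)) has_real_derivative dist_of (X s) * \<kappa> (X s)) (at s within {a..t})"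
        by (rule has_field_derivative_subset[OF dist_of_along[OF X s', unfolded \<kappa>(2)]]) (use t in auto)
      show "((\<lambda>s. - (dist_of (X s) * exp (M * (s - a)))) has_real_derivative
          - (dist_of (X s) * (\<kappa> (X s) + M) * exp (M * (s - a)))) (at s within {a..t})"
        by (rule derivative_eq_intros d refl)+ (simp add: algebra_simps)
      have "0 \<le> \<kappa> (X s) + M" using M[OF inC[OF s']] by linarith
      thus "- (dist_of (X s) * (\<kappa> (X s) + M) * exp (M * (s - a))) \<le> 0"
        using pos[OF s] by (simp add: mult_nonneg_nonneg)
    qed
    hence "dist_of (X a) \<le> dist_of (X t) * exp (M * (t - a))" by simp
    also have "\<dots> \<le> dist_of (X t) * exp (M * (T - a))"
      using pos[of t] t M0 by (intro mult_left_mono) (auto intro: mult_left_mono)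
    finally show ?thesis by (simp add: r_def exp_minus divide_inverse[symmetric] pos_divide_le_eq)
  qed
  define K where "K = ?C \<inter> {x. r \<le> dist_of x}"
  have "compact K"
    unfolding K_def by (intro compact_Int_closed compact_sublevel closed_Collect_le continuous_intros)
  moreover have "K \<subseteq> {x \<in> dom_D. V x \<le> V (X a)}"
    using r by (auto simp: K_def mem_dom_D mem_dom_Sigma)
  moreover have "X ` {a..<T} \<subseteq> K" using inC below by (auto simp: K_def)
  ultimately show ?thesis by blast
qed

text \<open>The open set \<open>S\<close> uses the level \<open>V x + 1\<close>, so that it contains the compact subsets of
  \<open>V \<le> V x\<close> that \<open>confined\<close> provides.\<close>

lemma global_solution:
  assumes x: "x \<in> dom_D"
  shows "\<exists>X. X 0 = x \<and> integral_curve closed_loop dom_D {0..} X"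
proof -
  define S where "S = {y \<in> dom_D. V y < V x + 1}"
  have S: "S = dom_D \<inter> V -` {..<V x + 1}" by (auto simp: S_def)
  let ?C = "{y \<in> dom_Sigma. V y \<le> V x + 1}"
  have "\<exists>X. X 0 = x \<and> integral_curve closed_loop S {0..} X"
  proof (rule integral_curve_global[of S ?C])
    show "open S"
      unfolding S
      by (intro continuous_open_preimage[OF continuous_on_subset[OF V_cont]] open_dom_D open_lessThan)
        (use dom_D_subset_Sigma dom_Sigma_subset_strip in blast)
    show "compact ?C" by (rule compact_sublevel)
    show "S \<subseteq> ?C" using dom_D_subset_Sigma by (auto simp: S_def)
    show "continuous_on ?C closed_loop" by (rule continuous_on_subset[OF closed_loop_cont]) auto
    show "x \<in> S" using x by (simp add: S_def)
    fix X :: "real \<Rightarrow> state" and T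
    assume X: "0 < T" "X 0 = x" "integral_curve closed_loop S {0..<T} X"
    have "integral_curve closed_loop dom_D {0..<T} X"
      by (rule integral_curve_mono[OF X(3)]) (auto simp: S_def)
    from confined[OF this X(1)] obtain K
      where K: "compact K" "K \<subseteq> {y \<in> dom_D. V y \<le> V (X 0)}" "X ` {0..<T} \<subseteq> K"
      by blast
    have "{y \<in> dom_D. V y \<le> V (X 0)} \<subseteq> S" using X(2) by (auto simp: S_def)
    thus "\<exists>K. compact K \<and> K \<subseteq> S \<and> X ` {0..<T} \<subseteq> K" using K by blast
  qed
  moreover have "S \<subseteq> dom_D" by (auto simp: S_def)
  ultimately show ?thesis using integral_curve_mono by blast
qed

theorem law_forward_complete: "forward_complete law"
  unfolding forward_complete_def
proof (intro conjI allI ballI impI)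
  fix t0 :: real and x assume "x \<in> dom_D"
  then obtain X where X: "X 0 = x" "integral_curve closed_loop dom_D {0..} X" using global_solution by blast
  show "\<exists>X. solution law {t0..} X \<and> X t0 = x"
    using integral_curve_shift[OF X(2), of t0] X(1)
    by (intro exI[of _ "\<lambda>t. X (t - t0)"]) (simp add: integral_curve_iff)
next
  fix t0 T :: real and X assume "t0 < T \<and> solution law {t0..<T} X"
  hence T: "t0 < T" and X: "integral_curve closed_loop dom_D {t0..<T} X" by (auto simp: integral_curve_iff)
  obtain K where K: "compact K" "K \<subseteq> {x \<in> dom_D. V x \<le> V (X t0)}" "X ` {t0..<T} \<subseteq> K"
    using confined[OF X T] by blast
  have "K \<subseteq> dom_D" using K(2) by blast
  hence "\<exists>Z. integral_curve closed_loop dom_D {t0..} Z \<and> (\<forall>t\<in>{t0..<T}. Z t = X t)"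
    using global_solution continuous_on_subset[OF closed_loop_cont dom_D_subset_Sigma]
    by (intro integral_curve_continuation[OF X T K(1) _ K(3)]) auto
  thus "\<exists>Y. solution law {t0..} Y \<and> (\<forall>t\<in>{t0..<T}. Y t = X t)" by (simp add: integral_curve_iff)
qed

lemma V_decay:
  obtains b where "class_KL b"
    "\<And>X t0 t. integral_curve closed_loop dom_D {t0..} X \<Longrightarrow> t0 \<le> t \<Longrightarrow> V (X t) \<le> b (V (X t0)) (t - t0)"
proof -
  obtain \<alpha> :: "real \<Rightarrow> real" where \<alpha>: "continuous_on {0<..} \<alpha>" "\<And>s. 0 < s \<Longrightarrow> 0 < \<alpha> s" "\<And>s. 0 < s \<Longrightarrow> \<alpha> s \<le> s"
    "\<And>x. x \<in> dom_Sigma \<Longrightarrow> \<alpha> (V x) \<le> W x"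
  proof (rule decay_rate_of_positive_definite[of dom_Sigma V W 0])
    show "continuous_on dom_Sigma V" by (rule continuous_on_subset[OF V_cont dom_Sigma_subset_strip])
    show "V x = 0" if "x \<in> dom_Sigma" "W x = 0" for x using W_zero_imp[OF that] V_zero by simp
  qed (auto intro: W_cont compact_sublevel W_nonneg zero_in_Sigma V_zero W_zero)
  obtain b where b: "class_KL b" "\<And>v d t0 t. t0 \<le> t \<Longrightarrow>
       (\<And>s. s \<in> {t0..t} \<Longrightarrow> 0 < v s) \<Longrightarrow>
       (\<And>s. s \<in> {t0..t} \<Longrightarrow> (v has_real_derivative d s) (at s within {t0..t})) \<Longrightarrow>
       (\<And>s. s \<in> {t0..t} \<Longrightarrow> d s \<le> - \<alpha> (v s)) \<Longrightarrow>
       v t \<le> b (v t0) (t - t0)"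
    using class_KL_of_decay_rate[OF \<alpha>(1-3)] by metis
  have "V (X t) \<le> b (V (X t0)) (t - t0)" if X: "integral_curve closed_loop dom_D {t0..} X" and "t0 \<le> t" for X t0 t
  proof (rule b(2)[of t0 t "\<lambda>t. V (X t)" "\<lambda>t. - W (X t)", OF \<open>t0 \<le> t\<close>])
    fix s assume s: "s \<in> {t0..t}"
    have D: "X s \<in> dom_D" using X s by (auto simp: integral_curve_def)
    show "0 < V (X s)" using V_pos[OF D] .
    show "((\<lambda>t. V (X t)) has_real_derivative - W (X s)) (at s within {t0..t})"
      by (rule has_field_derivative_subset[OF V_along[OF X]]) (use s in auto)
    show "- W (X s) \<le> - \<alpha> (V (X s))" using \<alpha>(4)[of "X s"] D dom_D_subset_Sigma by auto
  qed
  with b(1) show ?thesis by (rule that)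
qed

text \<open>The decay of \<open>V\<close> is transported to \<open>norm_D\<close> by the quadratic bounds.\<close>

theorem law_GAS: "GAS law"
proof -
  obtain b where b: "class_KL b"
    "\<And>X t0 t. integral_curve closed_loop dom_D {t0..} X \<Longrightarrow> t0 \<le> t \<Longrightarrow> V (X t) \<le> b (V (X t0)) (t - t0)"
    using V_decay by metis
  obtain A where A: "0 < A" "\<And>x. x \<in> dom_Sigma \<Longrightarrow> V x \<le> A * (norm_D x)\<^sup>2" using V_le_norm_D by blast
  obtain B where B: "0 < B" "\<And>x. x \<in> dom_Sigma \<Longrightarrow> norm_D x \<le> B * sqrt (V x)" using norm_D_le_V by blast
  have KA: "class_K (\<lambda>r. A * r\<^sup>2)"
    unfolding class_K_def using A(1)
    by (auto intro!: continuous_intros strict_mono_onI power_strict_mono)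
  have KB: "class_K (\<lambda>s. B * sqrt s)"
    unfolding class_K_def using B(1) by (auto intro!: continuous_intros strict_mono_onI)
  have "norm_D (X t) \<le> B * sqrt (b (A * (norm_D (X t0))\<^sup>2) (t - t0))"
    if X: "solution law {t0..} X" and t: "t0 \<le> t" for X t0 t
  proof -
    have X': "integral_curve closed_loop dom_D {t0..} X" using X by (simp add: integral_curve_iff)
    have D: "X s \<in> dom_Sigma" if "t0 \<le> s" for s
      using X' that dom_D_subset_Sigma by (auto simp: integral_curve_def)
    have "V (X t) \<le> b (V (X t0)) (t - t0)" by (rule b(2)[OF X' t])
    also have "\<dots> \<le> b (A * (norm_D (X t0))\<^sup>2) (t - t0)"
    proof (rule strict_mono_on_leD[of "{0..}" "\<lambda>r. b r (t - t0)"])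
      show "strict_mono_on {0..} (\<lambda>r. b r (t - t0))" using b(1) t by (auto simp: class_KL_def class_K_def)
      show "V (X t0) \<le> A * (norm_D (X t0))\<^sup>2" by (rule A(2)[OF D]) simp
    qed (use A(1) V_nonneg in auto)
    finally have "B * sqrt (V (X t)) \<le> B * sqrt (b (A * (norm_D (X t0))\<^sup>2) (t - t0))"
      using B(1) by simp
    thus ?thesis using B(2)[OF D[OF t]] by linarith
  qed
  hence "\<exists>b. class_KL b \<and> (\<forall>t0 X. solution law {t0..} X \<longrightarrow> (\<forall>t\<ge>t0. norm_D (X t) \<le> b (norm_D (X t0)) (t - t0)))"
    using class_KL_compose[OF b(1) KB KA] by blast
  thus ?thesis using law_cont law_forward_complete by (simp add: GAS_def)
qed

end

section \<open>Optimality\<close>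

lemma emeasure_lborel_half_line: "emeasure lborel {0::real..} = \<infinity>"
proof -
  have "(SUP n. of_nat n :: ennreal) \<le> emeasure lborel {0::real..}"
  proof (rule SUP_least)
    fix n
    have "(of_nat n :: ennreal) = emeasure lborel {0..real n}" by (simp add: ennreal_of_nat_eq_real_of_nat)
    also have "\<dots> \<le> emeasure lborel {0::real..}" by (rule emeasure_mono) auto
    finally show "(of_nat n :: ennreal) \<le> emeasure lborel {0::real..}" .
  qed
  thus ?thesis by (simp add: ennreal_SUP_of_nat_eq_top top_unique)
qed

text \<open>Both laws of the theorem are gain feedbacks; the two interpretations below share the closed-loop
  results.\<close>

locale inverse_optimal = clf_gains +
  fixes w :: "nat \<Rightarrow> ereal" and \<mu> :: "nat \<Rightarrow> real \<Rightarrow> real" and \<epsilon> :: "nat \<Rightarrow> state \<Rightarrow> real"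
  assumes yp: "\<And>i. i \<in> {1..3} \<Longrightarrow> young_pair (w i) (\<mu> i)"
    and eps: "\<And>i. i \<in> {1..3} \<Longrightarrow> continuous_on dom_Sigma (\<epsilon> i)"
      "\<And>i x. i \<in> {1..3} \<Longrightarrow> x \<in> dom_Sigma \<Longrightarrow> 0 < \<epsilon> i x"
begin

sublocale opt: gain_feedback k "\<lambda>i. inv_deriv (w i) (\<mu> i)" \<epsilon>
  by unfold_locales
    (use eps young_pair.\<phi>_cont[OF yp] young_pair.\<phi>_zero[OF yp] young_pair.\<phi>_pos[OF yp] in auto)

sublocale stab: gain_feedback k "\<lambda>i s. legendre (w i) (\<mu> i) s / s" \<epsilon>
  by unfold_locales
    (use eps young_pair.legendre_quotient_cont[OF yp] young_pair.legendre_pos[OF yp] in auto)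

abbreviation "Leg i \<equiv> legendre (w i) (\<mu> i)"
abbreviation "Phi i \<equiv> inv_deriv (w i) (\<mu> i)"
abbreviation "cost \<equiv> cost_J k w \<mu> \<epsilon>"
abbreviation "running \<equiv> running_cost k w \<mu> \<epsilon>"

lemma channels: "1 \<in> {1..3::nat}" "2 \<in> {1..3::nat}" "3 \<in> {1..3::nat}"
  by simp_all

lemma optimal_law_eq: "optimal_law w \<mu> \<epsilon> = gain_law (\<lambda>i. inv_deriv (w i) (\<mu> i)) \<epsilon>"
  by (simp add: optimal_law_def gain_law_def fun_eq_iff)

lemma stabilizing_law_eq: "stabilizing_law w \<mu> \<epsilon> = gain_law (\<lambda>i s. legendre (w i) (\<mu> i) s / s) \<epsilon>"
  by (simp add: stabilizing_law_def gain_law_def fun_eq_iff)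

text \<open>The state cost is exactly the dissipation of the stabilizing law, so it is continuous and
  positive definite.\<close>

lemma state_cost_eq:
  assumes x: "x \<in> dom_Sigma"
  shows "state_cost k w \<mu> \<epsilon> x = stab.W x"
proof -
  have L: "\<epsilon> i x * \<bar>n\<bar> * (Leg i (\<epsilon> i x * \<bar>n\<bar>) / (\<epsilon> i x * \<bar>n\<bar>)) = Leg i (\<epsilon> i x * \<bar>n\<bar>)" if "i \<in> {1..3}" for i n
    using eps(2)[OF that x] young_pair.legendre_zero[OF yp[OF that]] by simp
  have "x \<in> strip" using x dom_Sigma_subset_strip by blast
  thus ?thesis
    unfolding state_cost_def stab.W_def
    by (simp only: nu_eq prod.case L[OF channels(1)] L[OF channels(2)] L[OF channels(3)])
qed

lemma state_cost_split:
  assumes x: "x \<in> dom_Sigma"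
  shows "ennreal (state_cost k w \<mu> \<epsilon> x) = ennreal (Leg 1 (\<epsilon> 1 x * \<bar>nu1 x\<bar>))
    + ennreal (Leg 2 (\<epsilon> 2 x * \<bar>nu2 x\<bar>)) + ennreal (Leg 3 (\<epsilon> 3 x * \<bar>nu3 x\<bar>))"
proof -
  have n: "0 \<le> Leg i (\<epsilon> i x * \<bar>n\<bar>)" if "i \<in> {1..3}" for i n
    using young_pair.legendre_nonneg[OF yp[OF that]] eps(2)[OF that x] by simp
  have "x \<in> strip" using x dom_Sigma_subset_strip by blast
  thus ?thesis by (simp add: state_cost_def nu_eq ennreal_plus n)
qed

text \<open>Young's inequality in each channel, with \<open>b = \<epsilon>_i * \<bar>\<nu>_i\<bar>\<close> and \<open>a\<close> the argument of the penalty.  The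
  absolute value on the left matters: the cost bounds increases of \<open>V\<close> as well as decreases.\<close>

lemma running_cost_ge_power:
  assumes x: "x \<in> dom_D"
  shows "ennreal \<bar>grad x \<bullet> vehicle x c\<bar> \<le> running x c"
proof (cases c)
  case (fields v q s)
  have xS: "x \<in> dom_Sigma" using x dom_D_subset_Sigma by blast
  have r: "0 < dist_of x" using x by (simp add: mem_dom_D)
  note e = eps(2)[OF _ xS]
  have e': "0 < \<epsilon> 1 x" "0 < \<epsilon> 2 x" "0 < \<epsilon> 3 x" by (simp_all add: e)
  define a where "a = \<bar>v\<bar> / (\<epsilon> 1 x * dist_of x)"
  have a: "0 \<le> a" using e'(1) r by (simp add: a_def)
  have "grad x \<bullet> vehicle x c = v / dist_of x * nu1 x + q * nu2 x + s * nu3 x"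
    unfolding fields by (simp add: vehicle_def grad_inner_inputs dist_of_def)
  also have "\<bar>\<dots>\<bar> \<le> \<bar>v / dist_of x * nu1 x\<bar> + \<bar>q * nu2 x\<bar> + \<bar>s * nu3 x\<bar>"
    by (meson abs_triangle_ineq add_mono order_refl order_trans)
  also have "\<dots> = a * (\<epsilon> 1 x * \<bar>nu1 x\<bar>) + \<bar>q\<bar> / \<epsilon> 2 x * (\<epsilon> 2 x * \<bar>nu2 x\<bar>) + \<bar>s\<bar> / \<epsilon> 3 x * (\<epsilon> 3 x * \<bar>nu3 x\<bar>)"
    using e' r by (simp add: abs_mult a_def)
  finally have "ennreal \<bar>grad x \<bullet> vehicle x c\<bar>
      \<le> ennreal (a * (\<epsilon> 1 x * \<bar>nu1 x\<bar>) + \<bar>q\<bar> / \<epsilon> 2 x * (\<epsilon> 2 x * \<bar>nu2 x\<bar>) + \<bar>s\<bar> / \<epsilon> 3 x * (\<epsilon> 3 x * \<bar>nu3 x\<bar>))"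
    by (rule ennreal_leI)
  also have "\<dots> = ennreal (a * (\<epsilon> 1 x * \<bar>nu1 x\<bar>)) + ennreal (\<bar>q\<bar> / \<epsilon> 2 x * (\<epsilon> 2 x * \<bar>nu2 x\<bar>))
      + ennreal (\<bar>s\<bar> / \<epsilon> 3 x * (\<epsilon> 3 x * \<bar>nu3 x\<bar>))"
    using a e' by (subst ennreal_plus, simp, simp, subst ennreal_plus) simp_all
  also have "\<dots> \<le> (penalty (w 1) (\<mu> 1) a + ennreal (Leg 1 (\<epsilon> 1 x * \<bar>nu1 x\<bar>)))
      + (penalty (w 2) (\<mu> 2) (\<bar>q\<bar> / \<epsilon> 2 x) + ennreal (Leg 2 (\<epsilon> 2 x * \<bar>nu2 x\<bar>)))
      + (penalty (w 3) (\<mu> 3) (\<bar>s\<bar> / \<epsilon> 3 x) + ennreal (Leg 3 (\<epsilon> 3 x * \<bar>nu3 x\<bar>)))"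
    using a e' by (intro add_mono young_pair.young_penalty[OF yp]) (simp_all add: less_imp_le)
  also have "\<dots> = running x c"
    unfolding fields by (simp add: running_cost_def state_cost_split[OF xS] a_def dist_of_def ac_simps)
  finally show ?thesis .
qed

lemma running_cost_ge_state_cost: "ennreal (state_cost k w \<mu> \<epsilon> x) \<le> running x c"
  by (cases c) (simp add: running_cost_def add.assoc)

lemma running_cost_optimal:
  assumes x: "x \<in> dom_D"
  shows "running x (opt.law x) = ennreal (opt.W x)"
proof -
  have xS: "x \<in> dom_Sigma" using x dom_D_subset_Sigma by blast
  have xs: "x \<in> strip" and r: "0 < dist_of x" using x by (simp_all add: mem_dom_D)
  have e: "0 < \<epsilon> 1 x" "0 < \<epsilon> 2 x" "0 < \<epsilon> 3 x" by (simp_all add: eps(2)[OF _ xS])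
  have \<phi>: "0 \<le> Phi i b" "Phi i 0 = 0" if "i \<in> {1..3}" "0 \<le> b" for i b
    using young_pair.\<phi>_nonneg[OF yp] young_pair.\<phi>_zero[OF yp] that by auto
  \<comment> \<open>The argument of each penalty is the maximiser in Young's inequality.\<close>
  have arg: "\<bar>opt.u i n x\<bar> / \<epsilon> i x = Phi i (\<epsilon> i x * \<bar>n\<bar>)" if "i \<in> {1..3}" for i n
    using eps(2)[OF that xS] \<phi>[OF that, of "\<epsilon> i x * \<bar>n\<bar>"]
    by (cases "n = 0") (simp_all add: opt.u_def abs_mult abs_sgn_eq)
  have arg1: "\<bar>dist_of x * opt.u 1 n x\<bar> / (\<epsilon> 1 x * dist_of x) = Phi 1 (\<epsilon> 1 x * \<bar>n\<bar>)" for n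
    using arg[of 1 n] r e by (simp add: abs_mult)
  have eq: "penalty (w i) (\<mu> i) (Phi i (\<epsilon> i x * \<bar>n\<bar>)) + ennreal (Leg i (\<epsilon> i x * \<bar>n\<bar>))
      = ennreal (\<epsilon> i x * \<bar>n\<bar> * Phi i (\<epsilon> i x * \<bar>n\<bar>))" if "i \<in> {1..3}" for i n
    using eps(2)[OF that xS] by (intro young_pair.young_penalty_eq[OF yp[OF that]]) simp
  have "running x (opt.law x) =
      (penalty (w 1) (\<mu> 1) (Phi 1 (\<epsilon> 1 x * \<bar>nu1 x\<bar>)) + ennreal (Leg 1 (\<epsilon> 1 x * \<bar>nu1 x\<bar>)))
      + (penalty (w 2) (\<mu> 2) (Phi 2 (\<epsilon> 2 x * \<bar>nu2 x\<bar>)) + ennreal (Leg 2 (\<epsilon> 2 x * \<bar>nu2 x\<bar>)))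
      + (penalty (w 3) (\<mu> 3) (Phi 3 (\<epsilon> 3 x * \<bar>nu3 x\<bar>)) + ennreal (Leg 3 (\<epsilon> 3 x * \<bar>nu3 x\<bar>)))"
    unfolding opt.law_eq[OF xs] running_cost_def prod.case state_cost_split[OF xS]
    using arg1[of "nu1 x"] arg[of 2 "nu2 x"] arg[of 3 "nu3 x"] by (simp add: dist_of_def ac_simps)
  also have "\<dots> = ennreal (\<epsilon> 1 x * \<bar>nu1 x\<bar> * Phi 1 (\<epsilon> 1 x * \<bar>nu1 x\<bar>))
      + ennreal (\<epsilon> 2 x * \<bar>nu2 x\<bar> * Phi 2 (\<epsilon> 2 x * \<bar>nu2 x\<bar>))
      + ennreal (\<epsilon> 3 x * \<bar>nu3 x\<bar> * Phi 3 (\<epsilon> 3 x * \<bar>nu3 x\<bar>))"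
    by (simp only: eq[OF channels(1)] eq[OF channels(2)] eq[OF channels(3)])
  also have "\<dots> = ennreal (opt.W x)"
    unfolding opt.W_def
    by (simp only: ennreal_plus add_nonneg_nonneg opt.gain_product_nonneg(1)[OF channels(1) xS]
        opt.gain_product_nonneg(1)[OF channels(2) xS] opt.gain_product_nonneg(1)[OF channels(3) xS])
  finally show ?thesis .
qed

lemma nn_integral_lebesgue_on:
  assumes "S \<in> sets lebesgue"
  shows "(\<integral>\<^sup>+t. h t \<partial>lebesgue_on S) = (\<integral>\<^sup>+t. h t * indicator S t \<partial>lebesgue)"
  using assms by (intro nn_integral_restrict_space) simp

lemma admissible_V_change:
  assumes adm: "admissible Y c" and t: "0 \<le> t"
  shows "ennreal \<bar>V (Y t) - V (Y 0)\<bar> \<le> cost Y c"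
proof -
  let ?y = "\<lambda>s. vehicle (Y s) (c s)"
  let ?G = "\<lambda>s. grad (Y s) \<bullet> ?y s"
  have Y: "Y s \<in> dom_D" if "0 \<le> s" for s using adm that by (auto simp: admissible_def)
  have y: "?y absolutely_integrable_on {0..t}" using adm t by (auto simp: admissible_def)
  have yY: "(?y has_integral (Y s - Y 0)) {0..s}" if "s \<in> {0..t}" for s
    using adm that by (simp add: admissible_def)
  have D: "(V has_derivative (\<lambda>h. grad x \<bullet> h)) (at x)" if "x \<in> dom_D" for x
    using that by (intro V_deriv) (simp add: mem_dom_D)
  have gc: "continuous_on dom_D grad"
    by (rule continuous_on_subset[OF grad_cont]) (auto simp: mem_dom_D)
  have Ys: "Y s \<in> dom_D" if "s \<in> {0..t}" for s using Y that by simp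
  note chain = chain_rule_indefinite_integral[OF convex_dom_D D gc t Ys y yY]
  have G: "integrable (lebesgue_on {0..t}) ?G"
    by (rule absolutely_integrable_imp_integrable[OF chain(1)]) simp_all
  have "V (Y t) - V (Y 0) = integral\<^sup>L (lebesgue_on {0..t}) ?G"
    using lebesgue_integral_eq_integral[OF G] chain(2) by simp
  hence "ennreal \<bar>V (Y t) - V (Y 0)\<bar> \<le> (\<integral>\<^sup>+s. norm (?G s) \<partial>lebesgue_on {0..t})"
    using integral_norm_bound_ennreal[OF G] by simp
  also have "\<dots> = (\<integral>\<^sup>+s. ennreal (norm (?G s)) * indicator {0..t} s \<partial>lebesgue)"
    by (rule nn_integral_lebesgue_on) simp
  also have "\<dots> \<le> (\<integral>\<^sup>+s. running (Y s) (c s) * indicator {0..} s \<partial>lebesgue)"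
    using running_cost_ge_power[OF Y]
    by (intro nn_integral_mono) (auto simp: indicator_def)
  also have "\<dots> = cost Y c"
    unfolding cost_J_def by (rule nn_integral_lebesgue_on[symmetric]) simp
  finally show ?thesis .
qed

text \<open>No trajectory can profit from failing to converge, in particular not by escaping to infinity:
  a cost \<open>j < V (Y 0)\<close> would confine \<open>Y\<close> to a compact set away from the origin, where the state cost
  accumulates without bound.\<close>

theorem cost_ge_V:
  assumes adm: "admissible Y c"
  shows "ennreal (V (Y 0)) \<le> cost Y c"
proof (rule ccontr)
  assume "\<not> ennreal (V (Y 0)) \<le> cost Y c"
  hence less: "cost Y c < ennreal (V (Y 0))" by simp
  define j where "j = enn2real (cost Y c)"
  have "cost Y c < top" using less by (rule less_trans) simp
  hence j: "ennreal j = cost Y c" "0 \<le> j" by (simp_all add: j_def)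
  have jV: "j < V (Y 0)"
    using less j by (metis ennreal_less_iff)
  have Y: "Y t \<in> dom_Sigma" if "0 \<le> t" for t
    using adm that dom_D_subset_Sigma by (auto simp: admissible_def)
  have close: "\<bar>V (Y t) - V (Y 0)\<bar> \<le> j" if "0 \<le> t" for t
    using admissible_V_change[OF adm that] j by (metis ennreal_le_iff)
  \<comment> \<open>A compact set that contains the whole trajectory but not the origin.\<close>
  define C where "C = {x \<in> dom_Sigma. V x \<le> V (Y 0) + j} \<inter> V -` {V (Y 0) - j..}"
  have "closed C"
    unfolding C_def
    by (intro continuous_closed_preimage compact_imp_closed compact_sublevel closed_atLeast
        continuous_on_subset[OF V_cont]) (use dom_Sigma_subset_strip in auto)
  hence "compact ({x \<in> dom_Sigma. V x \<le> V (Y 0) + j} \<inter> C)"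
    by (intro compact_Int_closed compact_sublevel)
  moreover have "{x \<in> dom_Sigma. V x \<le> V (Y 0) + j} \<inter> C = C" by (auto simp: C_def)
  ultimately have "compact C" by simp
  have YC: "Y t \<in> C" if "0 \<le> t" for t
    using close[OF that] Y[OF that] by (auto simp: C_def)
  have CS: "C \<subseteq> dom_Sigma" by (auto simp: C_def)
  have "\<exists>x\<in>C. \<forall>z\<in>C. stab.W x \<le> stab.W z"
    using YC[of 0] by (intro continuous_attains_inf \<open>compact C\<close> continuous_on_subset[OF stab.W_cont CS]) auto
  then obtain x where x: "x \<in> C" "\<And>z. z \<in> C \<Longrightarrow> stab.W x \<le> stab.W z" by blast
  have "stab.W x \<noteq> 0"
    using stab.W_zero_imp[of x] x(1) CS V_zero jV by (auto simp: C_def)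
  hence m: "0 < stab.W x" using stab.W_nonneg[of x] x(1) CS by auto
  \<comment> \<open>The state cost is at least its minimum over \<open>C\<close> for an infinite time.\<close>
  have "(\<integral>\<^sup>+t. ennreal (stab.W x) \<partial>lebesgue_on {0::real..}) = ennreal (stab.W x) * emeasure lborel {0::real..}"
    by (simp add: emeasure_restrict_space)
  also note emeasure_lborel_half_line
  also have "ennreal (stab.W x) * \<infinity> = \<infinity>" using m by (simp add: ennreal_mult_top)
  finally have "(\<infinity>::ennreal) = (\<integral>\<^sup>+t. ennreal (stab.W x) \<partial>lebesgue_on {0::real..})" ..
  also have "\<dots> \<le> cost Y c"
    unfolding cost_J_def
  proof (rule nn_integral_mono)
    fix t assume "t \<in> space (lebesgue_on {0::real..})"
    hence t: "0 \<le> t" by simp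
    have "ennreal (stab.W x) \<le> ennreal (state_cost k w \<mu> \<epsilon> (Y t))"
      using x(2)[OF YC[OF t]] state_cost_eq[OF Y[OF t]] by (simp add: ennreal_leI)
    also have "\<dots> \<le> running (Y t) (c t)" by (rule running_cost_ge_state_cost)
    finally show "ennreal (stab.W x) \<le> running (Y t) (c t)" .
  qed
  finally show False using \<open>cost Y c < top\<close> by (simp add: top_unique)
qed

lemma optimal_admissible:
  assumes "solution opt.law {0..} X"
  shows "admissible X (\<lambda>t. opt.law (X t))"
proof -
  have X: "integral_curve opt.closed_loop dom_D {0..} X" using assms by (simp add: opt.integral_curve_iff)
  have XD: "X t \<in> dom_D" if "0 \<le> t" for t using X that by (simp add: integral_curve_def)
  have contX: "continuous_on {0..} X" by (rule integral_curve_continuous_on[OF X])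
  have "continuous_on {0..} (\<lambda>t. opt.law (X t))"
    by (rule continuous_on_compose2[OF opt.law_cont contX]) (use XD in auto)
  hence meas: "(\<lambda>t. opt.law (X t)) \<in> borel_measurable (lebesgue_on {0..})"
    by (rule continuous_imp_measurable_on_sets_lebesgue) simp
  have "continuous_on {0..} (\<lambda>t. opt.closed_loop (X t))"
    by (rule continuous_on_compose2[OF opt.closed_loop_cont contX]) (use XD dom_D_subset_Sigma in auto)
  hence cont: "continuous_on {0..} (\<lambda>t. vehicle (X t) (opt.law (X t)))"
    by (rule continuous_on_eq) (simp add: opt.vehicle_law XD)
  have "(\<lambda>s. vehicle (X s) (opt.law (X s))) absolutely_integrable_on {0..t}" if "0 \<le> t" for t
    by (rule absolutely_integrable_continuous_real) (rule continuous_on_subset[OF cont], auto)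
  moreover have "((\<lambda>s. vehicle (X s) (opt.law (X s))) has_integral (X t - X 0)) {0..t}" if "0 \<le> t" for t
  proof (rule fundamental_theorem_of_calculus[OF that])
    fix s assume s: "s \<in> {0..t}"
    hence "(X has_vector_derivative vehicle (X s) (opt.law (X s))) (at s within {0..})"
      using assms unfolding solution_def by simp
    thus "(X has_vector_derivative vehicle (X s) (opt.law (X s))) (at s within {0..t})"
      by (rule has_vector_derivative_within_subset) auto
  qed
  ultimately show ?thesis using meas XD unfolding admissible_def by blast
qed

text \<open>Under the optimal law the running cost is \<open>- dV/dt\<close>, and \<open>V \<ge> 0\<close>.\<close>

theorem optimal_cost_le_V:
  assumes "solution opt.law {0..} X"
  shows "cost X (\<lambda>t. opt.law (X t)) \<le> ennreal (V (X 0))"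
proof -
  have X: "integral_curve opt.closed_loop dom_D {0..} X" using assms by (simp add: opt.integral_curve_iff)
  have XD: "X t \<in> dom_D" if "0 \<le> t" for t using X that by (simp add: integral_curve_def)
  let ?W = "\<lambda>t. opt.W (X t)"
  have W0: "0 \<le> ?W t" if "0 \<le> t" for t using XD[OF that] dom_D_subset_Sigma by (auto intro: opt.W_nonneg)
  have part: "(\<integral>\<^sup>+t. ennreal (?W t) * indicator {0..real n} t \<partial>lebesgue) \<le> ennreal (V (X 0))" for n
  proof -
    have "((\<lambda>t. - ?W t) has_integral (V (X (real n)) - V (X 0))) {0..real n}"
    proof (rule fundamental_theorem_of_calculus)
      fix t assume t: "t \<in> {0..real n}"
      have "((\<lambda>t. V (X t)) has_real_derivative - ?W t) (at t within {0..real n})"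
        by (rule has_field_derivative_subset[OF opt.V_along[OF X]]) (use t in auto)
      thus "((\<lambda>t. V (X t)) has_vector_derivative - ?W t) (at t within {0..real n})"
        by (simp only: has_real_derivative_iff_has_vector_derivative)
    qed simp
    from has_integral_neg[OF this]
    have "(?W has_integral (V (X 0) - V (X (real n)))) {0..real n}" by (simp only: minus_minus minus_diff_eq)
    hence "(\<integral>\<^sup>+t. ennreal (?W t) * indicator {0..real n} t \<partial>lborel) = ennreal (V (X 0) - V (X (real n)))"
      by (rule nn_integral_has_integral_lebesgue'[rotated]) (use W0 in simp)
    also have "\<dots> \<le> ennreal (V (X 0))" using V_nonneg by (intro ennreal_leI) simp
    finally show ?thesis by (simp add: nn_integral_completion)
  qed
  have "continuous_on {0..} ?W"
    by (rule continuous_on_compose2[OF opt.W_cont integral_curve_continuous_on[OF X]])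
      (use XD dom_D_subset_Sigma in auto)
  hence meas: "(\<lambda>t. ennreal (?W t) * indicator {0..real n} t) \<in> borel_measurable lebesgue" for n
  proof -
    have "continuous_on {0..real n} ?W" by (rule continuous_on_subset[OF \<open>continuous_on {0..} ?W\<close>]) auto
    hence "?W \<in> borel_measurable (lebesgue_on {0..real n})"
      by (rule continuous_imp_measurable_on_sets_lebesgue) simp
    hence "(\<lambda>t. ennreal (?W t)) \<in> borel_measurable (lebesgue_on {0..real n})" by measurable
    thus ?thesis by (subst (asm) borel_measurable_restrict_space_iff_ennreal) simp_all
  qed
  have "cost X (\<lambda>t. opt.law (X t)) = (\<integral>\<^sup>+t. ennreal (?W t) \<partial>lebesgue_on {0..})"
    unfolding cost_J_def by (rule nn_integral_cong) (simp add: running_cost_optimal XD)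
  also have "\<dots> = (\<integral>\<^sup>+t. ennreal (?W t) * indicator {0..} t \<partial>lebesgue)"
    by (rule nn_integral_lebesgue_on) simp
  also have "\<dots> = (\<integral>\<^sup>+t. (SUP n. ennreal (?W t) * indicator {0..real n} t) \<partial>lebesgue)"
  proof (rule nn_integral_cong)
    fix t :: real
    show "ennreal (?W t) * indicator {0..} t = (SUP n. ennreal (?W t) * indicator {0..real n} t)"
    proof (rule antisym)
      obtain n :: nat where "t \<le> real n" using real_arch_simple by blast
      hence eq: "indicator {0..} t = (indicator {0..real n} t :: ennreal)" by (simp add: indicator_def)
      show "ennreal (?W t) * indicator {0..} t \<le> (SUP n. ennreal (?W t) * indicator {0..real n} t)"
        unfolding eq by (rule SUP_upper) simp
      show "(SUP n. ennreal (?W t) * indicator {0..real n} t) \<le> ennreal (?W t) * indicator {0..} t"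
        by (rule SUP_least) (simp add: indicator_def)
    qed
  qed
  also have "\<dots> = (SUP n. \<integral>\<^sup>+t. ennreal (?W t) * indicator {0..real n} t \<partial>lebesgue)"
    by (rule nn_integral_monotone_convergence_SUP[OF _ meas])
      (auto simp: incseq_def le_fun_def indicator_def)
  also have "\<dots> \<le> ennreal (V (X 0))" by (rule SUP_least) (rule part)
  finally show ?thesis .
qed

theorem minimized: "minimized_by cost opt.law"
  unfolding minimized_by_def
proof (intro conjI allI impI)
  show "forward_complete opt.law" by (rule opt.law_forward_complete)
  fix X assume X: "solution opt.law {0..} X"
  show "admissible X (\<lambda>t. opt.law (X t))" by (rule optimal_admissible[OF X])
  show "cost X (\<lambda>t. opt.law (X t)) < \<infinity>"
    using optimal_cost_le_V[OF X] by (rule le_less_trans) simp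
  fix Y c assume "admissible Y c \<and> Y 0 = X 0"
  hence "ennreal (V (X 0)) \<le> cost Y c" using cost_ge_V[of Y c] by simp
  with optimal_cost_le_V[OF X] show "cost X (\<lambda>t. opt.law (X t)) \<le> cost Y c" by (rule order_trans)
qed

end

theorem theorem1:
  fixes k :: "nat \<Rightarrow> real"
    and w :: "nat \<Rightarrow> ereal"
    and \<mu> :: "nat \<Rightarrow> real \<Rightarrow> real"
    and \<epsilon> :: "nat \<Rightarrow> state \<Rightarrow> real"
  assumes "\<forall>i\<in>{1..5}. 0 < k i"
    and "\<forall>i\<in>{1..3}. 0 < w i"
    and "\<forall>i\<in>{1..3}. class_K_inf (w i) (\<mu> i)"
    and "\<forall>i\<in>{1..3}. \<mu> i differentiable_on upto_w (w i)"
    and "\<forall>i\<in>{1..3}. class_K_inf (w i) (deriv_w (w i) (\<mu> i))"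
    and "\<forall>i\<in>{1..3}. continuous_on dom_Sigma (\<epsilon> i) \<and> (\<forall>x\<in>dom_Sigma. 0 < \<epsilon> i x)"
  shows "minimized_by (cost_J k w \<mu> \<epsilon>) (\<lambda>x. optimal_law w \<mu> \<epsilon> x (nu k x)) \<and>
    (\<forall>x\<in>dom_D. continuous_on UNIV (stabilizing_law w \<mu> \<epsilon> x)) \<and>
    GAS (\<lambda>x. stabilizing_law w \<mu> \<epsilon> x (nu k x))"
proof -
  interpret inverse_optimal k w \<mu> \<epsilon>
    by unfold_locales (use assms in \<open>auto simp: young_pair_def\<close>)
  show ?thesis
    unfolding optimal_law_eq stabilizing_law_eq
    using minimized stab.gain_law_cont stab.law_GAS by blast
qed

end
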